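(* Let $c,d$ be positive integers and let $\mathcal{C}$ be a family of graphs closed under taking induced subgraphs such that every $G'\in\mathcal{C}$ satisfies $\mathrm{tw}(G')\le(\Delta(G'))^c$. Let $G\in\mathcal{C}$ have degeneracy at most $d$. Let $k$ be a positive integer, $\mathcal{F}$ a $4d$-neighborhood-witnessing layered family of $G$ with thickness at most $k$ and set of centers $\mathcal{C}_{\mathcal{F}}$, and $X\subseteq\mathcal{C}_{\mathcal{F}}$. Then $G$ has a rooted tree decomposition $(T,\chi)$ with root $r$ such that $\chi(r)\supseteq\bigcup_{w\in X}F_w$ and for every $x\in V(T)$ there exists $X'\subseteq\mathcal{C}_{\mathcal{F}}$ with $|X'|\le\max\{|X|,\,110000k\log^2 2|V(G)|\cdot f\log 4f\}+5000k\log^2 2|V(G)|\cdot f\log 4f$, where $f=(1000000d\cdot k^2\cdot\log^3 2|V(G)|)^c$, and $\chi(x)=\bigcup_{w\in X'}F_w$.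
   Context: Logarithms are base 2; $\mathrm{tw}$ is treewidth and $\Delta$ maximum degree. A rooted tree decomposition is a tree decomposition with a distinguished root node. Layered family: given an ordered partition $\Pi=(L_1,\dots,L_m)$ of $V(G)$, the layer digraph has an arc $(u,v)$ iff $uv\in E(G)$, $u\in L_i$, $v\in L_j$, $j<i$. $v$ is a descendant of $u$ if there is a directed path from $u$ to $v$ (including $v=u$). For each vertex $u$ with no in-arcs, the set $F_u$ of $u$ and all its descendants belongs to $\mathcal{F}$ ($u$ is its center; $\mathcal{C}_{\mathcal{F}}$ is the set of centers). Thickness: smallest $k$ such that every member meets at most $k$ parts of $\Pi$. $\mathcal{F}$ is $4d$-neighborhood-witnessing if for every vertex $v$ and every $F\in\mathcal{F}$ containing $v$, $|N[v]\setminus F|\le 4d$. *)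

theory Defs
  imports
    Complex_Main
    "HOL-Library.Disjoint_Sets"
    "Graph_Theory.Graph_Theory"
begin

text \<open>
  A finite simple graph is a \<^const>\<open>pair_graph\<close>: a finite, loop-free, symmetric set of ordered
  pairs on a vertex set. An undirected edge is thus represented by both of its orientations.
\<close>

definition nbhd :: "'a pair_pre_digraph \<Rightarrow> 'a \<Rightarrow> 'a set" where
  "nbhd G v = {u. (v, u) \<in> parcs G}"

definition closed_nbhd :: "'a pair_pre_digraph \<Rightarrow> 'a \<Rightarrow> 'a set" where
  "closed_nbhd G v = insert v (nbhd G v)"

text \<open>The supremum of the empty set of naturals is 0, so the null graph has maximum degree 0.\<close>

definition max_degree :: "'a pair_pre_digraph \<Rightarrow> nat" where
  "max_degree G = (SUP v\<in>pverts G. card (nbhd G v))"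

definition degeneracy :: "'a pair_pre_digraph \<Rightarrow> nat" where
  "degeneracy G = (LEAST d. \<forall>H :: 'a pair_pre_digraph.
     pair_graph H \<and> subgraph (with_proj H) (with_proj G) \<and> pverts H \<noteq> {} \<longrightarrow>
       (\<exists>v\<in>pverts H. card (nbhd H v) \<le> d))"

definition induced_subgraph_closed :: "'a pair_pre_digraph set \<Rightarrow> bool" where
  "induced_subgraph_closed \<C> \<longleftrightarrow>
     (\<forall>G\<in>\<C>. \<forall>H. induced_subgraph (with_proj H) (with_proj G) \<longrightarrow> H \<in> \<C>)"


text \<open>
  \<^const>\<open>forest\<close> forbids all directed cycles, so it excludes every symmetric digraph with an
  edge, since \<open>a, b, a\<close> is a directed cycle. The cycles of a simple graph are the directed
  cycles of length at least 3 of its symmetric digraph.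
\<close>

definition undirected_tree :: "'b pair_pre_digraph \<Rightarrow> bool" where
  "undirected_tree T \<longleftrightarrow> pair_graph T \<and> Digraph_Component.connected (with_proj T) \<and>
     \<not> (\<exists>p. pre_digraph.cycle (with_proj T) p \<and> 3 \<le> length p)"

text \<open>
  \<^const>\<open>Digraph_Component.connected\<close> includes non-emptiness, so the last condition also says
  that every vertex lies in some bag.
\<close>

definition tree_decomposition ::
    "'a pair_pre_digraph \<Rightarrow> 'b pair_pre_digraph \<Rightarrow> ('b \<Rightarrow> 'a set) \<Rightarrow> bool" where
  "tree_decomposition G T bag \<longleftrightarrow> undirected_tree T \<and>
     (\<forall>x\<in>pverts T. bag x \<subseteq> pverts G) \<and>
     (\<forall>(u, v)\<in>parcs G. \<exists>x\<in>pverts T. u \<in> bag x \<and> v \<in> bag x) \<and>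
     (\<forall>v\<in>pverts G.
        Digraph_Component.connected (induce_subgraph (with_proj T) {x \<in> pverts T. v \<in> bag x}))"

definition rooted_tree_decomposition ::
    "'a pair_pre_digraph \<Rightarrow> 'b pair_pre_digraph \<Rightarrow> ('b \<Rightarrow> 'a set) \<Rightarrow> 'b \<Rightarrow> bool" where
  "rooted_tree_decomposition G T bag r \<longleftrightarrow> tree_decomposition G T bag \<and> r \<in> pverts T"

definition decomposition_width :: "'b pair_pre_digraph \<Rightarrow> ('b \<Rightarrow> 'a set) \<Rightarrow> nat" where
  "decomposition_width T bag = Max ((\<lambda>x. card (bag x)) ` pverts T) - 1"

text \<open>
  Trees are finite, so natural numbers suffice as nodes. The null graph gets treewidth 0
  by truncated subtraction.
\<close>

definition treewidth :: "'a pair_pre_digraph \<Rightarrow> nat" where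
  "treewidth G = (LEAST w. \<exists>(T :: nat pair_pre_digraph) bag.
     tree_decomposition G T bag \<and> decomposition_width T bag = w)"


definition ordered_partition :: "'a set \<Rightarrow> 'a set list \<Rightarrow> bool" where
  "ordered_partition V Ls \<longleftrightarrow> distinct Ls \<and> partition_on V (set Ls)"

definition layer_digraph :: "'a pair_pre_digraph \<Rightarrow> 'a set list \<Rightarrow> 'a pair_pre_digraph" where
  "layer_digraph G Ls = \<lparr> pverts = pverts G,
     parcs = {(u, v) \<in> parcs G. \<exists>i < length Ls. \<exists>j < i. u \<in> Ls ! i \<and> v \<in> Ls ! j} \<rparr>"

definition centers :: "'a pair_pre_digraph \<Rightarrow> 'a set list \<Rightarrow> 'a set" where
  "centers G Ls = {u \<in> pverts G. in_arcs (with_proj (layer_digraph G Ls)) u = {}}"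

definition descendants :: "'a pair_pre_digraph \<Rightarrow> 'a set list \<Rightarrow> 'a \<Rightarrow> 'a set" where
  "descendants G Ls u = {v. reachable (with_proj (layer_digraph G Ls)) u v}"

definition layered_family :: "'a pair_pre_digraph \<Rightarrow> 'a set list \<Rightarrow> 'a set set" where
  "layered_family G Ls = descendants G Ls ` centers G Ls"

definition thickness :: "'a set list \<Rightarrow> 'a set set \<Rightarrow> nat" where
  "thickness Ls \<F> = (LEAST k. \<forall>F\<in>\<F>. card {L \<in> set Ls. F \<inter> L \<noteq> {}} \<le> k)"

definition neighborhood_witnessing ::
    "nat \<Rightarrow> 'a pair_pre_digraph \<Rightarrow> 'a set set \<Rightarrow> bool" where
  "neighborhood_witnessing t G \<F> \<longleftrightarrow>
     (\<forall>v\<in>pverts G. \<forall>F\<in>\<F>. v \<in> F \<longrightarrow> card (closed_nbhd G v - F) \<le> t)"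

end

theory Submission
  imports Defs
begin

text \<open>
  The decomposition is built from the root. A component \<open>C\<close> of the uncovered part is attached to the
  union \<open>F(X)\<close> of the family members with centers in a set \<open>X\<close>; the next bag is \<open>F(X \<union> Y)\<close>, where
  \<open>F(Y)\<close> is a balanced separator for \<open>X\<close>, so that each new component is attached to \<open>F(X')\<close> with
  \<open>X'\<close> no larger than \<open>X\<close>.

  Suppose that there is no small balanced \<open>Y\<close>. Then large subsets \<open>A\<close>, \<open>B\<close> of \<open>X\<close> cannot be
  separated by few members of the family, and rounding a fractional separator turns this into many
  \<open>A\<close>--\<open>B\<close> walks such that each member meets few of them. Any two vertices of a member are joined
  through its center by a walk with at most \<open>2k - 1\<close> vertices that meets no further members, so each
  walk has at most \<open>2k\<close> vertices in each member. With the witnessing property, the subgraph induced by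
  all walks chosen so far has small maximum degree, hence small treewidth and a balanced separator
  \<open>Z\<close>. The cut of \<open>X\<close> given by \<open>Z\<close> is crossed by few of the walks; matching its sides by new walks
  increases the entropy of the random walk on \<open>X\<close> along the matchings by a constant multiple of
  \<open>|X|\<close>. This cannot happen more than \<open>O(log |X|)\<close> times.
\<close>

section \<open>Fractional covers and entropy\<close>

text \<open>The obstacle is that separators are paid for in members of the family, while a vertex
  may lie in many members and a member may have many vertices. So lengths, loads and separators are
  counted in centers, and vertices are counted only inside the union of the chosen walks. The
  constants: let L = log 2 (2|V|). A matching joins 6S pairs with load at most 166 L^2 per member
  and gains entropy at least 2S. The entropy is at most 22S ln (22S), so the total load that matters
  is at most \<open>lam\<close> = 11 ln (22S) * 166 L^2. Degrees in the union of the walks are then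
  at most 4d + 1 + 2k \<open>lam\<close> \<le> \<Delta> = 1000000 d k^2 L^3, the separator Z has at
  most \<Delta>^c + 1 = f + 1 vertices, and at most (f + 1) \<open>lam\<close> walks cross its cut.
  The gain requires this number to be at most 3S/2, which holds for S about 5000 k L^2 f log 4f. A
  set of 22S centers can be cut with at least 7S on either side, and 110000 = 22 * 5000.\<close>

lemma fractional_set_cover:
  fixes F :: "'w \<Rightarrow> 'a set" and z :: "'w \<Rightarrow> real"
  assumes fin: "finite W" "finite U"
    and nonneg: "\<And>w. w \<in> W \<Longrightarrow> 0 \<le> z w"
    and cover: "\<And>v. v \<in> U \<Longrightarrow> 1 \<le> (\<Sum>w\<in>{w\<in>W. v \<in> F w}. z w)"
    and total: "(\<Sum>w\<in>W. z w) \<le> \<tau>"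
  shows "\<exists>Y\<subseteq>W. U \<subseteq> \<Union>(F ` Y) \<and> real (card Y) \<le> \<tau> * ln (real (card U)) + 1"
proof (cases "U = {}")
  case True
  then show ?thesis by (intro exI[of _ "{}"]) auto
next
  case False
  then obtain v0 where "v0 \<in> U" by blast
  have "1 \<le> (\<Sum>w\<in>{w\<in>W. v0 \<in> F w}. z w)" using cover[OF \<open>v0 \<in> U\<close>] .
  also have "\<dots> \<le> (\<Sum>w\<in>W. z w)" using fin nonneg by (intro sum_mono2) auto
  finally have \<tau>: "1 \<le> \<tau>" using total by linarith
  \<comment> \<open>Double counting: the weights \<open>z\<close> cover each vertex of
    \<open>R\<close> at least once with total at most \<tau>, so not every member can meet less than
    a 1/\<tau> part of \<open>R\<close>.\<close>
  have greedy: "\<exists>w\<in>W. real (card R) / \<tau> \<le> real (card (F w \<inter> R))" if R: "R \<subseteq> U" "R \<noteq> {}" for R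
  proof (rule ccontr)
    assume "\<not> ?thesis"
    then have less: "real (card (F w \<inter> R)) < real (card R) / \<tau>" if "w \<in> W" for w
      using that by fastforce
    have finR: "finite R" using R fin finite_subset by blast
    have "real (card R) = (\<Sum>v\<in>R. 1)" by simp
    also have "\<dots> \<le> (\<Sum>v\<in>R. \<Sum>w\<in>{w\<in>W. v \<in> F w}. z w)"
      using R cover by (intro sum_mono) auto
    also have "\<dots> = (\<Sum>w\<in>W. \<Sum>v\<in>{v\<in>R. v \<in> F w}. z w)"
      using fin finR by (rule_tac sum.swap_restrict) auto
    also have "\<dots> = (\<Sum>w\<in>W. z w * real (card (F w \<inter> R)))"
      by (intro sum.cong refl) (simp add: Collect_conj_eq Int_commute mult.commute)
    finally have *: "real (card R) \<le> (\<Sum>w\<in>W. z w * real (card (F w \<inter> R)))" .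
    \<comment> \<open>Some weight must be positive for the comparison of the two sums to be
      strict.\<close>
    obtain w0 where w0: "w0 \<in> W" "0 < z w0"
    proof -
      have "\<exists>w\<in>W. 0 < z w"
      proof (rule ccontr)
        assume "\<not> ?thesis"
        then have "z w = 0" if "w \<in> W" for w using nonneg that by force
        then have "(\<Sum>w\<in>{w\<in>W. v0 \<in> F w}. z w) = 0" by (intro sum.neutral) auto
        with cover[OF \<open>v0 \<in> U\<close>] show False by simp
      qed
      with that show ?thesis by blast
    qed
    have "(\<Sum>w\<in>W. z w * real (card (F w \<inter> R))) < (\<Sum>w\<in>W. z w * (real (card R) / \<tau>))"
    proof (rule sum_strict_mono_ex1)
      show "\<forall>w\<in>W. z w * real (card (F w \<inter> R)) \<le> z w * (real (card R) / \<tau>)"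
        using nonneg less by (intro ballI mult_left_mono) (auto intro: less_imp_le)
      show "\<exists>w\<in>W. z w * real (card (F w \<inter> R)) < z w * (real (card R) / \<tau>)"
        using w0 less mult_strict_left_mono[of _ _ "z w0"] by blast
    qed (use fin in auto)
    also have "\<dots> = (\<Sum>w\<in>W. z w) * (real (card R) / \<tau>)" by (rule sum_distrib_right[symmetric])
    also have "\<dots> \<le> \<tau> * (real (card R) / \<tau>)" using total \<tau> by (intro mult_right_mono) auto
    also have "\<dots> = real (card R)" using \<tau> by simp
    finally show False using * by simp
  qed
  have iter: "\<exists>Y\<subseteq>W. card Y \<le> t \<and> real (card (U - \<Union>(F ` Y))) \<le> real (card U) * (1 - 1/\<tau>)^t" for t
  proof (induction t)
    case 0
    show ?case by (intro exI[of _ "{}"]) auto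
  next
    case (Suc t)
    then obtain Y where Y: "Y \<subseteq> W" "card Y \<le> t"
      "real (card (U - \<Union>(F ` Y))) \<le> real (card U) * (1 - 1/\<tau>)^t" by blast
    let ?R = "U - \<Union>(F ` Y)"
    show ?case
    proof (cases "?R = {}")
      case True
      then have "card (U - \<Union>(F ` Y)) = 0" by (simp only: card.empty)
      then show ?thesis using Y \<tau> by (intro exI[of _ Y]) (auto simp: le_SucI)
    next
      case False
      then obtain w where w: "w \<in> W" "real (card ?R) / \<tau> \<le> real (card (F w \<inter> ?R))"
        using greedy[of ?R] by blast
      have "U - \<Union>(F ` insert w Y) = ?R - (F w \<inter> ?R)" by auto
      then have "card (U - \<Union>(F ` insert w Y)) = card ?R - card (F w \<inter> ?R)"
        using fin by (simp add: card_Diff_subset)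
      moreover have "card (F w \<inter> ?R) \<le> card ?R" using fin by (intro card_mono) auto
      ultimately have "real (card (U - \<Union>(F ` insert w Y))) \<le> real (card ?R) * (1 - 1/\<tau>)"
        using w(2) by (simp add: of_nat_diff algebra_simps)
      also have "\<dots> \<le> real (card U) * (1 - 1/\<tau>)^t * (1 - 1/\<tau>)"
        using Y(3) \<tau> by (intro mult_right_mono) auto
      finally have "real (card (U - \<Union>(F ` insert w Y))) \<le> real (card U) * (1 - 1/\<tau>)^Suc t"
        by (simp add: mult_ac)
      moreover have "card (insert w Y) \<le> Suc t"
        using Y(2) by (metis Suc_le_mono card_insert_le_m1 diff_Suc_1 le_SucI zero_less_Suc)
      ultimately show ?thesis using Y w by (intro exI[of _ "insert w Y"]) auto
    qed
  qed
  have N: "1 \<le> real (card U)" using False fin by (simp add: Suc_leI card_gt_0_iff)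
  \<comment> \<open>The number of greedy steps exceeds \<tau> ln |U|, so less than one element is
    left; rounding costs the \<open>+ 1\<close> of the statement.\<close>
  define t where "t = nat \<lfloor>\<tau> * ln (real (card U))\<rfloor> + 1"
  have nn: "0 \<le> \<tau> * ln (real (card U))" using \<tau> N by simp
  have t1: "\<tau> * ln (real (card U)) < real t" and t2: "real t \<le> \<tau> * ln (real (card U)) + 1"
    unfolding t_def using nn by (simp_all add: of_nat_nat) linarith+
  obtain Y where Y: "Y \<subseteq> W" "card Y \<le> t"
    "real (card (U - \<Union>(F ` Y))) \<le> real (card U) * (1 - 1/\<tau>)^t" using iter[of t] by blast
  have "(1 - 1/\<tau>)^t \<le> exp (- 1/\<tau>)^t"
    using \<tau> exp_ge_add_one_self[of "- 1/\<tau>"] by (intro power_mono) auto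
  also have "\<dots> = exp (- (real t / \<tau>))" by (simp flip: exp_of_nat_mult)
  also have "\<dots> < exp (- ln (real (card U)))" using t1 \<tau> by (simp add: field_simps)
  also have "\<dots> = 1 / real (card U)" using N by (simp add: exp_minus inverse_eq_divide)
  finally have "real (card U) * (1 - 1/\<tau>)^t < 1" using N by (simp add: field_simps)
  then have "card (U - \<Union>(F ` Y)) = 0" using Y(3) by linarith
  then have "U \<subseteq> \<Union>(F ` Y)" using fin by auto
  then show ?thesis using Y t2 by (intro exI[of _ Y]) auto
qed

section \<open>Entropy of a random walk under a matching step\<close>

definition ent :: "real \<Rightarrow> real" where
  "ent x = - x * ln x"

text \<open>The left side is the tangent at \<open>y\<close> of the convex function x ln x,
  evaluated at \<open>a\<close>.\<close>

lemma x_ln_x_ge: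
  fixes a y :: real
  assumes "0 \<le> a" "0 < y"
  shows "a * ln y + a - y \<le> a * ln a"
proof (cases "a = 0")
  case False
  then have a: "0 < a" using assms by simp
  have "ln (y / a) \<le> y / a - 1" using a assms by (intro ln_le_minus_one) simp
  then have "a * (ln y - ln a) \<le> a * (y / a - 1)"
    using a assms by (intro mult_left_mono) (auto simp: ln_div)
  then show ?thesis using a by (simp add: algebra_simps)
qed (use assms in simp)

text \<open>For the first bound, tangents of x ln x are taken at 3/4 and 1/4 of \<open>a + b\<close>
  rather than at the midpoint. Their linear parts cancel because 3/4 + 1/4 = 1, and what remains is
  (a ln (3/2) - b ln 2) / 2, where ln (3/2) \<ge> 1/3 and ln 2 \<le> 1. The bound is useful when
  \<open>b\<close> is much smaller than \<open>a\<close>: averaging two nearly disjoint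
  distributions gains entropy.\<close>

lemma ent_midpoint_gap:
  assumes "0 \<le> a" "0 \<le> b"
  shows "a / 6 - b / 2 \<le> ent ((a + b) / 2) - (ent a + ent b) / 2"
    and "0 \<le> ent ((a + b) / 2) - (ent a + ent b) / 2"
proof -
  have "a / 6 - b / 2 \<le> ent ((a + b) / 2) - (ent a + ent b) / 2 \<and>
    0 \<le> ent ((a + b) / 2) - (ent a + ent b) / 2"
  proof (cases "a + b = 0")
    case True
    then have "a = 0" "b = 0" using assms by auto
    then show ?thesis by (simp add: ent_def)
  next
    case False
    then have s: "0 < a + b" using assms by simp
    let ?l = "ln ((a + b) / 2)"
    have l: "2 * (3/4) = (3/2::real)" "2 * (1/4) = (1/2::real)" by simp_all
    have split: "ln ((a + b) * r) = ?l + ln (2 * r)" if "0 < r" for r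
    proof -
      have "(a + b) * r = (a + b) / 2 * (2 * r)" by simp
      then show ?thesis using s that ln_mult[of "(a + b) / 2" "2 * r"] by simp
    qed
    have "a * ln ((a + b) * (3/4)) + a - (a + b) * (3/4) \<le> a * ln a"
      and "b * ln ((a + b) * (1/4)) + b - (a + b) * (1/4) \<le> b * ln b"
      using assms s by (auto intro!: x_ln_x_ge)
    then have "a * (?l + ln (3/2)) + a - (a + b) * (3/4) \<le> a * ln a"
      "b * (?l + ln (1/2)) + b - (a + b) * (1/4) \<le> b * ln b"
      by (simp_all only: split[of "3/4"] split[of "1/4"] l zero_less_divide_iff zero_less_numeral zero_less_one simp_thms)
    then have 1: "a * (?l + ln (3/2)) + b * (?l + ln (1/2)) \<le> a * ln a + b * ln b"
      by argo
    have 2: "a * ?l + b * ?l \<le> a * ln a + b * ln b"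
      using x_ln_x_ge[OF assms(1), of "(a+b)/2"] x_ln_x_ge[OF assms(2), of "(a+b)/2"] s
      by (simp add: field_simps)
    have "ln (2/3::real) \<le> 2/3 - 1" by (intro ln_le_minus_one) simp
    then have "1/3 \<le> ln (3/2::real)" by (simp add: ln_div)
    then have 3: "a / 3 \<le> a * ln (3/2)" using mult_left_mono[OF _ assms(1)] by fastforce
    have "ln (2::real) \<le> 1" using ln_le_minus_one[of "2::real"] by simp
    then have 4: "- b \<le> b * ln (1/2)"
      using mult_left_mono[OF _ assms(2), of "- 1" "ln (1/2)"] by (simp add: ln_div)
    have e: "ent ((a + b) / 2) = - (a * ?l + b * ?l) / 2" "ent a = - (a * ln a)" "ent b = - (b * ln b)"
      by (simp_all add: ent_def field_simps)
    have "a * (?l + ln (3/2)) = a * ?l + a * ln (3/2)" "b * (?l + ln (1/2)) = b * ?l + b * ln (1/2)"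
      by (simp_all add: algebra_simps)
    then show ?thesis unfolding e using 1 2 3 4 by argo
  qed
  then show "a / 6 - b / 2 \<le> ent ((a + b) / 2) - (ent a + ent b) / 2"
    and "0 \<le> ent ((a + b) / 2) - (ent a + ent b) / 2" by auto
qed

definition stochastic_on :: "'a set \<Rightarrow> ('a \<Rightarrow> 'a \<Rightarrow> real) \<Rightarrow> bool" where
  "stochastic_on X p \<longleftrightarrow> (\<forall>u\<in>X. (\<forall>s\<in>X. 0 \<le> p u s) \<and> (\<Sum>s\<in>X. p u s) = 1)"

definition entropy_on :: "'a set \<Rightarrow> ('a \<Rightarrow> 'a \<Rightarrow> real) \<Rightarrow> real" where
  "entropy_on X p = (\<Sum>u\<in>X. \<Sum>s\<in>X. ent (p u s))"

definition foreign_mass :: "'a set \<Rightarrow> 'a set \<Rightarrow> ('a \<Rightarrow> 'a \<Rightarrow> real) \<Rightarrow> 'a \<Rightarrow> real" where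
  "foreign_mass X A p u = (if u \<in> A then \<Sum>s\<in>X - A. p u s else \<Sum>s\<in>A. p u s)"

text \<open>Measures how far the walk has mixed across the cut. If it is small, rows on different
  sides are nearly disjoint, and averaging across the cut gains entropy.\<close>

definition cross_mass :: "'a set \<Rightarrow> 'a set \<Rightarrow> ('a \<Rightarrow> 'a \<Rightarrow> real) \<Rightarrow> real" where
  "cross_mass X A p = (\<Sum>u\<in>X. foreign_mass X A p u)"

text \<open>One round of the walk: matched vertices average their rows. Unmatched vertices are fixed
  points of \<open>\<sigma>\<close> and keep their row.\<close>

definition mix :: "('a \<Rightarrow> 'a) \<Rightarrow> ('a \<Rightarrow> 'a \<Rightarrow> real) \<Rightarrow> 'a \<Rightarrow> 'a \<Rightarrow> real" where
  "mix \<sigma> p u s = (p u s + p (\<sigma> u) s) / 2"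

definition involution_on :: "'a set \<Rightarrow> ('a \<Rightarrow> 'a) \<Rightarrow> bool" where
  "involution_on X \<sigma> \<longleftrightarrow> (\<forall>u\<in>X. \<sigma> u \<in> X \<and> \<sigma> (\<sigma> u) = u)"

lemma involution_on_bij: "involution_on X \<sigma> \<Longrightarrow> bij_betw \<sigma> X X"
  unfolding involution_on_def by (intro bij_betw_byWitness[where f' = \<sigma>]) auto

lemma stochastic_on_mix:
  assumes "stochastic_on X p" "involution_on X \<sigma>"
  shows "stochastic_on X (mix \<sigma> p)"
  using assms unfolding stochastic_on_def involution_on_def mix_def
  by (auto simp: sum.distrib simp flip: sum_divide_distrib)

lemma stochastic_on_sum_Diff:
  assumes "stochastic_on X p" "finite X" "A \<subseteq> X" "u \<in> X"
  shows "(\<Sum>s\<in>X - A. p u s) = 1 - (\<Sum>s\<in>A. p u s)"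
  using assms sum.subset_diff[of A X "p u"] unfolding stochastic_on_def by simp

lemma foreign_mass_nonneg:
  assumes "stochastic_on X p" "A \<subseteq> X" "u \<in> X"
  shows "0 \<le> foreign_mass X A p u"
  using assms unfolding foreign_mass_def stochastic_on_def by (auto intro!: sum_nonneg)

lemma card_cross_pairs:
  assumes inv: "involution_on X \<sigma>" and "finite X" "A \<subseteq> X"
  shows "card {u\<in>X. (u \<in> A) \<noteq> (\<sigma> u \<in> A)} = 2 * card {u\<in>A. \<sigma> u \<in> X - A}"
proof -
  let ?C = "{u\<in>A. \<sigma> u \<in> X - A}"
  have eq: "{u\<in>X. (u \<in> A) \<noteq> (\<sigma> u \<in> A)} = ?C \<union> \<sigma> ` ?C"
  proof
    show "{u\<in>X. (u \<in> A) \<noteq> (\<sigma> u \<in> A)} \<subseteq> ?C \<union> \<sigma> ` ?C"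
    proof
      fix u assume u: "u \<in> {u\<in>X. (u \<in> A) \<noteq> (\<sigma> u \<in> A)}"
      show "u \<in> ?C \<union> \<sigma> ` ?C"
      proof (cases "u \<in> A")
        case False
        then have "\<sigma> u \<in> ?C" "u = \<sigma> (\<sigma> u)" using u inv unfolding involution_on_def by auto
        then show ?thesis by blast
      qed (use u inv in \<open>auto simp: involution_on_def\<close>)
    qed
    show "?C \<union> \<sigma> ` ?C \<subseteq> {u\<in>X. (u \<in> A) \<noteq> (\<sigma> u \<in> A)}"
      using inv \<open>A \<subseteq> X\<close> unfolding involution_on_def by (auto simp: subset_iff)
  qed
  have "inj_on \<sigma> ?C"
    using involution_on_bij[OF inv] \<open>A \<subseteq> X\<close> unfolding bij_betw_def by (auto intro: inj_on_subset)
  then have "card (\<sigma> ` ?C) = card ?C" by (rule card_image)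
  moreover have "finite ?C" using finite_subset[OF assms(3,2)] by simp
  moreover have "?C \<inter> \<sigma> ` ?C = {}" by auto
  ultimately show ?thesis unfolding eq by (simp add: card_Un_disjoint)
qed

lemma sum_involution:
  assumes "involution_on X \<sigma>"
  shows "(\<Sum>u\<in>X. g (\<sigma> u)) = (\<Sum>u\<in>X. g u)"
  using sum.reindex_bij_betw[OF involution_on_bij[OF assms]] .

text \<open>In a crossing pair each row receives half of a row from the other side, of total mass 1,
  so its foreign mass grows by at most 1/2 over the average of the two. Other pairs only average
  their foreign masses.\<close>

lemma cross_mass_mix:
  assumes st: "stochastic_on X p" and inv: "involution_on X \<sigma>" and X: "finite X" "A \<subseteq> X"
  shows "cross_mass X A (mix \<sigma> p) \<le> cross_mass X A p + real (card {u\<in>A. \<sigma> u \<in> X - A})"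
proof -
  let ?g = "foreign_mass X A p" and ?D = "{u\<in>X. (u \<in> A) \<noteq> (\<sigma> u \<in> A)}"
  have "foreign_mass X A (mix \<sigma> p) u \<le> (?g u + ?g (\<sigma> u)) / 2 + (if u \<in> ?D then 1/2 else 0)"
    if u: "u \<in> X" for u
  proof -
    have su: "\<sigma> u \<in> X" using u inv unfolding involution_on_def by auto
    have "0 \<le> ?g (\<sigma> u)" using foreign_mass_nonneg[OF st X(2) su] .
    then show ?thesis using u su stochastic_on_sum_Diff[OF st X u] stochastic_on_sum_Diff[OF st X su]
      by (auto simp: foreign_mass_def mix_def sum.distrib add_divide_distrib simp flip: sum_divide_distrib)
  qed
  then have "cross_mass X A (mix \<sigma> p) \<le>
      (\<Sum>u\<in>X. (?g u + ?g (\<sigma> u)) / 2 + (if u \<in> ?D then 1/2 else 0))"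
    unfolding cross_mass_def by (intro sum_mono) auto
  also have "\<dots> = ((\<Sum>u\<in>X. ?g u) + (\<Sum>u\<in>X. ?g (\<sigma> u))) / 2 + (\<Sum>u\<in>X. if u \<in> ?D then 1/2 else 0)"
    by (simp add: sum.distrib flip: sum_divide_distrib)
  also have "(\<Sum>u\<in>X. if u \<in> ?D then 1/2 else 0 :: real) = real (card ?D) / 2"
    using X by (subst sum.inter_filter[symmetric]) auto
  finally show ?thesis unfolding sum_involution[OF inv] card_cross_pairs[OF inv X]
    by (simp add: cross_mass_def)
qed

text \<open>For a crossing pair, the columns on either side are dominated by the row native to that
  side. \<open>ent_midpoint_gap\<close> with that row as \<open>a\<close> gives a gain of at least
  1/3 - 2/3 (g u + g (\<sigma> u)) per row, where g is the foreign mass; the other rows do not lose.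
  In the sum over \<open>X\<close> each crossing pair counts twice, and so does each foreign
  mass.\<close>

lemma entropy_on_mix:
  assumes st: "stochastic_on X p" and inv: "involution_on X \<sigma>" and X: "finite X" "A \<subseteq> X"
  shows "entropy_on X p + 2/3 * real (card {u\<in>A. \<sigma> u \<in> X - A}) - 4/3 * cross_mass X A p
    \<le> entropy_on X (mix \<sigma> p)"
proof -
  let ?g = "foreign_mass X A p" and ?D = "{u\<in>X. (u \<in> A) \<noteq> (\<sigma> u \<in> A)}"
  define gap where "gap u s = ent (mix \<sigma> p u s) - (ent (p u s) + ent (p (\<sigma> u) s)) / 2" for u s
  have nn: "0 \<le> p u s" "0 \<le> p (\<sigma> u) s" if "u \<in> X" "s \<in> X" for u s
    using that st inv unfolding stochastic_on_def involution_on_def by auto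
  have gap: "0 \<le> gap u s" "p u s / 6 - p (\<sigma> u) s / 2 \<le> gap u s" "p (\<sigma> u) s / 6 - p u s / 2 \<le> gap u s"
    if "u \<in> X" "s \<in> X" for u s
    using ent_midpoint_gap[OF nn[OF that]] ent_midpoint_gap[OF nn(2,1)[OF that]]
    unfolding gap_def mix_def by (simp_all add: add.commute)
  have row: "(if u \<in> ?D then 1/3 else 0) - 2/3 * (?g u + ?g (\<sigma> u)) \<le> (\<Sum>s\<in>X. gap u s)"
    if u: "u \<in> X" for u
  proof -
    have su: "\<sigma> u \<in> X" using u inv unfolding involution_on_def by auto
    have g0: "0 \<le> ?g u" "0 \<le> ?g (\<sigma> u)"
      using foreign_mass_nonneg[OF st X(2)] u su by auto
    have split: "(\<Sum>s\<in>X. gap u s) = (\<Sum>s\<in>X - A. gap u s) + (\<Sum>s\<in>A. gap u s)"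
      using sum.subset_diff[OF X(2,1)] .
    have S: "(\<Sum>s\<in>Q. p a s) / 6 - (\<Sum>s\<in>Q. p b s) / 2 \<le> (\<Sum>s\<in>Q. gap u s)"
      if "Q \<subseteq> X" "(a = u \<and> b = \<sigma> u) \<or> (a = \<sigma> u \<and> b = u)" for Q a b
    proof -
      have "(\<Sum>s\<in>Q. p a s / 6 - p b s / 2) \<le> (\<Sum>s\<in>Q. gap u s)"
        using that gap[OF u] by (intro sum_mono) auto
      then show ?thesis by (simp add: sum_subtractf sum_divide_distrib)
    qed
    show ?thesis
    proof (cases "u \<in> ?D")
      case False
      moreover have "0 \<le> (\<Sum>s\<in>X. gap u s)" using gap[OF u] by (intro sum_nonneg) auto
      moreover have "0 \<le> 2/3 * (?g u + ?g (\<sigma> u))" using g0 by simp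
      ultimately show ?thesis by (simp only: if_False)
    next
      case True
      note d = stochastic_on_sum_Diff[OF st X u] stochastic_on_sum_Diff[OF st X su]
      show ?thesis
      proof (cases "u \<in> A")
        case True
        then have "\<sigma> u \<notin> A" using \<open>u \<in> ?D\<close> by auto
        then show ?thesis using True \<open>u \<in> ?D\<close> d S[OF X(2), of u "\<sigma> u"] S[of "X - A" "\<sigma> u" u]
          unfolding split by (simp add: foreign_mass_def) argo
      next
        case False
        then have "\<sigma> u \<in> A" using \<open>u \<in> ?D\<close> by auto
        then show ?thesis using False \<open>u \<in> ?D\<close> d S[OF X(2), of "\<sigma> u" u] S[of "X - A" u "\<sigma> u"]
          unfolding split by (simp add: foreign_mass_def) argo
      qed
    qed
  qed
  have "(\<Sum>u\<in>X. (if u \<in> ?D then 1/3 else 0) - 2/3 * (?g u + ?g (\<sigma> u))) \<le> (\<Sum>u\<in>X. \<Sum>s\<in>X. gap u s)"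
    using row by (intro sum_mono) auto
  moreover have "(\<Sum>u\<in>X. if u \<in> ?D then 1/3 else 0 :: real) = real (card ?D) / 3"
    using X by (subst sum.inter_filter[symmetric]) auto
  moreover have "(\<Sum>u\<in>X. 2/3 * (?g u + ?g (\<sigma> u))) = 2/3 * ((\<Sum>u\<in>X. ?g u) + (\<Sum>u\<in>X. ?g (\<sigma> u)))"
    by (simp only: sum.distrib sum_distrib_left[symmetric])
  ultimately have "real (card ?D) / 3 - 4/3 * cross_mass X A p \<le> (\<Sum>u\<in>X. \<Sum>s\<in>X. gap u s)"
    unfolding sum_subtractf sum_involution[OF inv] cross_mass_def by argo
  also have "(\<Sum>u\<in>X. \<Sum>s\<in>X. gap u s) = entropy_on X (mix \<sigma> p) -
      (entropy_on X p + (\<Sum>u\<in>X. \<Sum>s\<in>X. ent (p (\<sigma> u) s))) / 2"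
    unfolding gap_def entropy_on_def
    by (simp add: sum_subtractf sum.distrib add_divide_distrib flip: sum_divide_distrib)
  also have "(\<Sum>u\<in>X. \<Sum>s\<in>X. ent (p (\<sigma> u) s)) = entropy_on X p"
    unfolding entropy_on_def by (rule sum_involution[OF inv])
  finally show ?thesis unfolding card_cross_pairs[OF inv X] by simp
qed

lemma entropy_on_le:
  assumes st: "stochastic_on X p" and X: "finite X" "X \<noteq> {}"
  shows "entropy_on X p \<le> real (card X) * ln (real (card X))"
proof -
  have m: "0 < real (card X)" using X by (simp add: card_gt_0_iff)
  have "(\<Sum>s\<in>X. ent (p u s)) \<le> ln (real (card X))" if u: "u \<in> X" for u
  proof -
    \<comment> \<open>Tangent at the uniform value 1 / \<open>card X\<close>; summed over a row, the
      last two terms cancel.\<close>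
    have "ent (p u s) \<le> p u s * ln (real (card X)) - p u s + 1 / real (card X)" if "s \<in> X" for s
      using x_ln_x_ge[of "p u s" "1 / real (card X)"] m st u that
      by (auto simp: ent_def ln_div stochastic_on_def)
    then have "(\<Sum>s\<in>X. ent (p u s)) \<le> (\<Sum>s\<in>X. p u s * ln (real (card X)) - p u s + 1 / real (card X))"
      by (rule sum_mono)
    also have "\<dots> = ln (real (card X))"
      using m st u by (simp add: sum.distrib sum_subtractf stochastic_on_def flip: sum_distrib_right)
    finally show ?thesis .
  qed
  then have "entropy_on X p \<le> (\<Sum>u\<in>X. ln (real (card X)))"
    unfolding entropy_on_def by (rule sum_mono)
  then show ?thesis by simp
qed

lemma identity_walk:
  assumes "finite X" "p = (\<lambda>u s. if u = s then 1 else 0)"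
  shows "stochastic_on X p" "entropy_on X p = 0" "A \<subseteq> X \<Longrightarrow> cross_mass X A p = 0"
  using assms
  by (auto simp: stochastic_on_def entropy_on_def ent_def cross_mass_def foreign_mass_def if_distrib
      intro!: sum.neutral cong: if_cong)

section \<open>Walks in layered graphs\<close>

text \<open>Vertices may repeat. Edges and admissible vertices are separate arguments, so that
  deleting a separator only shrinks \<open>S\<close>.\<close>

definition walk :: "('a \<times> 'a) set \<Rightarrow> 'a set \<Rightarrow> 'a list \<Rightarrow> bool" where
  "walk E S xs \<longleftrightarrow> xs \<noteq> [] \<and> set xs \<subseteq> S \<and> successively (\<lambda>u v. (u, v) \<in> E) xs"

definition linked :: "('a \<times> 'a) set \<Rightarrow> 'a set \<Rightarrow> 'a \<Rightarrow> 'a \<Rightarrow> bool" where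
  "linked E S u v \<longleftrightarrow> (\<exists>xs. walk E S xs \<and> hd xs = u \<and> last xs = v)"

lemma walk_mono: "walk E S xs \<Longrightarrow> set xs \<subseteq> S' \<Longrightarrow> walk E S' xs"
  unfolding walk_def by blast

lemma walk_singleton: "v \<in> S \<Longrightarrow> walk E S [v]"
  unfolding walk_def by simp

lemma walk_rev: "sym E \<Longrightarrow> walk E S xs \<Longrightarrow> walk E S (rev xs)"
  unfolding walk_def by (auto simp: sym_def elim!: successively_mono)

lemma walk_join:
  assumes "walk E S xs" "walk E S ys" "last xs = hd ys"
  shows "walk E S (xs @ tl ys)" "hd (xs @ tl ys) = hd xs" "last (xs @ tl ys) = last ys"
    "set (xs @ tl ys) = set xs \<union> set ys"
proof -
  obtain y zs where ys: "ys = y # zs" using assms(2) unfolding walk_def by (cases ys) auto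
  have y: "y = last xs" using assms(3) ys by simp
  have xs: "xs \<noteq> []" using assms(1) unfolding walk_def by simp
  show "hd (xs @ tl ys) = hd xs" "last (xs @ tl ys) = last ys"
    using xs y by (auto simp: ys)
  show *: "set (xs @ tl ys) = set xs \<union> set ys" using xs y by (auto simp: ys)
  have "successively (\<lambda>u v. (u, v) \<in> E) (y # zs)" using assms(2) unfolding walk_def ys by simp
  then have "zs \<noteq> [] \<Longrightarrow> (last xs, hd zs) \<in> E" "successively (\<lambda>u v. (u, v) \<in> E) zs"
    unfolding y by (cases zs; simp)+
  then have "successively (\<lambda>u v. (u, v) \<in> E) (xs @ zs)"
    using assms(1) unfolding walk_def by (auto simp: successively_append_iff)
  then show "walk E S (xs @ tl ys)" using assms xs * unfolding walk_def by (simp add: ys)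
qed

lemma walk_replace_segment:
  assumes "walk E S (a @ s @ b)" "s \<noteq> []" "walk E S m" "hd m = hd s" "last m = last s"
  shows "walk E S (a @ m @ b)" "hd (a @ m @ b) = hd (a @ s @ b)" "last (a @ m @ b) = last (a @ s @ b)"
  using assms unfolding walk_def
  by (auto simp: successively_append_iff hd_append last_append)

lemma walk_invariant:
  assumes "walk E S xs" "hd xs \<in> Q" "\<And>u v. u \<in> Q \<Longrightarrow> u \<in> S \<Longrightarrow> (u, v) \<in> E \<Longrightarrow> v \<in> S \<Longrightarrow> v \<in> Q"
  shows "set xs \<subseteq> Q"
  using assms(1,2)
proof (induction xs)
  case (Cons x xs)
  then show ?case
    by (cases xs) (auto simp: walk_def intro: assms(3))
qed simp

lemma linked_refl: "v \<in> S \<Longrightarrow> linked E S v v"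
  unfolding linked_def by (metis walk_singleton last.simps list.sel(1))

lemma linked_sym: "sym E \<Longrightarrow> linked E S u v \<Longrightarrow> linked E S v u"
  unfolding linked_def by (metis walk_rev hd_rev last_rev)

lemma linked_trans: "linked E S u v \<Longrightarrow> linked E S v w \<Longrightarrow> linked E S u w"
  unfolding linked_def by (metis walk_join(1-3))

lemma linked_in: "linked E S u v \<Longrightarrow> u \<in> S \<and> v \<in> S"
  unfolding linked_def walk_def by force

lemma linked_mono: "linked E S u v \<Longrightarrow> S \<subseteq> S' \<Longrightarrow> linked E S' u v"
  unfolding linked_def walk_def by blast

lemma linked_edge: "(u, v) \<in> E \<Longrightarrow> u \<in> S \<Longrightarrow> v \<in> S \<Longrightarrow> linked E S u v"
  unfolding linked_def walk_def by (intro exI[of _ "[u, v]"]) auto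

lemma linked_step: "linked E S u v \<Longrightarrow> (v, w) \<in> E \<Longrightarrow> w \<in> S \<Longrightarrow> linked E S u w"
  by (meson linked_edge linked_in linked_trans)

definition sources :: "'a set \<Rightarrow> ('a \<times> 'a) set \<Rightarrow> 'a set" where
  "sources V D = {u \<in> V. \<forall>z. (z, u) \<notin> D}"

lemma relpow_list:
  assumes "(w, v) \<in> D ^^ j"
  shows "\<exists>xs. length xs = Suc j \<and> hd xs = w \<and> last xs = v \<and> successively (\<lambda>a b. (a, b) \<in> D) xs \<and>
    (\<forall>z\<in>set xs. (w, z) \<in> D\<^sup>* \<and> (z, v) \<in> D\<^sup>*)"
  using assms
proof (induction j arbitrary: v)
  case 0
  then show ?case by (intro exI[of _ "[w]"]) auto
next
  case (Suc j)
  then obtain u where u: "(w, u) \<in> D ^^ j" "(u, v) \<in> D" by auto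
  from Suc.IH[OF u(1)] obtain xs where xs: "length xs = Suc j" "hd xs = w" "last xs = u"
    "successively (\<lambda>a b. (a, b) \<in> D) xs" "\<forall>z\<in>set xs. (w, z) \<in> D\<^sup>* \<and> (z, u) \<in> D\<^sup>*" by blast
  have "xs \<noteq> []" using xs(1) by auto
  moreover have "(w, v) \<in> D\<^sup>*" using u by (meson relpow_imp_rtrancl rtrancl.rtrancl_into_rtrancl)
  ultimately show ?case using xs u
    by (intro exI[of _ "xs @ [v]"])
       (auto simp: successively_append_iff intro: rtrancl.rtrancl_into_rtrancl)
qed

text \<open>\<open>D\<close> stands for the layer digraph. The thickness enters as
  \<open>depth\<close>: a directed path meets distinct layers, so from a center it has at most
  \<open>k\<close> vertices and hence fewer than \<open>k\<close> arcs. \<open>covered\<close> holds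
  because in-arcs lead up a finite list of layers.\<close>

locale layered_graph =
  fixes V :: "'a set" and E D :: "('a \<times> 'a) set" and k t :: nat
  assumes finite_V: "finite V"
    and E_subset: "E \<subseteq> V \<times> V"
    and sym_E: "sym E"
    and D_subset: "D \<subseteq> E"
    and depth: "\<lbrakk>w \<in> sources V D; (w, v) \<in> D ^^ j\<rbrakk> \<Longrightarrow> j < k"
    and covered: "v \<in> V \<Longrightarrow> \<exists>w\<in>sources V D. (w, v) \<in> D\<^sup>*"
    and witnessing: "\<lbrakk>w \<in> sources V D; (w, v) \<in> D\<^sup>*\<rbrakk> \<Longrightarrow> card (E `` {v} - D\<^sup>* `` {w}) \<le> t"
begin

abbreviation "Cn \<equiv> sources V D"

abbreviation F :: "'a \<Rightarrow> 'a set" where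
  "F w \<equiv> D\<^sup>* `` {w}"

abbreviation FU :: "'a set \<Rightarrow> 'a set" where
  "FU Y \<equiv> D\<^sup>* `` Y"

definition hits :: "'a set \<Rightarrow> 'a list \<Rightarrow> 'a set" where
  "hits W xs = {w\<in>W. F w \<inter> set xs \<noteq> {}}"

lemma Cn_subset: "Cn \<subseteq> V"
  unfolding sources_def by auto

lemma F_subset: "w \<in> V \<Longrightarrow> F w \<subseteq> V"
proof -
  have "(w, v) \<in> D\<^sup>* \<Longrightarrow> w \<in> V \<Longrightarrow> v \<in> V" for v
    by (induction rule: rtrancl_induct) (use D_subset E_subset in auto)
  then show "w \<in> V \<Longrightarrow> F w \<subseteq> V" by blast
qed

lemma FU_subset: "Y \<subseteq> Cn \<Longrightarrow> FU Y \<subseteq> V"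
  using F_subset Cn_subset by fastforce

lemma source_in_F: "v \<in> Cn \<Longrightarrow> v \<in> F w \<Longrightarrow> v = w"
  unfolding sources_def by (auto elim: rtranclE)

lemma F_trans: "z \<in> F w \<Longrightarrow> (z, v) \<in> D\<^sup>* \<Longrightarrow> v \<in> F w"
  by (auto intro: rtrancl_trans)

lemma hits_append: "hits W (xs @ ys) = hits W xs \<union> hits W ys"
  unfolding hits_def by auto

lemma hits_mono: "set xs \<subseteq> set ys \<Longrightarrow> hits W xs \<subseteq> hits W ys"
  unfolding hits_def by auto

lemma hits_set_eq: "set xs = set ys \<union> set zs \<Longrightarrow> hits W xs = hits W ys \<union> hits W zs"
  unfolding hits_def by auto

text \<open>Moving up to a center is free: every member of the family that meets this walk contains \<open>v\<close>.\<close>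

lemma center_walk:
  assumes "w \<in> Cn" "v \<in> F w"
  obtains xs where "walk E (F w) xs" "hd xs = w" "last xs = v" "length xs \<le> k"
    "\<And>z. z \<in> set xs \<Longrightarrow> (z, v) \<in> D\<^sup>*"
proof -
  obtain j where j: "(w, v) \<in> D ^^ j" using assms(2) rtrancl_imp_relpow by fastforce
  obtain xs where xs: "length xs = Suc j" "hd xs = w" "last xs = v" "successively (\<lambda>a b. (a, b) \<in> D) xs"
    "\<forall>z\<in>set xs. (w, z) \<in> D\<^sup>* \<and> (z, v) \<in> D\<^sup>*" using relpow_list[OF j] by blast
  have "walk E (F w) xs" unfolding walk_def
    using xs D_subset by (auto elim: successively_mono)
  then show ?thesis using that xs depth[OF assms(1) j] by auto
qed

lemma shorten_walk:
  assumes W: "W \<subseteq> Cn" and xs: "walk E (FU W) xs"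
  obtains ys where "walk E (FU W) ys" "hd ys = hd xs" "last ys = last xs" "hits W ys \<subseteq> hits W xs"
    "\<And>w. w \<in> W \<Longrightarrow> card (set ys \<inter> F w) \<le> 2 * k"
proof -
  define P where "P ys \<longleftrightarrow> walk E (FU W) ys \<and> hd ys = hd xs \<and> last ys = last xs \<and> hits W ys \<subseteq> hits W xs" for ys
  have "P xs" using xs unfolding P_def by simp
  then obtain ys where ys: "P ys" "\<And>zs. P zs \<Longrightarrow> length ys \<le> length zs"
    using ex_has_least_nat[of P xs length] by blast
  have "card (set ys \<inter> F w) \<le> 2 * k" if w: "w \<in> W" for w
  proof (rule ccontr)
    assume "\<not> ?thesis"
    then have big: "2 * k < card (set ys \<inter> F w)" by simp
    then have "\<exists>x\<in>set ys. x \<in> F w" by (metis Int_iff card.empty ex_in_conv not_less_zero)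
    \<comment> \<open>\<open>p\<close> and \<open>q\<close> are the first and the last vertex of the
      walk in \<open>F w\<close>, so the segment between them contains all of its more than 2k
      vertices there and is longer than the detour through \<open>w\<close>.\<close>
    from split_list_first_prop[OF this] obtain a p b where ab: "ys = a @ p # b" "p \<in> F w" "\<forall>x\<in>set a. x \<notin> F w"
      by blast
    have "\<exists>x\<in>set (p # b). x \<in> F w" using ab by auto
    from split_list_last_prop[OF this] obtain c q b' where c: "p # b = c @ q # b'" "q \<in> F w" "\<forall>x\<in>set b'. x \<notin> F w"
      by blast
    have ys_eq: "ys = a @ (c @ [q]) @ b'" using ab c by simp
    have hdc: "hd (c @ [q]) = p" using c(1) by (cases c) auto
    have "set ys \<inter> F w \<subseteq> set (c @ [q])" using ys_eq ab c by auto
    then have "card (set ys \<inter> F w) \<le> length (c @ [q])"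
      by (meson List.finite_set card_length card_mono le_trans)
    then have len: "2 * k < length (c @ [q])" using big by linarith
    have wC: "w \<in> Cn" using w W by auto
    obtain us where us: "walk E (F w) us" "hd us = w" "last us = p" "length us \<le> k"
      "\<And>z. z \<in> set us \<Longrightarrow> (z, p) \<in> D\<^sup>*" using center_walk[OF wC ab(2)] by blast
    obtain vs where vs: "walk E (F w) vs" "hd vs = w" "last vs = q" "length vs \<le> k"
      "\<And>z. z \<in> set vs \<Longrightarrow> (z, q) \<in> D\<^sup>*" using center_walk[OF wC c(2)] by blast
    define m where "m = rev us @ tl vs"
    have ne: "us \<noteq> []" "vs \<noteq> []" using us(1) vs(1) unfolding walk_def by auto
    have join: "last (rev us) = hd vs" using us vs ne by (simp add: last_rev)
    note m = walk_join[OF walk_rev[OF sym_E us(1)] vs(1) join, folded m_def]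
    have "F w \<subseteq> FU W" using w by auto
    then have mw: "walk E (FU W) m" using m(1) by (meson walk_def walk_mono order_trans)
    have "hits W m \<subseteq> hits W ys"
    proof
      fix w' assume "w' \<in> hits W m"
      then obtain z where z: "w' \<in> W" "z \<in> F w'" "z \<in> set us \<union> set vs" unfolding hits_def using m(4) by auto
      then have "p \<in> F w' \<or> q \<in> F w'" using us(5) vs(5) F_trans[OF z(2)] by auto
      moreover have "p \<in> set ys" "q \<in> set ys" by (simp add: ab(1), simp add: ys_eq)
      ultimately show "w' \<in> hits W ys" using z(1) unfolding hits_def by blast
    qed
    moreover have "hits W a \<subseteq> hits W ys" "hits W b' \<subseteq> hits W ys" using ys_eq by (auto intro!: hits_mono)
    ultimately have h: "hits W (a @ m @ b') \<subseteq> hits W ys" unfolding hits_append by blast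
    have yw: "walk E (FU W) (a @ (c @ [q]) @ b')" using ys(1) ys_eq unfolding P_def by simp
    have "hd m = hd (c @ [q])" "last m = last (c @ [q])" using m(2,3) hdc us vs ne by (auto simp: hd_rev)
    note r = walk_replace_segment[OF yw _ mw this]
    have "P (a @ m @ b')" using r h ys(1) unfolding P_def ys_eq by auto
    then have "length ys \<le> length (a @ m @ b')" by (rule ys(2))
    moreover have "length m \<le> 2 * k" unfolding m_def using us(4) vs(4) by simp
    ultimately show False using len unfolding ys_eq by simp
  qed
  then show ?thesis using that ys(1) unfolding P_def by blast
qed

section \<open>Distances charged to the members of the family\<close>

definition wt :: "'a set \<Rightarrow> ('a \<Rightarrow> nat) \<Rightarrow> 'a list \<Rightarrow> nat" where
  "wt W x xs = (\<Sum>w\<in>hits W xs. x w)"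

definition vwt :: "'a set \<Rightarrow> ('a \<Rightarrow> nat) \<Rightarrow> 'a \<Rightarrow> nat" where
  "vwt W x v = (\<Sum>w\<in>{w\<in>W. v \<in> F w}. x w)"

text \<open>A ball for a distance that charges a walk once for each member, however often it is met.
  This makes the way up to a center free. Natural weights allow averaging over finitely many
  radii.\<close>

definition near :: "'a set \<Rightarrow> ('a \<Rightarrow> nat) \<Rightarrow> 'a set \<Rightarrow> nat \<Rightarrow> 'a set" where
  "near W x A s = {v. \<exists>xs. walk E (FU W) xs \<and> hd xs \<in> A \<and> last xs = v \<and> wt W x xs \<le> s}"

lemma finite_sources: "W \<subseteq> Cn \<Longrightarrow> finite W"
  using finite_V Cn_subset finite_subset by metis

lemma finite_hits: "W \<subseteq> Cn \<Longrightarrow> finite (hits W xs)"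
  using finite_sources unfolding hits_def by simp

lemma wt_le: 
  assumes "W \<subseteq> Cn" "hits W zs \<subseteq> hits W xs \<union> H" "finite H"
  shows "wt W x zs \<le> wt W x xs + sum x H"
proof -
  have "wt W x zs \<le> sum x (hits W xs \<union> H)"
    unfolding wt_def using assms finite_hits by (intro sum_mono2) auto
  also have "\<dots> \<le> wt W x xs + sum x H"
    unfolding wt_def using sum_Un_nat finite_hits assms by (metis diff_le_self)
  finally show ?thesis .
qed

lemma near_mono: "s \<le> s' \<Longrightarrow> near W x A s \<subseteq> near W x A s'"
  unfolding near_def by fastforce

text \<open>Members through \<open>u\<close> are already charged to the walk that reaches
  \<open>u\<close>, so the extension pays only for those through \<open>v\<close>. It serves both
  for an edge and for the way down from a center.\<close>

lemma near_extend:
  assumes W: "W \<subseteq> Cn" and u: "u \<in> near W x A s" and ys: "walk E (FU W) ys" "hd ys = u" "last ys = v"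
    and h: "\<And>z w. z \<in> set ys \<Longrightarrow> w \<in> W \<Longrightarrow> z \<in> F w \<Longrightarrow> u \<in> F w \<or> v \<in> F w"
  shows "v \<in> near W x A (s + vwt W x v)"
proof -
  obtain xs where xs: "walk E (FU W) xs" "hd xs \<in> A" "last xs = u" "wt W x xs \<le> s"
    using u unfolding near_def by auto
  have j: "last xs = hd ys" using xs ys by simp
  note jj = walk_join[OF xs(1) ys(1) j]
  have "u \<in> set xs" using xs unfolding walk_def by auto
  then have "hits W (xs @ tl ys) \<subseteq> hits W xs \<union> {w\<in>W. v \<in> F w}"
    unfolding hits_set_eq[OF jj(4)] using h unfolding hits_def by blast
  then have "wt W x (xs @ tl ys) \<le> wt W x xs + vwt W x v"
    unfolding vwt_def using W finite_sources by (intro wt_le) auto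
  then show ?thesis unfolding near_def using jj xs ys by (intro CollectI exI[of _ "xs @ tl ys"]) auto
qed

lemma near_up:
  assumes W: "W \<subseteq> Cn" and v: "v \<in> near W x A s" and w: "w \<in> W" "v \<in> F w"
  shows "w \<in> near W x A s"
proof -
  obtain xs where xs: "walk E (FU W) xs" "hd xs \<in> A" "last xs = v" "wt W x xs \<le> s"
    using v unfolding near_def by auto
  obtain us where us: "walk E (F w) us" "hd us = w" "last us = v" "\<And>z. z \<in> set us \<Longrightarrow> (z, v) \<in> D\<^sup>*"
    using center_walk[of w v] w W by blast
  have usw: "walk E (FU W) (rev us)" using us(1) w sym_E
    by (intro walk_rev walk_mono[OF us(1)]) (auto simp: walk_def)
  have ne: "us \<noteq> []" using us(1) unfolding walk_def by auto
  have j: "last xs = hd (rev us)" using xs us ne by (simp add: hd_rev)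
  note jj = walk_join[OF xs(1) usw j]
  have "v \<in> set xs" using xs unfolding walk_def by auto
  have "hits W (rev us) \<subseteq> hits W xs"
  proof
    fix w' assume "w' \<in> hits W (rev us)"
    then obtain z where "w' \<in> W" "z \<in> F w'" "z \<in> set us" unfolding hits_def by auto
    then show "w' \<in> hits W xs" using F_trans us(4) \<open>v \<in> set xs\<close> unfolding hits_def by blast
  qed
  then have "wt W x (xs @ tl (rev us)) \<le> wt W x xs + sum x {}"
    using W hits_set_eq[OF jj(4)] by (intro wt_le) auto
  then show ?thesis unfolding near_def using jj xs us ne
    by (intro CollectI exI[of _ "xs @ tl (rev us)"]) (auto simp: last_rev)
qed

lemma near_down:
  assumes W: "W \<subseteq> Cn" and u: "w \<in> near W x A s" and w: "w \<in> W" "v \<in> F w"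
  shows "v \<in> near W x A (s + vwt W x v)"
proof -
  obtain us where us: "walk E (F w) us" "hd us = w" "last us = v" "\<And>z. z \<in> set us \<Longrightarrow> (z, v) \<in> D\<^sup>*"
    using center_walk[of w v] w W by blast
  have "walk E (FU W) us" using us(1) w by (intro walk_mono[OF us(1)]) (auto simp: walk_def)
  then show ?thesis using us F_trans
    by (intro near_extend[OF W u, of us]) blast+
qed

lemma near_step:
  assumes W: "W \<subseteq> Cn" and u: "u \<in> near W x A s" and "(u, v) \<in> E" "v \<in> FU W"
  shows "v \<in> near W x A (s + vwt W x v)"
proof -
  have "u \<in> FU W" using u unfolding near_def walk_def by fastforce
  then show ?thesis using assms by (intro near_extend[OF W u, of "[u, v]"]) (auto simp: walk_def)
qed

lemma near_start:
  assumes "W \<subseteq> Cn" "a \<in> A" "a \<in> FU W"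
  shows "a \<in> near W x A (vwt W x a)"
  unfolding near_def wt_def vwt_def hits_def using assms
  by (intro CollectI exI[of _ "[a]"]) (auto simp: walk_def)

end

section \<open>Separators and congestion\<close>

text \<open>If m is the least point of \<open>Q\<close>, these thresholds lie between m - a and m +
  a. The guard \<open>a \<le> \<theta>\<close> takes care of truncated subtraction: a threshold
  below \<open>a\<close> is not excluded by the second condition.\<close>

lemma card_window:
  assumes mono: "\<And>s s'. s \<le> s' \<Longrightarrow> Q s \<Longrightarrow> Q s'"
  shows "finite {\<theta>::nat. Q (\<theta> + a) \<and> \<not> (a \<le> \<theta> \<and> Q (\<theta> - a))}"
    and "card {\<theta>::nat. Q (\<theta> + a) \<and> \<not> (a \<le> \<theta> \<and> Q (\<theta> - a))} \<le> 2 * a"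
proof -
  let ?T = "{\<theta>::nat. Q (\<theta> + a) \<and> \<not> (a \<le> \<theta> \<and> Q (\<theta> - a))}"
  define m where "m = (LEAST s. Q s)"
  have "?T \<subseteq> {m - a..<m + a}"
  proof
    fix \<theta> assume th: "\<theta> \<in> ?T"
    then have "Q (\<theta> + a)" by simp
    then have "m \<le> \<theta> + a" "Q m" unfolding m_def by (auto intro: Least_le LeastI)
    moreover have "\<theta> < m + a"
    proof (rule ccontr)
      assume "\<not> \<theta> < m + a"
      then have "m \<le> \<theta> - a" "a \<le> \<theta>" by auto
      then have "Q (\<theta> - a)" using mono \<open>Q m\<close> by blast
      then show False using th \<open>a \<le> \<theta>\<close> by simp
    qed
    ultimately show "\<theta> \<in> {m - a..<m + a}" by auto
  qed
  then show "finite ?T" "card ?T \<le> 2 * a"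
    by (auto intro: finite_subset dest: card_mono[rotated])
qed

lemma exists_le_average:
  fixes g :: "nat \<Rightarrow> real"
  assumes "(\<Sum>i<n. g i) \<le> c" "0 < n"
  shows "\<exists>i<n. g i \<le> c / real n"
proof (rule ccontr)
  assume "\<not> ?thesis"
  then have "(\<Sum>i<n. c / real n) < (\<Sum>i<n. g i)"
    using \<open>0 < n\<close> by (intro sum_strict_mono) auto
  then show False using assms by simp
qed

text \<open>The bounds 1 - 1/x \<le> ln x \<le> x - 1 are too coarse at 2; applied to the factors
  4/3 and 3/2 they give 1/4 + 1/3 and 1/3 + 1/2.\<close>

lemma ln_2_bounds: "7/12 \<le> ln (2::real)" "ln (2::real) \<le> 5/6"
proof -
  have *: "ln (2::real) = ln (4/3) + ln (3/2)" using ln_mult[of "4/3" "3/2 :: real"] by simp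
  have "1 - 1/x \<le> ln x" "ln x \<le> x - 1" if "0 < x" for x :: real
    using that ln_le_minus_one[of x] ln_le_minus_one[of "1/x"] by (auto simp: ln_div)
  from this[of "4/3"] this[of "3/2"] show "7/12 \<le> ln (2::real)" "ln (2::real) \<le> 5/6"
    unfolding * by auto
qed

lemma ln_card_le:
  assumes "0 < n"
  shows "ln (real n) \<le> 5/6 * log 2 (2 * real n)" "ln (real n) \<le> ln 2 * log 2 (2 * real n)"
proof -
  have "log 2 (2 * real n) * ln 2 = ln (2 * real n)" by (simp add: log_def)
  moreover have "ln (real n) \<le> ln (2 * real n)" using assms by simp
  ultimately show *: "ln (real n) \<le> ln 2 * log 2 (2 * real n)" by (simp add: mult.commute)
  have "0 \<le> log 2 (2 * real n)" using assms by simp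
  then have "ln 2 * log 2 (2 * real n) \<le> 5/6 * log 2 (2 * real n)"
    using ln_2_bounds(2) by (rule mult_right_mono[rotated])
  then show "ln (real n) \<le> 5/6 * log 2 (2 * real n)" using * by linarith
qed

context layered_graph begin

text \<open>
  The boundary vertices of the sublevel sets of the distance from \<open>A\<close> are grouped by the dyadic
  scale of their weight. At scale \<open>2 ^ i\<close> only centers at distance less than \<open>2 ^ (i + 1)\<close> from the
  threshold matter, so each center is relevant for few thresholds, and on average \<open>x / 2 ^ i\<close> is a
  cheap fractional cover of the boundary.
\<close>

lemma cheap_separator:
  assumes W: "W \<subseteq> Cn" and x: "\<And>w. w \<in> W \<Longrightarrow> 1 \<le> x w"
    and total: "(\<Sum>w\<in>W. x w) \<le> 2 * card V"
    and AB: "\<And>xs. walk E (FU W) xs \<Longrightarrow> hd xs \<in> A \<Longrightarrow> last xs \<in> B \<Longrightarrow> m \<le> wt W x xs"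
    and m: "0 < m" and nV: "0 < card V"
  shows "\<exists>Y\<subseteq>W. (\<nexists>xs. walk E (FU W - FU Y) xs \<and> hd xs \<in> A \<and> last xs \<in> B) \<and>
    real (card Y) \<le> 16 * real (card V) * log 2 (2 * real (card V)) / real m * ln (real (card V)) + 1"
proof -
  define L where "L = log 2 (2 * real (card V))"
  \<comment> \<open>The number of dyadic scales: a boundary vertex has weight between 1 and 2 |V| =
    2 ^ L.\<close>
  define nc where "nc = nat \<lfloor>L\<rfloor> + 1"
  have L1: "1 \<le> L" unfolding L_def using nV by (simp add: le_log_iff)
  have nc: "real nc \<le> 2 * L" unfolding nc_def using L1 by linarith
  have finW: "finite W" using finite_sources[OF W] .
  let ?N = "near W x A" and ?y = "vwt W x"
  define Rel where "Rel i \<theta> = {w\<in>W. w \<in> ?N (\<theta> + 2^(i+1)) \<and> \<not> (2^(i+1) \<le> \<theta> \<and> w \<in> ?N (\<theta> - 2^(i+1)))}" for i \<theta>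
  define z where "z \<theta> w = (\<Sum>i<nc. if w \<in> Rel i \<theta> then real (x w) / 2^i else 0)" for \<theta> w
  define total' where "total' = real (\<Sum>w\<in>W. x w)"
  have "(\<Sum>\<theta><m. \<Sum>w\<in>W. z \<theta> w) = (\<Sum>\<theta><m. \<Sum>i<nc. \<Sum>w\<in>W. if w \<in> Rel i \<theta> then real (x w) / 2^i else 0)"
    unfolding z_def by (intro sum.cong refl sum.swap)
  also have "\<dots> = (\<Sum>i<nc. \<Sum>\<theta><m. \<Sum>w\<in>W. if w \<in> Rel i \<theta> then real (x w) / 2^i else 0)"
    by (rule sum.swap)
  also have "\<dots> = (\<Sum>i<nc. \<Sum>w\<in>W. \<Sum>\<theta><m. if w \<in> Rel i \<theta> then real (x w) / 2^i else 0)"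
    by (intro sum.cong refl sum.swap)
  \<comment> \<open>By \<open>card_window\<close>, a center is relevant at scale \<open>i\<close>
    for at most 4 * 2 ^ i thresholds, and it pays x / 2 ^ i for each.\<close>
  also have "\<dots> \<le> (\<Sum>i<nc. \<Sum>w\<in>W. 4 * real (x w))"
  proof (intro sum_mono)
    fix i w assume w: "w \<in> W"
    let ?T = "{\<theta>::nat. w \<in> ?N (\<theta> + 2^(i+1)) \<and> \<not> (2^(i+1) \<le> \<theta> \<and> w \<in> ?N (\<theta> - 2^(i+1)))}"
    have T: "finite ?T" "card ?T \<le> 2 * 2^(i+1)"
      by (rule card_window; use near_mono in blast)+
    have "card {\<theta>\<in>{..<m}. w \<in> Rel i \<theta>} \<le> card ?T"
      using T(1) by (intro card_mono) (auto simp: Rel_def)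
    then have "card {\<theta>\<in>{..<m}. w \<in> Rel i \<theta>} \<le> 4 * 2^i" using T(2) by simp
    then have "real (card {\<theta>\<in>{..<m}. w \<in> Rel i \<theta>}) \<le> real (4 * 2^i)" by (rule of_nat_mono)
    then have c: "real (card {\<theta>\<in>{..<m}. w \<in> Rel i \<theta>}) \<le> 4 * 2^i" by simp
    have "(\<Sum>\<theta><m. if w \<in> Rel i \<theta> then real (x w) / 2^i else 0) =
        real (card {\<theta>\<in>{..<m}. w \<in> Rel i \<theta>}) * (real (x w) / 2^i)"
      by (subst sum.inter_filter[symmetric]) auto
    also have "\<dots> \<le> 4 * 2^i * (real (x w) / 2^i)" using c by (intro mult_right_mono) auto
    finally show "(\<Sum>\<theta><m. if w \<in> Rel i \<theta> then real (x w) / 2^i else 0) \<le> 4 * real (x w)" by simp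
  qed
  also have "\<dots> = 4 * real nc * total'" unfolding total'_def by (simp add: sum_distrib_left mult_ac)
  also have "\<dots> \<le> 4 * (2 * L) * (2 * real (card V))"
    using nc of_nat_mono[OF total, where 'a = real] L1 unfolding total'_def
    by (intro mult_mono) (auto simp: sum_nonneg)
  finally have "(\<Sum>\<theta><m. \<Sum>w\<in>W. z \<theta> w) \<le> 16 * real (card V) * L" by (simp add: mult_ac)
  then obtain \<theta> where \<theta>: "\<theta> < m" "(\<Sum>w\<in>W. z \<theta> w) \<le> 16 * real (card V) * L / real m"
    using exists_le_average[OF _ m] by blast
  define bd where "bd = {v \<in> FU W - ?N \<theta>. v \<in> A \<or> (\<exists>u\<in>?N \<theta>. (u, v) \<in> E)}"
  have bdV: "bd \<subseteq> V" using FU_subset[OF W] unfolding bd_def by auto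
  have "\<exists>Y\<subseteq>W. bd \<subseteq> \<Union>(F ` Y) \<and> real (card Y) \<le> 16 * real (card V) * L / real m * ln (real (card bd)) + 1"
  proof (rule fractional_set_cover[OF finW])
    show "finite bd" using finite_V bdV finite_subset by blast
    show "0 \<le> z \<theta> w" for w unfolding z_def by (intro sum_nonneg) auto
    show "(\<Sum>w\<in>W. z \<theta> w) \<le> 16 * real (card V) * L / real m" by (rule \<theta>(2))
    fix v assume v: "v \<in> bd"
    then obtain w0 where w0: "w0 \<in> W" "v \<in> F w0" unfolding bd_def by auto
    have "x w0 \<le> ?y v" unfolding vwt_def using finW w0 by (intro member_le_sum) auto
    then have "1 \<le> ?y v" using x[OF w0(1)] by simp
    then obtain i where i: "2^i \<le> ?y v" "?y v < 2^(i+1)" using ex_power_ivl1[of 2 "?y v"] by auto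
    have "?y v \<le> (\<Sum>w\<in>W. x w)" unfolding vwt_def using finW by (intro sum_mono2) auto
    then have "2^i \<le> 2 * card V" using i total by linarith
    then have "real (2^i) \<le> real (2 * card V)" by (rule of_nat_mono)
    then have "2 powr real i \<le> 2 * real (card V)" by (simp add: powr_realpow)
    then have "real i \<le> L" unfolding L_def using nV by (simp add: le_log_iff)
    then have inc: "i < nc" unfolding nc_def by linarith
    have up: "v \<in> ?N (\<theta> + ?y v)"
    proof -
      have vW: "v \<in> FU W" using v unfolding bd_def by auto
      consider "v \<in> A" | u where "u \<in> ?N \<theta>" "(u, v) \<in> E" using v unfolding bd_def by auto
      then show ?thesis
      proof cases
        case 1
        then show ?thesis using near_start[OF W _ vW] near_mono[of "?y v" "\<theta> + ?y v"] by (metis le_add2 subsetD)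
      next
        case 2
        then show ?thesis using near_step[OF W _ _ vW] by blast
      qed
    qed
    have rel: "w \<in> Rel i \<theta>" if w: "w \<in> W" "v \<in> F w" for w
    proof -
      have "w \<in> ?N (\<theta> + ?y v)" using near_up[OF W up w] .
      moreover have "?N (\<theta> + ?y v) \<subseteq> ?N (\<theta> + 2^(i+1))" using i by (intro near_mono) simp
      \<comment> \<open>Otherwise the way down from \<open>w\<close> to \<open>v\<close>, which
        costs \<open>vwt W x v\<close> < 2 ^ (i + 1), would bring \<open>v\<close> inside the ball
        of radius \<theta>.\<close>
      moreover have "w \<notin> ?N (\<theta> - 2^(i+1))" if "2^(i+1) \<le> \<theta>"
      proof
        assume "w \<in> ?N (\<theta> - 2^(i+1))"
        then have "v \<in> ?N (\<theta> - 2^(i+1) + ?y v)" using near_down[OF W _ w] by blast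
        moreover have "?N (\<theta> - 2^(i+1) + ?y v) \<subseteq> ?N \<theta>" using i that by (intro near_mono) linarith
        ultimately show False using v unfolding bd_def by auto
      qed
      ultimately show ?thesis using w unfolding Rel_def by auto
    qed
    \<comment> \<open>Scale \<open>i\<close> alone covers \<open>v\<close>: all members through
      \<open>v\<close> are relevant there, and together they weigh at least 2 ^ i.\<close>
    have "1 \<le> real (?y v) / 2^i" using of_nat_mono[OF i(1), where 'a = real] by simp
    also have "\<dots> = (\<Sum>w\<in>{w\<in>W. v \<in> F w}. real (x w) / 2^i)"
      unfolding vwt_def by (simp add: sum_divide_distrib)
    also have "\<dots> \<le> (\<Sum>w\<in>{w\<in>W. v \<in> F w}. z \<theta> w)"
    proof (intro sum_mono)
      fix w assume "w \<in> {w\<in>W. v \<in> F w}"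
      then have "real (x w) / 2^i = (if w \<in> Rel i \<theta> then real (x w) / 2^i else 0)" using rel by auto
      also have "\<dots> \<le> z \<theta> w" unfolding z_def using inc
        by (intro member_le_sum[where f = "\<lambda>i. if w \<in> Rel i \<theta> then real (x w) / 2^i else 0"]) auto
      finally show "real (x w) / 2^i \<le> z \<theta> w" .
    qed
    finally show "1 \<le> (\<Sum>w\<in>{w\<in>W. v \<in> F w}. z \<theta> w)" .
  qed
  then obtain Y where Y: "Y \<subseteq> W" "bd \<subseteq> \<Union>(F ` Y)"
    "real (card Y) \<le> 16 * real (card V) * L / real m * ln (real (card bd)) + 1" by blast
  \<comment> \<open>A walk that avoids the cover of the boundary cannot leave the ball of radius
    \<theta> < m, so it does not reach \<open>B\<close>.\<close>
  have "\<not> (walk E (FU W - FU Y) xs \<and> hd xs \<in> A \<and> last xs \<in> B)" for xs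
  proof
    assume xs: "walk E (FU W - FU Y) xs \<and> hd xs \<in> A \<and> last xs \<in> B"
    have bdY: "bd \<subseteq> FU Y" using Y(2) by auto
    have ne: "xs \<noteq> []" "set xs \<subseteq> FU W - FU Y" using xs unfolding walk_def by auto
    then have "hd xs \<in> FU W - FU Y" using hd_in_set by blast
    then have "hd xs \<in> ?N \<theta>" using xs bdY unfolding bd_def by auto
    then have "set xs \<subseteq> ?N \<theta>" using xs bdY
      by (intro walk_invariant[of E "FU W - FU Y"]) (auto simp: bd_def)
    then have "last xs \<in> ?N \<theta>" using ne by auto
    then obtain ys where "walk E (FU W) ys" "hd ys \<in> A" "last ys = last xs" "wt W x ys \<le> \<theta>"
      unfolding near_def by auto
    then show False using AB[of ys] xs \<theta>(1) by auto
  qed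
  moreover have "ln (real (card bd)) \<le> ln (real (card V))"
  proof (cases "card bd = 0")
    case False
    then show ?thesis using card_mono[OF finite_V bdV] by simp
  qed (use nV in simp)
  then have "16 * real (card V) * L / real m * ln (real (card bd)) \<le> 16 * real (card V) * L / real m * ln (real (card V))"
    using L1 by (intro mult_left_mono) auto
  ultimately show ?thesis using Y unfolding L_def by (intro exI[of _ Y]) auto
qed

text \<open>Contraposition of \<open>cheap_separator\<close>. The weights are scaled to total |V|
  and rounded up, which adds at most 1 per center; this is the origin of the bound 2 |V| there. If
  all walks from \<open>A\<close> to \<open>B\<close> were heavier than claimed, a separator would
  cost at most S ln |V| / L + 1 \<le> 5/6 S + 1, which is at most S since S \<ge> 6.\<close>

lemma short_walk:
  fixes S :: nat
  defines "L \<equiv> log 2 (2 * real (card V))"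
  assumes W: "W \<subseteq> Cn" and x: "\<And>w. w \<in> W \<Longrightarrow> 1 \<le> x w" and S: "6 \<le> S"
    and nosep: "\<And>Y. Y \<subseteq> W \<Longrightarrow> card Y \<le> S \<Longrightarrow> \<exists>xs. walk E (FU W - FU Y) xs \<and> hd xs \<in> A \<and> last xs \<in> B"
  shows "\<exists>xs. walk E (FU W) xs \<and> hd xs \<in> A \<and> last xs \<in> B \<and>
    real (wt W x xs) \<le> 16 * L\<^sup>2 / real S * real (\<Sum>w\<in>W. x w)"
proof (rule ccontr)
  assume no: "\<not> ?thesis"
  define n where "n = card V"
  define \<Phi> where "\<Phi> = real (\<Sum>w\<in>W. x w)"
  obtain xs0 where "walk E (FU W) xs0" using nosep[of "{}"] by auto
  then obtain v where v: "v \<in> FU W" unfolding walk_def by (cases xs0) auto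
  have nV: "0 < n" unfolding n_def using v FU_subset[OF W] finite_V card_gt_0_iff by blast
  have L1: "1 \<le> L" unfolding L_def using nV by (simp add: le_log_iff n_def)
  have finW: "finite W" using finite_sources[OF W] .
  obtain w0 where "w0 \<in> W" using v by auto
  then have "x w0 \<le> (\<Sum>w\<in>W. x w)" using finW by (intro member_le_sum) auto
  then have "1 \<le> (\<Sum>w\<in>W. x w)" using x[OF \<open>w0 \<in> W\<close>] by simp
  then have \<Phi>: "1 \<le> \<Phi>" unfolding \<Phi>_def using of_nat_mono[where 'a = real] by fastforce
  define x' where "x' w = nat \<lceil>real n * real (x w) / \<Phi>\<rceil>" for w
  have x': "real n * real (x w) / \<Phi> \<le> real (x' w)" "real (x' w) \<le> real n * real (x w) / \<Phi> + 1" for w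
  proof -
    have "0 \<le> real n * real (x w) / \<Phi>" using \<Phi> by simp
    then show "real n * real (x w) / \<Phi> \<le> real (x' w)" "real (x' w) \<le> real n * real (x w) / \<Phi> + 1"
      unfolding x'_def by linarith+
  qed
  have x'1: "1 \<le> x' w" if "w \<in> W" for w
  proof -
    have "0 < real n * real (x w) / \<Phi>" using \<Phi> nV x[OF that] by simp
    then have "0 < real (x' w)" using x'(1)[of w] by linarith
    then show ?thesis by simp
  qed
  have "real (\<Sum>w\<in>W. x' w) \<le> (\<Sum>w\<in>W. real n * real (x w) / \<Phi> + 1)"
    using x'(2) by (simp add: sum_mono)
  also have "\<dots> = real n * \<Phi> / \<Phi> + real (card W)"
    unfolding \<Phi>_def by (simp add: sum.distrib sum_distrib_left sum_divide_distrib)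
  also have "\<dots> \<le> real n + real n"
    using \<Phi> card_mono[OF finite_V order_trans[OF W Cn_subset]] by (simp add: n_def)
  finally have tot: "(\<Sum>w\<in>W. x' w) \<le> 2 * card V" unfolding n_def by linarith
  define r where "r = 16 * real n * L\<^sup>2 / real S"
  define m where "m = nat \<lceil>r\<rceil>"
  have r0: "0 < r" unfolding r_def using nV L1 S by simp
  have m0: "0 < m" and mr: "r \<le> real m" unfolding m_def using r0 by linarith+
  have long: "m \<le> wt W x' xs" if xs: "walk E (FU W) xs" "hd xs \<in> A" "last xs \<in> B" for xs
  proof -
    have "16 * L\<^sup>2 / real S * \<Phi> < real (wt W x xs)" using no xs unfolding \<Phi>_def by force
    then have "real n / \<Phi> * (16 * L\<^sup>2 / real S * \<Phi>) < real n / \<Phi> * real (wt W x xs)"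
      using nV \<Phi> by (intro mult_strict_left_mono) auto
    also have "\<dots> = (\<Sum>w\<in>hits W xs. real n * real (x w) / \<Phi>)"
      unfolding wt_def by (simp add: sum_distrib_left)
    also have "\<dots> \<le> real (wt W x' xs)" unfolding wt_def using x'(1) by (simp add: sum_mono)
    finally have "r < real (wt W x' xs)" unfolding r_def using \<Phi> by (simp add: field_simps)
    then show ?thesis unfolding m_def by linarith
  qed
  have L_eq: "log 2 (2 * real n) = L" unfolding L_def n_def ..
  obtain Y where Y: "Y \<subseteq> W" "\<nexists>xs. walk E (FU W - FU Y) xs \<and> hd xs \<in> A \<and> last xs \<in> B"
    "real (card Y) \<le> 16 * real n * L / real m * ln (real n) + 1"
    using cheap_separator[OF W x'1 tot, of A B m, OF _ long m0] nV unfolding n_def[symmetric] L_eq by auto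
  have l0: "0 \<le> ln (real n)" using nV by simp
  have "16 * real n * L / real m * ln (real n) \<le> 16 * real n * L / r * ln (real n)"
    using mr r0 L1 l0 by (intro mult_right_mono divide_left_mono) auto
  also have "\<dots> = real S * (ln (real n) / L)"
    unfolding r_def using nV L1 S by (simp add: power2_eq_square)
  also have "\<dots> \<le> real S * (5/6)"
    using ln_card_le(1)[OF nV] L1 S unfolding L_def n_def
    by (intro mult_left_mono) (auto simp: divide_le_eq)
  finally have "real (card Y) \<le> real S" using Y(3) S by linarith
  then show False using nosep[OF Y(1)] Y(2) by simp
qed

text \<open>Walks are kept in lists, because a walk may be chosen again in a later round and must
  then be counted again.\<close>

definition load :: "'a \<Rightarrow> 'a list list \<Rightarrow> nat" where
  "load w Ps = length (filter (\<lambda>P. F w \<inter> set P \<noteq> {}) Ps)"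

definition short_in :: "'a set \<Rightarrow> 'a list \<Rightarrow> bool" where
  "short_in W P \<longleftrightarrow> walk E (FU W) P \<and> (\<forall>w\<in>W. card (set P \<inter> F w) \<le> 2 * k)"

definition well_linked :: "nat \<Rightarrow> 'a set \<Rightarrow> 'a set \<Rightarrow> bool" where
  "well_linked S W X \<longleftrightarrow> (\<forall>A\<subseteq>X. \<forall>B\<subseteq>X. \<forall>Y\<subseteq>W. S < card A \<longrightarrow> S < card B \<longrightarrow> card Y \<le> S \<longrightarrow>
     (\<exists>xs. walk E (FU W - FU Y) xs \<and> hd xs \<in> A \<and> last xs \<in> B))"

text \<open>Multiplicative weights: each new walk is cheap for the weights \<open>2 ^ load\<close>.\<close>

lemma low_congestion_matching:
  fixes S :: nat
  defines "L \<equiv> log 2 (2 * real (card V))"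
  assumes W: "W \<subseteq> Cn" and S: "6 \<le> S"
    and nosep: "well_linked S W X"
    and A: "A \<subseteq> X" "7 * S \<le> card A" and B: "B \<subseteq> X" "7 * S \<le> card B"
  obtains Ps where "length Ps = 6 * S" "distinct (map hd Ps)" "distinct (map last Ps)"
    "\<And>P. P \<in> set Ps \<Longrightarrow> short_in W P \<and> hd P \<in> A \<and> last P \<in> B"
    "\<And>w. w \<in> W \<Longrightarrow> real (load w Ps) \<le> 166 * L\<^sup>2"
proof -
  define n where "n = card V"
  define q where "q = 16 * L\<^sup>2 / real S"
  have finW: "finite W" using finite_sources[OF W] .
  have "\<exists>xs. walk E (FU W - FU {}) xs \<and> hd xs \<in> A \<and> last xs \<in> B"
    using nosep[unfolded well_linked_def, rule_format, OF A(1) B(1) empty_subsetI] A B S by simp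
  then obtain xs0 where "walk E (FU W) xs0" by auto
  then obtain v where v: "v \<in> FU W" unfolding walk_def by (cases xs0) auto
  have nV: "0 < n" unfolding n_def using v FU_subset[OF W] finite_V card_gt_0_iff by blast
  have L1: "1 \<le> L" unfolding L_def using nV by (simp add: le_log_iff n_def)
  \<comment> \<open>Doubling the weights of the members that a walk hits adds exactly the weight of
    that walk. So the total weight starts at \<open>card W\<close> \<le> |V| and grows by a factor
    of at most 1 + q per walk.\<close>
  have "\<exists>Ps. length Ps = j \<and> distinct (map hd Ps) \<and> distinct (map last Ps) \<and>
      (\<forall>P\<in>set Ps. short_in W P \<and> hd P \<in> A \<and> last P \<in> B) \<and>
      real (\<Sum>w\<in>W. 2 ^ load w Ps) \<le> real n * (1 + q) ^ j" if "j \<le> 6 * S" for j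
    using that
  proof (induction j)
    case 0
    have "real (card W) \<le> real n"
      using card_mono[OF finite_V order_trans[OF W Cn_subset]] by (simp add: n_def)
    then show ?case by (intro exI[of _ "[]"]) (auto simp: load_def)
  next
    case (Suc j)
    then obtain Ps where Ps: "length Ps = j" "distinct (map hd Ps)" "distinct (map last Ps)"
      "\<forall>P\<in>set Ps. short_in W P \<and> hd P \<in> A \<and> last P \<in> B"
      "real (\<Sum>w\<in>W. 2 ^ load w Ps) \<le> real n * (1 + q) ^ j" by auto
    let ?A = "A - hd ` set Ps" and ?B = "B - last ` set Ps"
    have "card (hd ` set Ps) \<le> j" "card (last ` set Ps) \<le> j"
      using Ps(1) card_image_le[of "set Ps"] card_length[of Ps] by (meson List.finite_set le_trans order_eq_refl)+
    then have "card A - j \<le> card ?A" "card B - j \<le> card ?B"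
      using diff_card_le_card_Diff[of "hd ` set Ps" A] diff_card_le_card_Diff[of "last ` set Ps" B] by auto
    then have big: "S < card ?A" "S < card ?B" using A B S Suc.prems by auto
    have sub: "?A \<subseteq> X" "?B \<subseteq> X" using A B by auto
    have "\<exists>xs. walk E (FU W - FU Y) xs \<and> hd xs \<in> ?A \<and> last xs \<in> ?B" if "Y \<subseteq> W" "card Y \<le> S" for Y
      using nosep sub big that unfolding well_linked_def by blast
    from short_walk[OF W _ S this, of "\<lambda>w. 2 ^ load w Ps"]
    obtain xs where xs: "walk E (FU W) xs" "hd xs \<in> ?A" "last xs \<in> ?B"
      "real (wt W (\<lambda>w. 2 ^ load w Ps) xs) \<le> q * real (\<Sum>w\<in>W. 2 ^ load w Ps)"
      unfolding q_def L_def by auto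
    obtain P where P: "walk E (FU W) P" "hd P = hd xs" "last P = last xs" "hits W P \<subseteq> hits W xs"
      "\<And>w. w \<in> W \<Longrightarrow> card (set P \<inter> F w) \<le> 2 * k" using shorten_walk[OF W xs(1)] by blast
    have "(\<Sum>w\<in>W. 2 ^ load w (P # Ps)) = (\<Sum>w\<in>W. 2 ^ load w Ps + (if w \<in> hits W P then 2 ^ load w Ps else 0 :: nat))"
      by (intro sum.cong refl) (auto simp: load_def hits_def)
    also have "\<dots> = (\<Sum>w\<in>W. 2 ^ load w Ps) + wt W (\<lambda>w. 2 ^ load w Ps) P"
    proof -
      have "(\<Sum>w\<in>W. if w \<in> hits W P then 2 ^ load w Ps else 0 :: nat) = (\<Sum>w\<in>W \<inter> hits W P. 2 ^ load w Ps)"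
        using finW by (simp add: sum.inter_restrict)
      also have "W \<inter> hits W P = hits W P" unfolding hits_def by auto
      finally show ?thesis unfolding wt_def by (simp add: sum.distrib)
    qed
    also have "\<dots> \<le> (\<Sum>w\<in>W. 2 ^ load w Ps) + wt W (\<lambda>w. 2 ^ load w Ps) xs"
      using wt_le[OF W, of P xs "{}"] P(4) by simp
    finally have "real (\<Sum>w\<in>W. 2 ^ load w (P # Ps)) \<le>
        real (\<Sum>w\<in>W. 2 ^ load w Ps) + real (wt W (\<lambda>w. 2 ^ load w Ps) xs)"
      unfolding of_nat_add[symmetric] by (rule of_nat_mono)
    also have "\<dots> \<le> (1 + q) * real (\<Sum>w\<in>W. 2 ^ load w Ps)" using xs(4) unfolding distrib_right by simp
    also have "\<dots> \<le> (1 + q) * (real n * (1 + q) ^ j)"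
      using Ps(5) unfolding q_def by (intro mult_left_mono) auto
    finally have "real (\<Sum>w\<in>W. 2 ^ load w (P # Ps)) \<le> real n * (1 + q) ^ Suc j" by (simp add: mult_ac)
    then show ?case using Ps P xs by (intro exI[of _ "P # Ps"]) (auto simp: short_in_def)
  qed
  then obtain Ps where Ps: "length Ps = 6 * S" "distinct (map hd Ps)" "distinct (map last Ps)"
    "\<forall>P\<in>set Ps. short_in W P \<and> hd P \<in> A \<and> last P \<in> B"
    "real (\<Sum>w\<in>W. 2 ^ load w Ps) \<le> real n * (1 + q) ^ (6 * S)" by blast
  have "real (load w Ps) \<le> 166 * L\<^sup>2" if w: "w \<in> W" for w
  proof -
    have "2 ^ load w Ps \<le> (\<Sum>w\<in>W. 2 ^ load w Ps :: nat)"
      using member_le_sum[of w W "\<lambda>w. 2 ^ load w Ps :: nat"] w finW by simp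
    then have "2 ^ load w Ps \<le> real (\<Sum>w\<in>W. 2 ^ load w Ps)"
      using of_nat_mono[where 'a = real] by fastforce
    also have "\<dots> \<le> real n * (1 + q) ^ (6 * S)" by (rule Ps(5))
    also have "(1 + q) ^ (6 * S) \<le> exp q ^ (6 * S)"
      using exp_ge_add_one_self[of q] by (intro power_mono) (auto simp: q_def)
    also have "exp q ^ (6 * S) = exp (96 * L\<^sup>2)"
      using S unfolding q_def by (simp flip: exp_of_nat_mult)
    finally have "2 ^ load w Ps \<le> real n * exp (96 * L\<^sup>2)" using nV by simp
    then have "ln (2 ^ load w Ps) \<le> ln (real n * exp (96 * L\<^sup>2))" using nV by simp
    then have "real (load w Ps) * ln 2 \<le> ln (real n) + 96 * L\<^sup>2"
      using nV by (simp add: ln_realpow ln_mult)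
    also have "\<dots> \<le> ln 2 * L + 96 * L\<^sup>2" using ln_card_le(2)[OF nV] unfolding L_def n_def by simp
    \<comment> \<open>165 * 7/12 \<ge> 96; the remaining unit of 166 pays for ln |V|.\<close>
    also have "\<dots> \<le> ln 2 * L\<^sup>2 + 165 * (ln 2 * L\<^sup>2)"
    proof -
      have "ln 2 * L \<le> ln 2 * L\<^sup>2" using L1 self_le_power[of L 2] by (intro mult_left_mono) auto
      moreover have "7/12 * L\<^sup>2 \<le> ln 2 * L\<^sup>2" using ln_2_bounds(1) by (intro mult_right_mono) auto
      moreover have "0 \<le> L\<^sup>2" by simp
      ultimately show ?thesis by linarith
    qed
    finally have "real (load w Ps) * ln 2 \<le> (166 * L\<^sup>2) * ln 2" by (simp add: algebra_simps)
    then show ?thesis by simp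
  qed
  then show ?thesis using that Ps by blast
qed

end

section \<open>The cut-matching game\<close>

text \<open>A smallest union \<open>A\<close> of classes that satisfies the lower bound works. Let C
  be a class in it. If C alone satisfies the bound, minimality gives |A| \<le> |C| \<le> m/2.
  Otherwise both C and A - C have fewer than m/3 - z elements, hence |A| < 2m/3. The slack
  \<open>z\<close> accounts for elements lost to a separator.\<close>

lemma balanced_union_of_classes:
  fixes m z :: nat
  assumes fin: "finite Q" and refl: "\<And>u. u \<in> Q \<Longrightarrow> sim u u"
    and sym: "\<And>u v. sim u v \<Longrightarrow> sim v u" and trans: "\<And>u v w. sim u v \<Longrightarrow> sim v w \<Longrightarrow> sim u w"
    and small: "\<And>u. u \<in> Q \<Longrightarrow> 2 * card {v\<in>Q. sim u v} \<le> m" and total: "m \<le> card Q + z"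
  shows "\<exists>A\<subseteq>Q. (\<forall>u\<in>A. \<forall>v\<in>Q. sim u v \<longrightarrow> v \<in> A) \<and> m \<le> 3 * card A + 3 * z \<and> 3 * card A \<le> 2 * m"
proof -
  define P where "P A \<longleftrightarrow> A \<subseteq> Q \<and> (\<forall>u\<in>A. \<forall>v\<in>Q. sim u v \<longrightarrow> v \<in> A) \<and> m \<le> 3 * card A + 3 * z" for A
  have "P Q" using total unfolding P_def by auto
  then obtain A where A: "P A" "\<And>B. P B \<Longrightarrow> card A \<le> card B"
    using ex_has_least_nat[of P Q card] by blast
  have finA: "finite A" using A(1) fin finite_subset unfolding P_def by blast
  have "3 * card A \<le> 2 * m"
  proof (cases "A = {}")
    case False
    then obtain u where u: "u \<in> A" by blast
    let ?C = "{v\<in>Q. sim u v}"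
    have uQ: "u \<in> Q" and CA: "?C \<subseteq> A" using A(1) u unfolding P_def by auto
    have finC: "finite ?C" using fin by simp
    show ?thesis
    proof (cases "m \<le> 3 * card ?C + 3 * z")
      case True
      then have "P ?C" unfolding P_def by (auto intro: trans)
      then show ?thesis using A(2)[of ?C] small[OF uQ] by simp
    next
      case False
      have card: "card A = card ?C + card (A - ?C)"
        using CA finC finA by (metis (no_types, lifting) card_Diff_subset card_mono le_add_diff_inverse)
      have "u \<in> ?C" using refl uQ by simp
      then have "0 < card ?C" using finC card_gt_0_iff by blast
      have "\<not> P (A - ?C)" using A(2)[of "A - ?C"] card \<open>0 < card ?C\<close> by auto
      moreover have "v \<in> A - ?C" if "x \<in> A - ?C" "v \<in> Q" "sim x v" for x v
      proof -
        have "v \<in> A" using that A(1) unfolding P_def by blast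
        moreover have "\<not> sim u v" using that A(1) sym trans unfolding P_def by blast
        ultimately show ?thesis by simp
      qed
      moreover have "A - ?C \<subseteq> Q" using A(1) unfolding P_def by blast
      ultimately have "3 * card (A - ?C) + 3 * z < m" unfolding P_def by (meson not_le)
      then show ?thesis using False card by linarith
    qed
  qed simp
  then show ?thesis using A(1) unfolding P_def by blast
qed

text \<open>The transpositions of \<open>hd P\<close> and \<open>last P\<close> have disjoint
  supports, so their product is an involution that fixes all unmatched vertices.\<close>

lemma matching_involution:
  fixes Ps :: "'a list list"
  assumes "distinct (map hd Ps)" "distinct (map last Ps)"
    and "\<And>P. P \<in> set Ps \<Longrightarrow> hd P \<in> A \<and> last P \<in> B" and "A \<inter> B = {}"
  shows "\<exists>\<sigma>. (\<forall>u. \<sigma> (\<sigma> u) = u) \<and> (\<forall>P\<in>set Ps. \<sigma> (hd P) = last P) \<and>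
    (\<forall>u. \<sigma> u \<noteq> u \<longrightarrow> (\<exists>P\<in>set Ps. (u = hd P \<and> \<sigma> u = last P) \<or> (u = last P \<and> \<sigma> u = hd P)))"
  using assms(1-3)
proof (induction Ps)
  case Nil
  show ?case by (intro exI[of _ id]) auto
next
  case (Cons P Ps)
  then obtain \<sigma> where \<sigma>: "\<forall>u. \<sigma> (\<sigma> u) = u" "\<forall>P\<in>set Ps. \<sigma> (hd P) = last P"
    "\<forall>u. \<sigma> u \<noteq> u \<longrightarrow> (\<exists>P\<in>set Ps. (u = hd P \<and> \<sigma> u = last P) \<or> (u = last P \<and> \<sigma> u = hd P))"
    by auto
  let ?a = "hd P" and ?b = "last P"
  have PAB: "?a \<in> A" "?b \<in> B" using Cons.prems(3)[of P] by auto
  have new: "hd P' \<noteq> ?a" "last P' \<noteq> ?b" "hd P' \<noteq> ?b" "last P' \<noteq> ?a" if P': "P' \<in> set Ps" for P'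
  proof -
    have *: "hd P' \<in> A" "last P' \<in> B" using Cons.prems(3)[of P'] P' by auto
    show "hd P' \<noteq> ?a" "last P' \<noteq> ?b" using Cons.prems(1,2) P' by (force simp: image_iff)+
    show "hd P' \<noteq> ?b" "last P' \<noteq> ?a" using * PAB assms(4) by auto
  qed
  have fixed: "\<sigma> ?a = ?a" "\<sigma> ?b = ?b" using \<sigma>(3) new by metis+
  have ab: "?a \<noteq> ?b" using PAB assms(4) by auto
  let ?\<sigma> = "\<sigma>(?a := ?b, ?b := ?a)"
  have "\<sigma> u \<noteq> ?a" "\<sigma> u \<noteq> ?b" if "u \<noteq> ?a" "u \<noteq> ?b" for u
    using \<sigma>(1) fixed that by metis+
  then have "\<forall>u. ?\<sigma> (?\<sigma> u) = u" using \<sigma>(1) ab by auto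
  moreover have "\<forall>P'\<in>set (P # Ps). ?\<sigma> (hd P') = last P'" using \<sigma>(2) ab new by auto
  moreover have "\<forall>u. ?\<sigma> u \<noteq> u \<longrightarrow> (\<exists>P'\<in>set (P # Ps). (u = hd P' \<and> ?\<sigma> u = last P') \<or> (u = last P' \<and> ?\<sigma> u = hd P'))"
    using \<sigma>(3) by auto
  ultimately show ?case by blast
qed

lemma length_filter_mono:
  assumes "\<And>x. x \<in> set xs \<Longrightarrow> P x \<Longrightarrow> Q x"
  shows "length (filter P xs) \<le> length (filter Q xs)"
  using assms by (induction xs) (auto simp: le_SucI)

lemma length_filter_Bex_le:
  assumes "finite Z"
  shows "length (filter (\<lambda>P. \<exists>z\<in>Z. Q z P) Ps) \<le> (\<Sum>z\<in>Z. length (filter (Q z) Ps))"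
proof (induction Ps)
  case (Cons P Ps)
  show ?case
  proof (cases "\<exists>z\<in>Z. Q z P")
    case True
    then obtain z where z: "z \<in> Z" "Q z P" by blast
    have "(\<Sum>z\<in>Z. length (filter (Q z) Ps)) + 1 \<le>
        (\<Sum>z\<in>Z. length (filter (Q z) Ps)) + (\<Sum>z\<in>Z. if Q z P then 1 else 0)"
      using z assms member_le_sum[of z Z "\<lambda>z. if Q z P then 1 else 0 :: nat"] by simp
    also have "\<dots> = (\<Sum>z\<in>Z. length (filter (Q z) (P # Ps)))"
      unfolding sum.distrib[symmetric] by (intro sum.cong) auto
    finally show ?thesis using True Cons.IH by simp
  next
    case False
    then have "(\<Sum>z\<in>Z. length (filter (Q z) (P # Ps))) = (\<Sum>z\<in>Z. length (filter (Q z) Ps))"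
      by (intro sum.cong) auto
    then show ?thesis using False Cons.IH by simp
  qed
qed simp

context layered_graph begin

text \<open>The form in which the treewidth hypothesis enters the game: \<open>U\<close> induces a
  subgraph of maximum degree at most \<delta>, and \<open>z\<close> bounds the size of the
  separator.\<close>

definition has_balanced_separators :: "real \<Rightarrow> real \<Rightarrow> bool" where
  "has_balanced_separators \<delta> z \<longleftrightarrow>
     (\<forall>U\<subseteq>V. \<forall>X\<subseteq>U. (\<forall>v\<in>U. real (card (E `` {v} \<inter> U)) \<le> \<delta>) \<longrightarrow>
        (\<exists>Z\<subseteq>U. real (card Z) \<le> z \<and> (\<forall>u\<in>U - Z. 2 * card {v\<in>X. linked E (U - Z) u v} \<le> card X)))"

lemma load_append: "load w (Ps @ Qs) = load w Ps + load w Qs"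
  unfolding load_def by simp

lemma card_F_Int_walks:
  assumes "\<And>P. P \<in> set Ps \<Longrightarrow> short_in W P" "w \<in> W"
  shows "card (F w \<inter> (\<Union>P\<in>set Ps. set P)) \<le> 2 * k * load w Ps"
  using assms(1)
proof (induction Ps)
  case (Cons P Ps)
  have fin: "finite (F w \<inter> (\<Union>P\<in>set Ps. set P))" by simp
  have eq: "F w \<inter> (\<Union>P\<in>set (P # Ps). set P) = (set P \<inter> F w) \<union> (F w \<inter> (\<Union>P\<in>set Ps. set P))" by auto
  have "card (F w \<inter> (\<Union>P\<in>set (P # Ps). set P)) \<le> card (set P \<inter> F w) + card (F w \<inter> (\<Union>P\<in>set Ps. set P))"
    unfolding eq by (rule card_Un_le)
  moreover have "card (F w \<inter> (\<Union>P\<in>set Ps. set P)) \<le> 2 * k * load w Ps" using Cons by auto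
  moreover have "card (set P \<inter> F w) \<le> (if F w \<inter> set P \<noteq> {} then 2 * k else 0)"
    using Cons.prems[of P] assms(2) unfolding short_in_def by (auto simp: Int_commute)
  ultimately show ?case by (auto simp: load_def algebra_simps split: if_splits)
qed simp

text \<open>Neighbours outside \<open>F w\<close> are bounded by witnessing. Inside
  \<open>F w\<close>, the set \<open>X\<close> contributes at most \<open>w\<close> itself, because
  a center lies in no other member, and each walk that meets \<open>F w\<close> has at most 2k
  vertices there.\<close>

lemma degree_in_walks:
  assumes W: "W \<subseteq> Cn" and X: "X \<subseteq> W" and Ps: "\<And>P. P \<in> set Ps \<Longrightarrow> short_in W P"
    and U: "U = X \<union> (\<Union>P\<in>set Ps. set P)" and w: "w \<in> W" "v \<in> F w"
  shows "card (E `` {v} \<inter> U) \<le> t + 1 + 2 * k * load w Ps"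
proof -
  have finN: "finite (E `` {v})" using finite_subset[OF _ finite_V, of "E `` {v}"] E_subset by blast
  have finU: "finite U" unfolding U using finite_sources[OF order_trans[OF X W]] by simp
  have "X \<inter> F w \<subseteq> {w}" using source_in_F X W by blast
  then have "card (X \<inter> F w) \<le> 1" using card_mono[of "{w}"] by simp
  have "E `` {v} \<inter> U \<subseteq> (E `` {v} - F w) \<union> ((X \<inter> F w) \<union> (F w \<inter> (\<Union>P\<in>set Ps. set P)))"
    unfolding U by auto
  then have "card (E `` {v} \<inter> U) \<le> card ((E `` {v} - F w) \<union> ((X \<inter> F w) \<union> (F w \<inter> (\<Union>P\<in>set Ps. set P))))"
    using finN finU unfolding U by (intro card_mono) auto
  also have "\<dots> \<le> card (E `` {v} - F w) + (card (X \<inter> F w) + card (F w \<inter> (\<Union>P\<in>set Ps. set P)))"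
    by (meson card_Un_le le_trans nat_add_left_cancel_le)
  also have "\<dots> \<le> t + (1 + 2 * k * load w Ps)"
    using witnessing[of w v] w W \<open>card (X \<inter> F w) \<le> 1\<close> card_F_Int_walks[OF Ps w(1)]
    by (intro add_mono) auto
  finally show ?thesis by simp
qed

text \<open>
  The cut-matching game: as long as the union \<open>U\<close> of the walks chosen so far has small degree, it has
  a small balanced separator \<open>Z\<close>. Few of the walks cross the cut that \<open>Z\<close> induces on \<open>X\<close>, so a new
  matching across this cut raises the entropy of the random walk \<open>p\<close> on \<open>X\<close> by a constant multiple
  of \<open>card X\<close>; but that entropy is at most \<open>card X * ln (card X)\<close>.
\<close>

lemma cut_matching_game:
  fixes S :: nat and z \<delta> :: real
  defines "L \<equiv> log 2 (2 * real (card V))"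
  defines "lam \<equiv> 11 * ln (22 * real S) * (166 * L\<^sup>2)"
  assumes W: "W \<subseteq> Cn" and X: "X \<subseteq> W" "card X = 22 * S" and S: "6 \<le> S"
    and nosep: "well_linked S W X"
    and sep: "has_balanced_separators \<delta> z"
    and \<delta>: "real t + 1 + 2 * real k * lam \<le> \<delta>"
    and z: "3 * z \<le> real S" "z * lam \<le> 3/2 * real S"
  shows False
proof -
  have finX: "finite X" using X W finite_sources by (meson finite_subset)
  define q0 where "q0 = 166 * L\<^sup>2"
  have q0: "0 \<le> q0" unfolding q0_def by simp
  \<comment> \<open>The cross mass is controlled for every cut, since the next cut depends on the
    walks chosen so far.\<close>
  define Inv where "Inv j p Ps \<longleftrightarrow> stochastic_on X p \<and>
    (\<forall>P\<in>set Ps. short_in W P \<and> hd P \<in> X \<and> last P \<in> X) \<and>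
    (\<forall>w\<in>W. real (load w Ps) \<le> real j * q0) \<and>
    (\<forall>A\<subseteq>X. cross_mass X A p \<le> real (length (filter (\<lambda>P. (hd P \<in> A) \<noteq> (last P \<in> A)) Ps))) \<and>
    2 * real S * real j \<le> entropy_on X p" for j :: nat and p and Ps :: "'a list list"
  have step: "\<exists>p' Ps'. Inv (Suc j) p' Ps'" if inv: "Inv j p Ps" and j: "real j \<le> 11 * ln (22 * real S)" for j p Ps
  proof -
    have st: "stochastic_on X p" and
      Ps: "\<And>P. P \<in> set Ps \<Longrightarrow> short_in W P" "\<And>P. P \<in> set Ps \<Longrightarrow> hd P \<in> X \<and> last P \<in> X" and
      ld: "\<And>w. w \<in> W \<Longrightarrow> real (load w Ps) \<le> real j * q0" and
      cr: "\<And>A. A \<subseteq> X \<Longrightarrow> cross_mass X A p \<le> real (length (filter (\<lambda>P. (hd P \<in> A) \<noteq> (last P \<in> A)) Ps))" and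
      en: "2 * real S * real j \<le> entropy_on X p"
      using inv unfolding Inv_def by auto
    have jq: "real j * q0 \<le> lam" unfolding lam_def q0_def[symmetric] using j q0 by (rule mult_right_mono)
    define U where "U = X \<union> (\<Union>P\<in>set Ps. set P)"
    have PW: "walk E (FU W) P" if "P \<in> set Ps" for P using Ps(1)[OF that] unfolding short_in_def by simp
    have UW: "U \<subseteq> FU W" using X PW unfolding U_def walk_def by blast
    have UV: "U \<subseteq> V" using UW FU_subset[OF W] by blast
    have finU: "finite U" using UV finite_V finite_subset by blast
    have "\<forall>v\<in>U. real (card (E `` {v} \<inter> U)) \<le> \<delta>"
    proof
      fix v assume "v \<in> U"
      then obtain w where w: "w \<in> W" "v \<in> F w" using UW by blast
      have "real (card (E `` {v} \<inter> U)) \<le> real (t + 1 + 2 * k * load w Ps)"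
        using degree_in_walks[OF W X(1) Ps(1) U_def w] by (rule of_nat_mono)
      also have "\<dots> = real t + 1 + 2 * real k * real (load w Ps)" by simp
      also have "\<dots> \<le> real t + 1 + 2 * real k * lam"
        using ld[OF w(1)] jq by (intro add_left_mono mult_left_mono) auto
      finally show "real (card (E `` {v} \<inter> U)) \<le> \<delta>" using \<delta> by linarith
    qed
    moreover have "X \<subseteq> U" unfolding U_def by blast
    ultimately have "\<exists>Z\<subseteq>U. real (card Z) \<le> z \<and> (\<forall>u\<in>U - Z. 2 * card {v\<in>X. linked E (U - Z) u v} \<le> card X)"
      using sep UV unfolding has_balanced_separators_def by blast
    then obtain Z where Z: "Z \<subseteq> U" "real (card Z) \<le> z"
      "\<And>u. u \<in> U - Z \<Longrightarrow> 2 * card {v\<in>X. linked E (U - Z) u v} \<le> card X"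
      by auto
    have finZ: "finite Z" using Z(1) finU finite_subset by blast
    let ?Q = "X - Z"
    have "\<exists>A\<subseteq>?Q. (\<forall>u\<in>A. \<forall>v\<in>?Q. linked E (U - Z) u v \<longrightarrow> v \<in> A) \<and>
        22 * S \<le> 3 * card A + 3 * card Z \<and> 3 * card A \<le> 2 * (22 * S)"
    proof (rule balanced_union_of_classes)
      show "finite ?Q" using finX by simp
      show "linked E (U - Z) u u" if "u \<in> ?Q" for u using that unfolding U_def by (intro linked_refl) auto
      show "linked E (U - Z) v u" if "linked E (U - Z) u v" for u v using that linked_sym sym_E by metis
      show "linked E (U - Z) u w" if "linked E (U - Z) u v" "linked E (U - Z) v w" for u v w
        using that linked_trans by metis
      show "2 * card {v\<in>?Q. linked E (U - Z) u v} \<le> 22 * S" if "u \<in> ?Q" for u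
      proof -
        have "card {v\<in>?Q. linked E (U - Z) u v} \<le> card {v\<in>X. linked E (U - Z) u v}"
          using finX by (intro card_mono) auto
        moreover have "u \<in> U - Z" using that unfolding U_def by auto
        ultimately show ?thesis using Z(3)[of u] X(2) by simp
      qed
      show "22 * S \<le> card ?Q + card Z" using diff_card_le_card_Diff[OF finZ, of X] X(2) by simp
    qed
    then obtain A where A: "A \<subseteq> X - Z" "\<And>u v. u \<in> A \<Longrightarrow> v \<in> X - Z \<Longrightarrow> linked E (U - Z) u v \<Longrightarrow> v \<in> A"
      "22 * S \<le> 3 * card A + 3 * card Z" "3 * card A \<le> 2 * (22 * S)" by blast
    have AX: "A \<subseteq> X" using A(1) by blast
    have "3 * card Z \<le> S" using Z(2) z(1) by linarith
    \<comment> \<open>The reason for 22 and 7: |A| \<ge> 22S/3 - |Z| \<ge> 7S because 3 |Z| \<le> S,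
      and |X - A| \<ge> 22S/3.\<close>
    then have cA: "7 * S \<le> card A" using A(3) by linarith
    have "card (X - A) = card X - card A" using finX AX by (meson card_Diff_subset finite_subset)
    then have cB: "7 * S \<le> card (X - A)" using A(4) X(2) by linarith
    \<comment> \<open>\<open>A\<close> is closed in \<open>X - Z\<close> under linkage within
      \<open>U - Z\<close>, so a walk between the two sides must meet \<open>Z\<close>.\<close>
    have hitZ: "\<exists>z\<in>Z. z \<in> set P" if P: "P \<in> set Ps" "(hd P \<in> A) \<noteq> (last P \<in> A)" for P
    proof (rule ccontr)
      assume "\<not> ?thesis"
      then have sP: "set P \<subseteq> U - Z" using P(1) unfolding U_def by auto
      then have w: "walk E (U - Z) P" using PW[OF P(1)] by (rule walk_mono[rotated])
      then have "P \<noteq> []" unfolding walk_def by simp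
      then have "hd P \<in> X - Z" "last P \<in> X - Z" using Ps(2)[OF P(1)] sP hd_in_set last_in_set by blast+
      moreover have "linked E (U - Z) (hd P) (last P)" using w unfolding linked_def by blast
      ultimately show False using P(2) A(2)[of "hd P" "last P"] A(2)[of "last P" "hd P"] linked_sym[OF sym_E] by metis
    qed
    have "length (filter (\<lambda>P. (hd P \<in> A) \<noteq> (last P \<in> A)) Ps) \<le> length (filter (\<lambda>P. \<exists>z\<in>Z. z \<in> set P) Ps)"
      using hitZ by (rule length_filter_mono)
    also have "\<dots> \<le> (\<Sum>z\<in>Z. length (filter (\<lambda>P. z \<in> set P) Ps))" using length_filter_Bex_le[OF finZ] .
    finally have "real (length (filter (\<lambda>P. (hd P \<in> A) \<noteq> (last P \<in> A)) Ps)) \<le>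
        (\<Sum>z\<in>Z. real (length (filter (\<lambda>P. z \<in> set P) Ps)))"
      unfolding of_nat_sum[symmetric] by (rule of_nat_mono)
    \<comment> \<open>A vertex of \<open>Z\<close> lies in some member, whose load bounds the number
      of walks through that vertex.\<close>
    also have "\<dots> \<le> (\<Sum>z\<in>Z. lam)"
    proof (rule sum_mono)
      fix y assume "y \<in> Z"
      then obtain w where w: "w \<in> W" "y \<in> F w" using Z(1) UW by blast
      have "length (filter (\<lambda>P. y \<in> set P) Ps) \<le> load w Ps"
        unfolding load_def using w(2) by (intro length_filter_mono) blast
      then show "real (length (filter (\<lambda>P. y \<in> set P) Ps)) \<le> lam" using ld[OF w(1)] jq by linarith
    qed
    also have "\<dots> = real (card Z) * lam" by simp
    also have "\<dots> \<le> z * lam" using Z(2) jq q0 by (intro mult_right_mono) (auto intro: order_trans[rotated])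
    also have "\<dots> \<le> 3/2 * real S" by (rule z(2))
    finally have crA: "cross_mass X A p \<le> 3/2 * real S" using cr[OF AX] by linarith
    obtain Qs where Qs: "length Qs = 6 * S" "distinct (map hd Qs)" "distinct (map last Qs)"
      "\<And>P. P \<in> set Qs \<Longrightarrow> short_in W P \<and> hd P \<in> A \<and> last P \<in> X - A"
      "\<And>w. w \<in> W \<Longrightarrow> real (load w Qs) \<le> 166 * L\<^sup>2"
      by (rule low_congestion_matching[OF W S nosep AX cA Diff_subset cB, folded L_def]) (rule that)
    have "\<exists>\<sigma>. (\<forall>u. \<sigma> (\<sigma> u) = u) \<and> (\<forall>P\<in>set Qs. \<sigma> (hd P) = last P) \<and>
      (\<forall>u. \<sigma> u \<noteq> u \<longrightarrow> (\<exists>P\<in>set Qs. (u = hd P \<and> \<sigma> u = last P) \<or> (u = last P \<and> \<sigma> u = hd P)))"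
      by (rule matching_involution[OF Qs(2,3), of A "X - A"]) (use Qs(4) in auto)
    then obtain \<sigma> where \<sigma>: "\<And>u. \<sigma> (\<sigma> u) = u" "\<And>P. P \<in> set Qs \<Longrightarrow> \<sigma> (hd P) = last P"
      "\<And>u. \<sigma> u \<noteq> u \<Longrightarrow> \<exists>P\<in>set Qs. (u = hd P \<and> \<sigma> u = last P) \<or> (u = last P \<and> \<sigma> u = hd P)"
      by auto
    have io: "involution_on X \<sigma>" unfolding involution_on_def
    proof
      fix u assume "u \<in> X"
      then have "\<sigma> u \<in> X" using \<sigma>(3)[of u] Qs(4) AX by (cases "\<sigma> u = u") auto
      then show "\<sigma> u \<in> X \<and> \<sigma> (\<sigma> u) = u" using \<sigma>(1) by simp
    qed
    have cross: "card {u\<in>B. \<sigma> u \<in> X - B} \<le> length (filter (\<lambda>P. (hd P \<in> B) \<noteq> (last P \<in> B)) Qs)" for B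
    proof -
      let ?Fs = "filter (\<lambda>P. (hd P \<in> B) \<noteq> (last P \<in> B)) Qs" and ?g = "\<lambda>P. if hd P \<in> B then hd P else last P"
      have "{u\<in>B. \<sigma> u \<in> X - B} \<subseteq> ?g ` set ?Fs"
      proof
        fix u assume u: "u \<in> {u\<in>B. \<sigma> u \<in> X - B}"
        then have "\<sigma> u \<noteq> u" by auto
        then obtain P where P: "P \<in> set Qs" "(u = hd P \<and> \<sigma> u = last P) \<or> (u = last P \<and> \<sigma> u = hd P)"
          using \<sigma>(3) by blast
        then have "P \<in> set ?Fs" "u = ?g P" using u by auto
        then show "u \<in> ?g ` set ?Fs" by blast
      qed
      then have "card {u\<in>B. \<sigma> u \<in> X - B} \<le> card (?g ` set ?Fs)" by (intro card_mono) auto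
      also have "\<dots> \<le> length ?Fs" by (meson List.finite_set card_image_le card_length le_trans)
      finally show ?thesis .
    qed
    have "hd ` set Qs \<subseteq> {u\<in>A. \<sigma> u \<in> X - A}" using Qs(4) \<sigma>(2) by auto
    then have "card (hd ` set Qs) \<le> card {u\<in>A. \<sigma> u \<in> X - A}"
      using finite_subset[OF AX finX] by (intro card_mono) auto
    moreover have "card (hd ` set Qs) = 6 * S" using Qs(1,2) by (metis distinct_card length_map set_map)
    ultimately have mt: "6 * real S \<le> real (card {u\<in>A. \<sigma> u \<in> X - A})" by linarith
    have "Inv (Suc j) (mix \<sigma> p) (Ps @ Qs)" unfolding Inv_def
    proof (intro conjI ballI allI impI)
      show "stochastic_on X (mix \<sigma> p)" using stochastic_on_mix[OF st io] .
      fix P assume "P \<in> set (Ps @ Qs)"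
      then show "short_in W P" "hd P \<in> X" "last P \<in> X" using Ps Qs(4) AX by auto
    next
      fix w assume "w \<in> W"
      then show "real (load w (Ps @ Qs)) \<le> real (Suc j) * q0"
        using ld[of w] Qs(5)[of w, folded q0_def] unfolding load_append by (simp add: algebra_simps)
    next
      fix B assume B: "B \<subseteq> X"
      have "cross_mass X B (mix \<sigma> p) \<le> cross_mass X B p + real (card {u\<in>B. \<sigma> u \<in> X - B})"
        using cross_mass_mix[OF st io finX B] .
      then show "cross_mass X B (mix \<sigma> p) \<le> real (length (filter (\<lambda>P. (hd P \<in> B) \<noteq> (last P \<in> B)) (Ps @ Qs)))"
        using cr[OF B] of_nat_mono[OF cross[of B], where 'a = real] by simp
    next
      \<comment> \<open>A matching of 6S pairs gains 4S, of which the cross mass costs at most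
        2S.\<close>
      have "2 * real S * real (Suc j) = 2 * real S * real j + 2/3 * (6 * real S) - 4/3 * (3/2 * real S)"
        by (simp add: algebra_simps)
      also have "\<dots> \<le> entropy_on X p + 2/3 * real (card {u\<in>A. \<sigma> u \<in> X - A}) - 4/3 * cross_mass X A p"
        using en mt crA by linarith
      also have "\<dots> \<le> entropy_on X (mix \<sigma> p)" using entropy_on_mix[OF st io finX AX] .
      finally show "2 * real S * real (Suc j) \<le> entropy_on X (mix \<sigma> p)" .
    qed
    then show ?thesis by blast
  qed
  \<comment> \<open>One round more than the entropy bound 22S ln (22S) permits at 2S per
    round.\<close>
  define T where "T = nat \<lfloor>11 * ln (22 * real S)\<rfloor> + 1"
  have l0: "0 \<le> ln (22 * real S)" using S by simp
  have T: "11 * ln (22 * real S) < real T" unfolding T_def by linarith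
  have "\<exists>p Ps. Inv j p Ps" if "j \<le> T" for j
    using that
  proof (induction j)
    case 0
    have "Inv 0 (\<lambda>u s. if u = s then 1 else 0) []"
      unfolding Inv_def using identity_walk[OF finX refl] by (auto simp: load_def)
    then show ?case by blast
  next
    case (Suc j)
    then obtain p Ps where "Inv j p Ps" by auto
    moreover have "real j \<le> 11 * ln (22 * real S)" using Suc.prems l0 unfolding T_def by linarith
    ultimately show ?case by (rule step)
  qed
  then obtain p Ps where "Inv T p Ps" by blast
  then have "stochastic_on X p" "2 * real S * real T \<le> entropy_on X p" unfolding Inv_def by auto
  moreover have "X \<noteq> {}" using X(2) S by auto
  ultimately have "2 * real S * real T \<le> 22 * real S * ln (22 * real S)"
    using entropy_on_le[of X p] finX X(2) by simp
  then have "2 * real S * real T \<le> 2 * real S * (11 * ln (22 * real S))" by simp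
  then show False using T S by simp
qed

text \<open>If after removal of any S members some component keeps all but at most S elements of
  \<open>X\<close>, that component meets every subset with more than S elements, so the set is well
  linked and the game gives a contradiction. The game is played on exactly 22S elements of
  \<open>X\<close>, which fixes its number of rounds.\<close>

lemma balanced_separator:
  fixes S :: nat and z \<delta> :: real
  defines "L \<equiv> log 2 (2 * real (card V))"
  defines "lam \<equiv> 11 * ln (22 * real S) * (166 * L\<^sup>2)"
  assumes W: "W \<subseteq> Cn" and X: "X \<subseteq> W" "22 * S \<le> card X" and S: "6 \<le> S"
    and sep: "has_balanced_separators \<delta> z"
    and \<delta>: "real t + 1 + 2 * real k * lam \<le> \<delta>"
    and z: "3 * z \<le> real S" "z * lam \<le> 3/2 * real S"
  shows "\<exists>Y\<subseteq>W. card Y \<le> S \<and> (\<forall>u\<in>FU W - FU Y. card {v\<in>X. linked E (FU W - FU Y) u v} + S < card X)"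
proof (rule ccontr)
  assume no: "\<not> ?thesis"
  have finX: "finite X" using X W finite_sources by (meson finite_subset)
  obtain X' where X': "X' \<subseteq> X" "card X' = 22 * S" using X(2) by (metis obtain_subset_with_card_n)
  have "\<exists>xs. walk E (FU W - FU Y) xs \<and> hd xs \<in> A \<and> last xs \<in> B"
    if AB: "A \<subseteq> X'" "B \<subseteq> X'" "S < card A" "S < card B" and Y: "Y \<subseteq> W" "card Y \<le> S" for A B Y
  proof -
    have "\<not> (\<forall>u\<in>FU W - FU Y. card {v\<in>X. linked E (FU W - FU Y) u v} + S < card X)"
      using no Y by blast
    then obtain u where u: "card X \<le> card {v\<in>X. linked E (FU W - FU Y) u v} + S"
      unfolding not_less[symmetric] by blast
    let ?C = "{v\<in>X. linked E (FU W - FU Y) u v}"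
    have "card (X - ?C) = card X - card ?C" using finX by (intro card_Diff_subset) auto
    then have small: "card (X - ?C) \<le> S" using u by linarith
    have meet: "\<exists>a\<in>B'. linked E (FU W - FU Y) u a" if "B' \<subseteq> X'" "S < card B'" for B'
    proof (rule ccontr)
      assume "\<not> ?thesis"
      then have "B' \<subseteq> X - ?C" using that X' by auto
      then have "card B' \<le> S" using card_mono[of "X - ?C" B'] finX small by auto
      then show False using that by simp
    qed
    obtain a b where "a \<in> A" "linked E (FU W - FU Y) u a" "b \<in> B" "linked E (FU W - FU Y) u b"
      using meet AB by meson
    then have "linked E (FU W - FU Y) a b" using linked_sym[OF sym_E] linked_trans by metis
    then show ?thesis using \<open>a \<in> A\<close> \<open>b \<in> B\<close> unfolding linked_def by blast
  qed
  then have "well_linked S W X'" unfolding well_linked_def by blast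
  then show False
    by (rule cut_matching_game[OF W order_trans[OF X'(1) X(1)] X'(2) S _ sep
          \<delta>[unfolded lam_def L_def] z(1) z(2)[unfolded lam_def L_def]])
qed

end

section \<open>Construction of the decomposition\<close>

context layered_graph begin

definition splits_centers :: "nat \<Rightarrow> bool" where
  "splits_centers S \<longleftrightarrow> (\<forall>W\<subseteq>Cn. \<forall>X\<subseteq>W. 22 * S \<le> card X \<longrightarrow>
     (\<exists>Y\<subseteq>W. card Y \<le> S \<and> (\<forall>u\<in>FU W - FU Y. card {v\<in>X. linked E (FU W - FU Y) u v} + S < card X)))"

definition uncovered :: "nat \<Rightarrow> (nat \<Rightarrow> 'a set) \<Rightarrow> 'a set" where
  "uncovered N bag = V - (\<Union>i<N. bag i)"

text \<open>The tree is given by parents of smaller index. Connectedness is encoded by a topmost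
  node for each covered vertex: every other node that contains the vertex has a parent that contains
  it. The last clause attaches the component of each uncovered \<open>c\<close> to at most
  \<open>M\<close> members inside a single bag.\<close>

definition partial_decomposition :: "nat \<Rightarrow> nat \<Rightarrow> nat \<Rightarrow> (nat \<Rightarrow> nat) \<Rightarrow> (nat \<Rightarrow> 'a set) \<Rightarrow> bool" where
  "partial_decomposition S M N par bag \<longleftrightarrow> 0 < N \<and>
     (\<forall>i. 0 < i \<longrightarrow> i < N \<longrightarrow> par i < i) \<and>
     (\<forall>i<N. \<exists>X\<subseteq>Cn. card X \<le> M + (S + 1) \<and> bag i = FU X) \<and>
     (\<forall>(u, v)\<in>E. u \<notin> uncovered N bag \<longrightarrow> v \<notin> uncovered N bag \<longrightarrow> (\<exists>i<N. u \<in> bag i \<and> v \<in> bag i)) \<and>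
     (\<forall>v\<in>V - uncovered N bag. \<exists>r<N. v \<in> bag r \<and> (\<forall>i<N. v \<in> bag i \<longrightarrow> i \<noteq> r \<longrightarrow> 0 < i \<and> v \<in> bag (par i))) \<and>
     (\<forall>c\<in>uncovered N bag. \<exists>i<N. \<exists>X\<subseteq>Cn. card X \<le> M \<and> FU X \<subseteq> bag i \<and>
        (\<forall>u v. linked E (uncovered N bag) c u \<longrightarrow> (u, v) \<in> E \<longrightarrow> v \<notin> uncovered N bag \<longrightarrow> v \<in> FU X))"

text \<open>\<open>C\<close> is a union of components of the graph induced by \<open>R\<close>, with
  its outer boundary in \<open>FU X\<close>.\<close>

definition attached :: "'a set \<Rightarrow> 'a set \<Rightarrow> 'a set \<Rightarrow> bool" where
  "attached X R C \<longleftrightarrow> X \<subseteq> Cn \<and> R \<subseteq> V \<and> FU X \<inter> R = {} \<and> C \<subseteq> R \<and>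
     (\<forall>u\<in>C. \<forall>v. (u, v) \<in> E \<longrightarrow> (if v \<in> R then v \<in> C else v \<in> FU X))"

lemma attachedD:
  assumes "attached X R C"
  shows "X \<subseteq> Cn" "R \<subseteq> V" "FU X \<inter> R = {}" "C \<subseteq> R"
    "\<And>u v. u \<in> C \<Longrightarrow> (u, v) \<in> E \<Longrightarrow> v \<notin> R \<Longrightarrow> v \<in> FU X"
    "\<And>u v. u \<in> C \<Longrightarrow> (u, v) \<in> E \<Longrightarrow> v \<in> R \<Longrightarrow> v \<in> C"
  using assms unfolding attached_def by (auto split: if_splits)

text \<open>Makes FU X \<union> C a union of members again, so that separators can be sought within
  it. Going up from \<open>C\<close> along \<open>D\<close> cannot leave \<open>C\<close>: a
  predecessor outside \<open>R\<close> would lie in \<open>FU X\<close>, which is closed under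
  descendants and disjoint from \<open>R\<close>.\<close>

lemma component_in_family:
  assumes att: "attached X R C"
  shows "FU (X \<union> (C \<inter> Cn)) = FU X \<union> C" and "C \<noteq> {} \<Longrightarrow> C \<inter> Cn \<noteq> {}"
proof -
  note bd = attachedD(5)[OF att] and C = attachedD(4,6)[OF att] and R = attachedD(2,3)[OF att]
  have down: "v \<in> FU X \<union> C" if "(w, v) \<in> D\<^sup>*" "w \<in> FU X \<union> C" for w v
    using that
  proof (induction rule: rtrancl_induct)
    case (step y z)
    have "(y, z) \<in> E" using step D_subset by blast
    show ?case
    proof (cases "y \<in> FU X")
      case True
      then show ?thesis using step(2) by (auto intro: rtrancl_into_rtrancl)
    next
      case False
      then have "y \<in> C" using step by blast
      then show ?thesis using bd C(2) \<open>(y, z) \<in> E\<close> by blast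
    qed
  qed
  have up: "w \<in> C" if "(w, v) \<in> D\<^sup>*" "v \<in> C" for w v
    using that
  proof (induction rule: converse_rtrancl_induct)
    case (step y z)
    then have "z \<in> C" by blast
    have "(z, y) \<in> E" using step D_subset sym_E unfolding sym_def by blast
    have "y \<in> R"
    proof (rule ccontr)
      assume "y \<notin> R"
      then have "y \<in> FU X" using bd \<open>z \<in> C\<close> \<open>(z, y) \<in> E\<close> by blast
      then have "z \<in> FU X" using step(1) by (auto intro: rtrancl_into_rtrancl)
      then show False using \<open>z \<in> C\<close> C R by blast
    qed
    then show ?case using C(2) \<open>z \<in> C\<close> \<open>(z, y) \<in> E\<close> by blast
  qed
  have src: "\<exists>w\<in>C \<inter> Cn. (w, v) \<in> D\<^sup>*" if "v \<in> C" for v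
    using covered[of v] that C R up by blast
  show "FU (X \<union> (C \<inter> Cn)) = FU X \<union> C" using down src by blast
  show "C \<noteq> {} \<Longrightarrow> C \<inter> Cn \<noteq> {}" using src by blast
qed

text \<open>\<open>Y\<close> always contains a center \<open>w0\<close> in \<open>C\<close>, so that
  a new vertex gets covered; hence S + 1. If |X| = M, the separator leaves \<open>c\<close> linked
  to at most M - S - 1 elements of \<open>X\<close>, and together with \<open>Y\<close> these are
  again at most \<open>M\<close> centers.\<close>

lemma new_bag:
  assumes S: "splits_centers S" and M: "22 * (S + 1) \<le> M"
    and cardX: "card X \<le> M" and att: "attached X R C" and ne: "C \<noteq> {}"
  shows "\<exists>Y\<subseteq>Cn. card Y \<le> S + 1 \<and> FU (X \<union> Y) \<subseteq> FU X \<union> C \<and> FU Y \<inter> C \<noteq> {} \<and>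
    (\<forall>c\<in>C - FU (X \<union> Y). \<exists>X'\<subseteq>X \<union> Y. card X' \<le> M \<and>
       (\<forall>u v. linked E (R - FU (X \<union> Y)) c u \<longrightarrow> (u, v) \<in> E \<longrightarrow> v \<notin> R - FU (X \<union> Y) \<longrightarrow> v \<in> FU X'))"
proof -
  note bd = attachedD(5)[OF att] and C = attachedD(4,6)[OF att] and X = attachedD(1)[OF att]
  define W where "W = X \<union> (C \<inter> Cn)"
  have WC: "W \<subseteq> Cn" and XW: "X \<subseteq> W" using X unfolding W_def by auto
  have FW: "FU W = FU X \<union> C" and "C \<inter> Cn \<noteq> {}"
    using component_in_family[OF att] ne unfolding W_def by blast+
  then obtain w0 where w0: "w0 \<in> C" "w0 \<in> Cn" by blast
  have w0W: "w0 \<in> W" using w0 unfolding W_def by blast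
  have finX: "finite X" using finite_sources[OF X] .
  have sub: "FU Y \<subseteq> FU X \<union> C" if "Y \<subseteq> W" for Y using that FW by blast
  have comp: "walk E R' xs \<Longrightarrow> hd xs \<in> C \<Longrightarrow> R' \<subseteq> R \<Longrightarrow> set xs \<subseteq> C" for xs R'
    by (rule walk_invariant[of E R']) (use C(2) in blast)+
  have out: "v \<in> FU (X \<union> Y)"
    if cu: "c \<in> C" "linked E (R - FU (X \<union> Y)) c u" "(u, v) \<in> E" "v \<notin> R - FU (X \<union> Y)" for c u v Y
  proof -
    obtain xs where xs: "walk E (R - FU (X \<union> Y)) xs" "hd xs = c" "last xs = u"
      using cu(2) unfolding linked_def by blast
    have "set xs \<subseteq> C" using comp[OF xs(1)] xs(2) cu(1) by blast
    then have "u \<in> C" using xs(1,3) unfolding walk_def by auto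
    then show ?thesis using bd[of u v] cu(3,4) by blast
  qed
  show ?thesis
  proof (cases "card X < M")
    case True
    have "card (X \<union> {w0}) \<le> M" using True finX by (simp add: card_insert_if)
    moreover have "FU {w0} \<inter> C \<noteq> {}" using w0 by blast
    moreover have "FU (X \<union> {w0}) \<subseteq> FU X \<union> C" using sub[of "X \<union> {w0}"] XW w0W by blast
    moreover have "\<exists>X'\<subseteq>X \<union> {w0}. card X' \<le> M \<and> (\<forall>u v. linked E (R - FU (X \<union> {w0})) c u \<longrightarrow>
        (u, v) \<in> E \<longrightarrow> v \<notin> R - FU (X \<union> {w0}) \<longrightarrow> v \<in> FU X')" if c: "c \<in> C - FU (X \<union> {w0})" for c
    proof (intro exI[of _ "X \<union> {w0}"] conjI allI impI)
      show "card (X \<union> {w0}) \<le> M" by fact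
      show "v \<in> FU (X \<union> {w0})" if "linked E (R - FU (X \<union> {w0})) c u" "(u, v) \<in> E"
        "v \<notin> R - FU (X \<union> {w0})" for u v
        using out[OF _ that] c by blast
    qed simp
    moreover have "{w0} \<subseteq> Cn" "card {w0} \<le> S + 1" using w0 by auto
    ultimately show ?thesis by - (rule exI[of _ "{w0}"], intro conjI ballI)
  next
    case False
    then have cX: "card X = M" using cardX by simp
    then have "22 * S \<le> card X" using M by simp
    then obtain Y1 where Y1: "Y1 \<subseteq> W" "card Y1 \<le> S"
      "\<And>u. u \<in> FU W - FU Y1 \<Longrightarrow> card {v\<in>X. linked E (FU W - FU Y1) u v} + S < card X"
      using S[unfolded splits_centers_def, rule_format, OF WC XW] by auto
    define Y where "Y = insert w0 Y1"
    have finY: "finite Y1" using finite_sources[OF order_trans[OF Y1(1) WC]] .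
    have YW: "Y \<subseteq> W" using Y1 w0W unfolding Y_def by blast
    have cY: "card Y \<le> S + 1" using Y1(2) finY unfolding Y_def by (simp add: card_insert_if)
    have "\<exists>X'\<subseteq>X \<union> Y. card X' \<le> M \<and>
       (\<forall>u v. linked E (R - FU (X \<union> Y)) c u \<longrightarrow> (u, v) \<in> E \<longrightarrow> v \<notin> R - FU (X \<union> Y) \<longrightarrow> v \<in> FU X')"
      if c: "c \<in> C - FU (X \<union> Y)" for c
    proof -
      let ?B = "{x\<in>X. linked E (FU W - FU Y1) c x}"
      have "c \<in> FU W - FU Y1" using c FW unfolding Y_def by blast
      then have "card ?B + S < card X" by (rule Y1(3))
      then have "card (Y \<union> ?B) \<le> M" using cY cX card_Un_le[of Y ?B] by linarith
      moreover have "v \<in> FU (Y \<union> ?B)"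
        if uv: "linked E (R - FU (X \<union> Y)) c u" "(u, v) \<in> E" "v \<notin> R - FU (X \<union> Y)" for u v
      proof (cases "v \<in> FU Y")
        case False
        have "v \<in> FU (X \<union> Y)" using out uv c by blast
        then obtain x where x: "x \<in> X" "v \<in> F x" using False by blast
        have vW: "v \<in> FU W - FU Y1" using x XW False unfolding Y_def by blast
        obtain xs where xs: "walk E (R - FU (X \<union> Y)) xs" "hd xs = c" "last xs = u"
          using uv(1) unfolding linked_def by blast
        have "set xs \<subseteq> C" using comp[OF xs(1)] xs(2) c by blast
        moreover have "set xs \<inter> FU Y1 = {}" using xs(1) unfolding walk_def Y_def by blast
        ultimately have "walk E (FU W - FU Y1) xs" using FW by (intro walk_mono[OF xs(1)]) blast
        then have "linked E (FU W - FU Y1) c u" using xs unfolding linked_def by blast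
        then have "linked E (FU W - FU Y1) c v" using linked_step uv(2) vW by metis
        \<comment> \<open>The way down from \<open>x\<close> to \<open>v\<close> avoids
          \<open>FU Y1\<close>, since that set is closed under descendants and misses
          \<open>v\<close>.\<close>
        moreover have "linked E (FU W - FU Y1) x v"
        proof -
          obtain us where us: "walk E (F x) us" "hd us = x" "last us = v" "\<And>z. z \<in> set us \<Longrightarrow> (z, v) \<in> D\<^sup>*"
            using center_walk[of x v] x X by blast
          have "set us \<subseteq> FU W - FU Y1"
          proof
            fix z assume z: "z \<in> set us"
            have "z \<in> FU W" using z us(1) x XW unfolding walk_def by blast
            moreover have "z \<notin> FU Y1" using us(4)[OF z] vW by (blast intro: rtrancl_trans)
            ultimately show "z \<in> FU W - FU Y1" by blast
          qed
          then have "walk E (FU W - FU Y1) us" using walk_mono us(1) by metis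
          then show ?thesis using us unfolding linked_def by blast
        qed
        ultimately have "linked E (FU W - FU Y1) c x" using linked_sym[OF sym_E] linked_trans by metis
        then show ?thesis using x by blast
      qed blast
      moreover have "Y \<union> ?B \<subseteq> X \<union> Y" by blast
      ultimately show ?thesis by - (rule exI[of _ "Y \<union> ?B"], intro conjI allI impI)
    qed
    moreover have "FU (X \<union> Y) \<subseteq> FU X \<union> C" using sub[of "X \<union> Y"] XW YW by blast
    moreover have "FU Y \<inter> C \<noteq> {}" using w0 unfolding Y_def by blast
    moreover have "Y \<subseteq> Cn" using YW WC by blast
    ultimately show ?thesis using cY by - (rule exI[of _ Y], intro conjI ballI)
  qed
qed

text \<open>The new node becomes a child of the node \<open>i\<close> to which the component of
  \<open>c\<close> is attached. Its bag lies in FU X \<union> C with FU X inside bag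
  \<open>i\<close>, so a vertex covered before occurs in it only if it also occurs in bag
  \<open>i\<close>.\<close>

lemma partial_decomposition_extend:
  assumes S: "splits_centers S" and M: "22 * (S + 1) \<le> M"
    and pd: "partial_decomposition S M N par bag" and ne: "uncovered N bag \<noteq> {}"
  shows "\<exists>i B. partial_decomposition S M (Suc N) (par(N := i)) (bag(N := B)) \<and>
    uncovered (Suc N) (bag(N := B)) \<subset> uncovered N bag"
proof -
  define R where "R = uncovered N bag"
  note pd' = pd[unfolded partial_decomposition_def, folded R_def]
  note par = pd'[THEN conjunct2, THEN conjunct1, rule_format]
    and fam = pd'[THEN conjunct2, THEN conjunct2, THEN conjunct1, rule_format]
    and edges = pd'[THEN conjunct2, THEN conjunct2, THEN conjunct2, THEN conjunct1]
    and roots = pd'[THEN conjunct2, THEN conjunct2, THEN conjunct2, THEN conjunct2, THEN conjunct1, rule_format]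
    and rest = pd'[THEN conjunct2, THEN conjunct2, THEN conjunct2, THEN conjunct2, THEN conjunct2, rule_format]
  obtain c where c: "c \<in> R" using ne unfolding R_def by blast
  define C where "C = {u. linked E R c u}"
  obtain i X where iX: "i < N" "X \<subseteq> Cn" "card X \<le> M" "FU X \<subseteq> bag i"
    "\<And>u v. linked E R c u \<Longrightarrow> (u, v) \<in> E \<Longrightarrow> v \<notin> R \<Longrightarrow> v \<in> FU X"
    using rest[OF c] by auto
  have RV: "R \<subseteq> V" and bagR: "\<And>i. i < N \<Longrightarrow> bag i \<inter> R = {}" unfolding R_def uncovered_def by auto
  have XR: "FU X \<inter> R = {}" using bagR iX by blast
  have CR: "C \<subseteq> R" using linked_in[of E R c] unfolding C_def by blast
  have Cst: "v \<in> C" if "u \<in> C" "(u, v) \<in> E" "v \<in> R" for u v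
    using linked_step[of E R c u v] that unfolding C_def by simp
  have cC: "c \<in> C" using linked_refl[OF c] unfolding C_def by simp
  have bd: "v \<in> FU X" if "u \<in> C" "(u, v) \<in> E" "v \<notin> R" for u v
    using that iX(5)[of u v] unfolding C_def by simp
  have att: "attached X R C" using iX(2) RV XR CR Cst bd unfolding attached_def by auto
  have "C \<noteq> {}" using cC by blast
  from new_bag[OF S M iX(3) att this]
  obtain Y where Y: "Y \<subseteq> Cn" "card Y \<le> S + 1" "FU (X \<union> Y) \<subseteq> FU X \<union> C" "FU Y \<inter> C \<noteq> {}"
    "\<forall>c\<in>C - FU (X \<union> Y). \<exists>X'\<subseteq>X \<union> Y. card X' \<le> M \<and>
       (\<forall>u v. linked E (R - FU (X \<union> Y)) c u \<longrightarrow> (u, v) \<in> E \<longrightarrow> v \<notin> R - FU (X \<union> Y) \<longrightarrow> v \<in> FU X')"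
    by (elim exE conjE) (rule that)
  define B where "B = FU (X \<union> Y)"
  let ?bag = "bag(N := B)" and ?par = "par(N := i)"
  have R': "uncovered (Suc N) ?bag = R - B"
    unfolding uncovered_def R_def by (auto simp: less_Suc_eq)
  have XB: "FU X \<subseteq> B" unfolding B_def by blast
  have BR: "B \<inter> R \<subseteq> C" using Y(3) XR unfolding B_def by blast
  have "B \<inter> R \<noteq> {}" using Y(4) CR unfolding B_def by blast
  then have smaller: "uncovered (Suc N) ?bag \<subset> R" unfolding R' by blast
  have "partial_decomposition S M (Suc N) ?par ?bag"
    unfolding partial_decomposition_def R'
  proof (intro conjI)
    show "\<forall>j. 0 < j \<longrightarrow> j < Suc N \<longrightarrow> ?par j < j" using par iX(1) by (auto simp: less_Suc_eq)
    have "card (X \<union> Y) \<le> M + (S + 1)" using card_Un_le[of X Y] iX(3) Y(2) by linarith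
    then show "\<forall>j<Suc N. \<exists>X\<subseteq>Cn. card X \<le> M + (S + 1) \<and> ?bag j = FU X"
      using fam iX(2) Y(1) unfolding less_Suc_eq B_def
      by (metis (no_types, lifting) Un_least fun_upd_other fun_upd_same less_irrefl)
    show "\<forall>(u, v)\<in>E. u \<notin> R - B \<longrightarrow> v \<notin> R - B \<longrightarrow> (\<exists>j<Suc N. u \<in> ?bag j \<and> v \<in> ?bag j)"
    proof clarify
      fix u v assume uv: "(u, v) \<in> E" "u \<notin> R - B" "v \<notin> R - B"
      have vu: "(v, u) \<in> E" using uv(1) sym_E unfolding sym_def by blast
      consider "u \<notin> R" "v \<notin> R" | "u \<in> R" | "v \<in> R" by blast
      then show "\<exists>j<Suc N. u \<in> ?bag j \<and> v \<in> ?bag j"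
      proof cases
        case 1
        then obtain j where "j < N" "u \<in> bag j" "v \<in> bag j" using edges uv(1) by blast
        then show ?thesis by (intro exI[of _ j]) auto
      next
        case 2
        then have "u \<in> B" "u \<in> C" using uv BR by blast+
        then have "v \<in> B" using bd[of u v] uv XB by blast
        then show ?thesis using \<open>u \<in> B\<close> by (intro exI[of _ N]) auto
      next
        case 3
        then have "v \<in> B" "v \<in> C" using uv BR by blast+
        then have "u \<in> B" using bd[of v u] vu uv XB by blast
        then show ?thesis using \<open>v \<in> B\<close> by (intro exI[of _ N]) auto
      qed
    qed
    show "\<forall>v\<in>V - (R - B). \<exists>r<Suc N. v \<in> ?bag r \<and>
        (\<forall>j<Suc N. v \<in> ?bag j \<longrightarrow> j \<noteq> r \<longrightarrow> 0 < j \<and> v \<in> ?bag (?par j))"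
    proof
      fix v assume v: "v \<in> V - (R - B)"
      show "\<exists>r<Suc N. v \<in> ?bag r \<and> (\<forall>j<Suc N. v \<in> ?bag j \<longrightarrow> j \<noteq> r \<longrightarrow> 0 < j \<and> v \<in> ?bag (?par j))"
      proof (cases "v \<in> R")
        case True
        then have "v \<in> B" using v by blast
        moreover have "v \<notin> bag j" if "j < N" for j using bagR[OF that] True by blast
        ultimately show ?thesis by (intro exI[of _ N]) (auto simp: less_Suc_eq)
      next
        case False
        then obtain r where r: "r < N" "v \<in> bag r" "\<And>j. j < N \<Longrightarrow> v \<in> bag j \<Longrightarrow> j \<noteq> r \<Longrightarrow> 0 < j \<and> v \<in> bag (par j)"
          using roots[of v] v by auto
        have old: "v \<in> ?bag (?par j)" if "j < N" "v \<in> bag j" "j \<noteq> r" for j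
        proof -
          have "0 < j" "v \<in> bag (par j)" using r(3) that by auto
          moreover have "par j < j" using par that \<open>0 < j\<close> by blast
          ultimately show ?thesis using that by auto
        qed
        have new: "v \<in> bag i" if "v \<in> B"
          using that False Y(3) CR iX(4) unfolding B_def by blast
        show ?thesis
        proof (intro exI[of _ r] conjI allI impI)
          fix j assume j: "j < Suc N" "v \<in> ?bag j" "j \<noteq> r"
          have "(0 < j) \<and> v \<in> ?bag (?par j)"
          proof (cases "j = N")
            case True
            then show ?thesis using new j iX(1) by auto
          next
            case False
            then have "j < N" "v \<in> bag j" using j by auto
            then show ?thesis using old r(3) j(3) by blast
          qed
          then show "0 < j" "v \<in> ?bag (?par j)" by blast+
        qed (use r in auto)
      qed
    qed
    show "\<forall>c'\<in>R - B. \<exists>j<Suc N. \<exists>X\<subseteq>Cn. card X \<le> M \<and> FU X \<subseteq> ?bag j \<and>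
        (\<forall>u v. linked E (R - B) c' u \<longrightarrow> (u, v) \<in> E \<longrightarrow> v \<notin> R - B \<longrightarrow> v \<in> FU X)"
    proof
      fix c' assume c': "c' \<in> R - B"
      show "\<exists>j<Suc N. \<exists>X\<subseteq>Cn. card X \<le> M \<and> FU X \<subseteq> ?bag j \<and>
        (\<forall>u v. linked E (R - B) c' u \<longrightarrow> (u, v) \<in> E \<longrightarrow> v \<notin> R - B \<longrightarrow> v \<in> FU X)"
      proof (cases "c' \<in> C")
        case True
        then obtain X' where X': "X' \<subseteq> X \<union> Y" "card X' \<le> M"
          "\<forall>u v. linked E (R - B) c' u \<longrightarrow> (u, v) \<in> E \<longrightarrow> v \<notin> R - B \<longrightarrow> v \<in> FU X'"
          using Y(5)[rule_format, of c'] c' unfolding B_def by blast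
        have "FU X' \<subseteq> B" "X' \<subseteq> Cn" using X'(1) Y(1) iX(2) unfolding B_def by blast+
        then show ?thesis using X' by (intro exI[of _ N]) auto
      next
        case False
        have "c' \<in> R" using c' by blast
        then obtain j X' where jX: "j < N" "X' \<subseteq> Cn" "card X' \<le> M" "FU X' \<subseteq> bag j"
          "\<And>u v. linked E R c' u \<Longrightarrow> (u, v) \<in> E \<Longrightarrow> v \<notin> R \<Longrightarrow> v \<in> FU X'"
          using rest by meson
        have "v \<in> FU X'" if uv: "linked E (R - B) c' u" "(u, v) \<in> E" "v \<notin> R - B" for u v
        proof -
          have l: "linked E R c' u" using uv(1) by (rule linked_mono) blast
          \<comment> \<open>The new bag takes only vertices of \<open>C\<close> out of
            \<open>R\<close>, so every other component keeps its old boundary.\<close>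
          have "v \<notin> R"
          proof
            assume "v \<in> R"
            then have "v \<in> C" using uv(3) BR by blast
            have "linked E R c' v" using linked_step[OF l uv(2) \<open>v \<in> R\<close>] .
            then have "linked E R c c'"
              using \<open>v \<in> C\<close> linked_sym[OF sym_E] linked_trans unfolding C_def by (metis mem_Collect_eq)
            then show False using False unfolding C_def by blast
          qed
          then show ?thesis using jX(5) l uv(2) by blast
        qed
        then show ?thesis using jX by (intro exI[of _ j]) auto
      qed
    qed
  qed simp
  then show ?thesis using smaller unfolding R_def by blast
qed

lemma layered_tree_decomposition:
  assumes S: "splits_centers S" and M: "22 * (S + 1) \<le> M" "card X \<le> M" and X: "X \<subseteq> Cn"
  shows "\<exists>(N :: nat) par bag. 0 < N \<and> (\<forall>i. 0 < i \<longrightarrow> i < N \<longrightarrow> par i < i) \<and> bag 0 = FU X \<and>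
    (\<forall>i<N. \<exists>X\<subseteq>Cn. card X \<le> M + (S + 1) \<and> bag i = FU X) \<and>
    (\<forall>(u, v)\<in>E. \<exists>i<N. u \<in> bag i \<and> v \<in> bag i) \<and>
    (\<forall>v\<in>V. \<exists>r<N. v \<in> bag r \<and> (\<forall>i<N. v \<in> bag i \<longrightarrow> i \<noteq> r \<longrightarrow> 0 < i \<and> v \<in> bag (par i)))"
proof -
  have ext: "\<exists>N par bag. partial_decomposition S M N par bag \<and> bag 0 = FU X \<and> uncovered N bag = {}"
    if "partial_decomposition S M N par bag" "bag 0 = FU X" for N par bag
    using that
  proof (induction "card (uncovered N bag)" arbitrary: N par bag rule: less_induct)
    case less
    show ?case
    proof (cases "uncovered N bag = {}")
      case False
      then obtain i B where iB: "partial_decomposition S M (Suc N) (par(N := i)) (bag(N := B))"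
        "uncovered (Suc N) (bag(N := B)) \<subset> uncovered N bag"
        using partial_decomposition_extend[OF S M(1) less.prems(1)] by blast
      have "finite (uncovered N bag)" unfolding uncovered_def using finite_V by simp
      then have "card (uncovered (Suc N) (bag(N := B))) < card (uncovered N bag)"
        using iB(2) by (rule psubset_card_mono)
      moreover have "0 < N" using less.prems(1) unfolding partial_decomposition_def by blast
      ultimately show ?thesis using less.hyps[OF _ iB(1)] less.prems(2) by simp
    qed (use less.prems in blast)
  qed
  \<comment> \<open>With the single bag \<open>FU X\<close>, every neighbour of the uncovered part
    outside that part lies in \<open>FU X\<close>.\<close>
  have "partial_decomposition S M 1 (\<lambda>_. 0) (\<lambda>_. FU X)"
    unfolding partial_decomposition_def uncovered_def
    using M(2) X E_subset by (auto intro!: exI[of _ X])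
  from ext[OF this] obtain N par bag where N: "partial_decomposition S M N par bag" "bag 0 = FU X" "uncovered N bag = {}"
    by auto
  note N' = N(1)[unfolded partial_decomposition_def N(3)]
  show ?thesis
    by (rule exI[of _ N], rule exI[of _ par], rule exI[of _ bag]) (use N(2) N' in auto)
qed

end

section \<open>Trees and tree decompositions\<close>

lemma walk_restrict_arcs: "walk E S xs \<Longrightarrow> walk (E \<inter> S \<times> S) S xs"
  unfolding walk_def by (auto elim!: successively_mono)

lemma walk_arcs_mono: "walk E S xs \<Longrightarrow> E \<subseteq> E' \<Longrightarrow> walk E' S xs"
  unfolding walk_def by (auto elim!: successively_mono)

lemma linked_restrict_arcs:
  assumes "S \<subseteq> U" shows "linked (E \<inter> U \<times> U) S u v \<longleftrightarrow> linked E S u v"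
proof
  assume "linked E S u v"
  then obtain xs where xs: "walk E S xs" "hd xs = u" "last xs = v" unfolding linked_def by blast
  have "walk (E \<inter> U \<times> U) S xs"
    by (rule walk_arcs_mono[OF walk_restrict_arcs[OF xs(1)]]) (use assms in blast)
  then show "linked (E \<inter> U \<times> U) S u v" using xs unfolding linked_def by blast
next
  assume "linked (E \<inter> U \<times> U) S u v"
  then show "linked E S u v" unfolding linked_def using walk_arcs_mono[of "E \<inter> U \<times> U" S _ E, OF _ Int_lower1] by metis
qed

definition linked_set :: "('a \<times> 'a) set \<Rightarrow> 'a set \<Rightarrow> bool" where
  "linked_set E S \<longleftrightarrow> (\<forall>u\<in>S. \<forall>v\<in>S. linked E S u v)"

lemma linked_component:
  assumes "linked E S u v"
  shows "linked E {w. linked E S u w} u v"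
proof -
  obtain xs where xs: "walk E S xs" "hd xs = u" "last xs = v" using assms unfolding linked_def by blast
  have "u \<in> S" using linked_in[OF assms] by blast
  have "set xs \<subseteq> {w. linked E S u w}"
    by (rule walk_invariant[OF xs(1)])
       (use linked_refl[OF \<open>u \<in> S\<close>, of E] xs(2) linked_step[of E S u] in auto)
  then show ?thesis using walk_mono[OF xs(1)] xs unfolding linked_def by blast
qed

lemma linked_set_component:
  assumes "sym E" shows "linked_set E {w. linked E S u w}"
  unfolding linked_set_def
proof (intro ballI)
  fix a b assume "a \<in> {w. linked E S u w}" "b \<in> {w. linked E S u w}"
  then have "linked E {w. linked E S u w} u a" "linked E {w. linked E S u w} u b"
    by (simp_all add: linked_component)
  then show "linked E {w. linked E S u w} a b" using linked_trans[OF linked_sym[OF assms]] by metis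
qed

text \<open>The library defines connectedness through the symmetric closure of the arcs, which adds
  nothing to a symmetric arc set.\<close>

lemma connected_induce_iff:
  assumes "sym (parcs T)"
  shows "Digraph_Component.connected (induce_subgraph (with_proj T) S) \<longleftrightarrow>
    S \<noteq> {} \<and> linked_set (parcs T) S"
proof -
  let ?A = "{e \<in> parcs T. fst e \<in> S \<and> snd e \<in> S}"
  have arcs: "(\<Union>e\<in>?A. {e, (snd e, fst e)}) = ?A"
    using assms by (auto simp: sym_def)
  have "(u, v) \<in> rtrancl_on S ?A \<longleftrightarrow> linked (parcs T) S u v" for u v
  proof
    assume "(u, v) \<in> rtrancl_on S ?A"
    then show "linked (parcs T) S u v"
      by (induction rule: rtrancl_on_induct) (auto intro: linked_refl linked_step)
  next
    assume "linked (parcs T) S u v"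
    then obtain xs where xs: "walk (parcs T) S xs" "hd xs = u" "last xs = v" unfolding linked_def by blast
    have "u \<in> S" "xs \<noteq> []" using xs unfolding walk_def by auto
    have "set xs \<subseteq> {v. (u, v) \<in> rtrancl_on S ?A}"
      by (rule walk_invariant[OF xs(1)])
         (use xs(2) \<open>u \<in> S\<close> in \<open>auto intro: rtrancl_on_into_rtrancl_on\<close>)
    then show "(u, v) \<in> rtrancl_on S ?A" using xs(3) last_in_set[OF \<open>xs \<noteq> []\<close>] by blast
  qed
  then show ?thesis
    unfolding Digraph_Component.connected_def strongly_connected_def mk_symmetric_def reachable_def linked_set_def
    by (simp add: induce_subgraph_def arcs)
qed

lemma connected_iff:
  assumes "pair_graph T"
  shows "Digraph_Component.connected (with_proj T) \<longleftrightarrow> pverts T \<noteq> {} \<and> linked_set (parcs T) (pverts T)"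
proof -
  interpret pair_graph T by fact
  have "induce_subgraph (with_proj T) (pverts T) = with_proj T"
    unfolding induce_subgraph_def with_proj_def by (auto intro: in_arcsD1 in_arcsD2)
  moreover have "sym (parcs T)" using pair_sym_arcs unfolding symmetric_def by simp
  ultimately show ?thesis using connected_induce_iff by metis
qed

lemma pair_graph_sym: "pair_graph G \<Longrightarrow> sym (parcs G)"
  using pair_sym_digraph.pair_sym_arcs[of G] unfolding symmetric_def pair_graph_def pair_pseudo_graph_def by simp

lemma pair_graph_arcs:
  assumes "pair_graph G" shows "parcs G \<subseteq> pverts G \<times> pverts G"
proof -
  interpret pair_graph G by fact
  show ?thesis using in_arcsD1 in_arcsD2 by auto
qed

lemma pair_graph_finite: "pair_graph G \<Longrightarrow> finite (pverts G)"
  using pair_fin_digraph.pair_finite_verts[of G] unfolding pair_graph_def pair_digraph_def by simp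

lemma pair_graph_irrefl: "pair_graph G \<Longrightarrow> (v, v) \<notin> parcs G"
  using pair_loopfree_digraph.pair_no_loops[of G "(v, v)"] unfolding pair_graph_def pair_digraph_def by auto

lemma pair_graphI:
  assumes "finite V" "E \<subseteq> V \<times> V" "sym E" "irrefl E"
  shows "pair_graph \<lparr>pverts = V, parcs = E\<rparr>"
proof
  show "finite (parcs \<lparr>pverts = V, parcs = E\<rparr>)" using assms finite_subset by auto
  show "symmetric (with_proj \<lparr>pverts = V, parcs = E\<rparr>)" using assms unfolding symmetric_def by simp
qed (use assms in \<open>auto simp: irrefl_def\<close>)

section \<open>Leaves, the Helly property and balanced bags\<close>

definition acyclic_on :: "('a \<times> 'a) set \<Rightarrow> 'a set \<Rightarrow> bool" where
  "acyclic_on E V \<longleftrightarrow> (\<forall>xs. walk E V xs \<longrightarrow> distinct xs \<longrightarrow> 3 \<le> length xs \<longrightarrow> (last xs, hd xs) \<notin> E)"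

lemma linked_ne_neighbour:
  assumes "linked E S x v" "v \<noteq> x"
  shows "\<exists>y\<in>S. (x, y) \<in> E \<and> y \<noteq> x"
proof (rule ccontr)
  assume no: "\<not> ?thesis"
  obtain xs where xs: "walk E S xs" "hd xs = x" "last xs = v" using assms(1) unfolding linked_def by blast
  have "set xs \<subseteq> {x}" by (rule walk_invariant[OF xs(1)]) (use xs(2) no in auto)
  moreover have "v \<in> set xs" using xs unfolding walk_def by auto
  ultimately show False using assms(2) by blast
qed

text \<open>The first vertex of a longest path is a leaf: all its neighbours lie on the path, and
  one other than the second vertex would close a cycle.\<close>

lemma exists_leaf:
  assumes fin: "finite V" and sym: "sym E" and irr: "\<And>v. (v, v) \<notin> E"
    and ac: "acyclic_on E V" and conn: "linked_set E V" and two: "2 \<le> card V"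
  shows "\<exists>x\<in>V. \<exists>y. {z\<in>V. (x, z) \<in> E} = {y}"
proof -
  define P where "P xs \<longleftrightarrow> walk E V xs \<and> distinct xs" for xs
  have "length xs \<le> card V" if "P xs" for xs
    using that fin distinct_card[of xs] card_mono[of V "set xs"] unfolding P_def walk_def by auto
  moreover obtain v0 where "v0 \<in> V" using two by fastforce
  then have "P [v0]" unfolding P_def by (simp add: walk_singleton)
  ultimately obtain xs where xs: "P xs" "\<And>ys. P ys \<Longrightarrow> length ys \<le> length xs"
    using ex_has_greatest_nat[of P "[v0]" length "Suc (card V)"] by (auto simp: less_Suc_eq_le)
  obtain x as where xas: "xs = x # as" using xs(1) unfolding P_def walk_def by (cases xs) auto
  have xV: "x \<in> V" using xs(1) unfolding P_def walk_def xas by simp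
  have nb: "z \<in> set as" if z: "z \<in> V" "(x, z) \<in> E" for z
  proof (rule ccontr)
    assume "z \<notin> set as"
    moreover have "z \<noteq> x" using irr z by blast
    moreover have "(z, x) \<in> E" using z sym unfolding sym_def by blast
    ultimately have "P (z # xs)" using xs(1) z unfolding P_def walk_def xas by auto
    then show False using xs(2) by fastforce
  qed
  have "\<exists>v\<in>V. v \<noteq> x"
  proof (rule ccontr)
    assume "\<not> ?thesis"
    then have "V \<subseteq> {x}" by blast
    then show False using two card_mono[of "{x}" V] by simp
  qed
  then obtain z0 where "z0 \<in> V" "(x, z0) \<in> E"
    using linked_ne_neighbour[of E V x] conn xV unfolding linked_set_def by blast
  then obtain y bs where as: "as = y # bs" using nb by (cases as) auto
  have xy: "(x, y) \<in> E" "y \<in> V" using xs(1) unfolding P_def walk_def xas as by auto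
  have "z = y" if z: "z \<in> V" "(x, z) \<in> E" for z
  proof (rule ccontr)
    assume "z \<noteq> y"
    then have "z \<in> set bs" using nb[OF z] as by auto
    then obtain cs ds where bs: "bs = cs @ z # ds" using split_list by metis
    let ?c = "x # y # cs @ [z]"
    have eq: "xs = ?c @ ds" unfolding xas as bs by simp
    have "successively (\<lambda>u v. (u, v) \<in> E) ?c"
      using xs(1) unfolding P_def walk_def eq successively_append_iff by blast
    then have "walk E V ?c" using xs(1) unfolding P_def walk_def eq by simp
    moreover have "distinct ?c" using xs(1) unfolding P_def eq distinct_append by blast
    moreover have "(last ?c, hd ?c) \<in> E" using z sym unfolding sym_def by simp
    ultimately show False using ac unfolding acyclic_on_def by force
  qed
  then have "{z\<in>V. (x, z) \<in> E} = {y}" using xy by blast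
  then show ?thesis using xV by blast
qed

lemma linked_set_remove_leaf:
  assumes S: "S \<subseteq> V" and leaf: "{z\<in>V. (x, z) \<in> E} = {y}" and sym: "sym E" and conn: "linked_set E S"
  shows "linked_set E (S - {x})" and "x \<in> S \<Longrightarrow> S \<noteq> {x} \<Longrightarrow> y \<in> S"
proof -
  show "linked_set E (S - {x})" unfolding linked_set_def
  proof (intro ballI)
    fix u v assume uv: "u \<in> S - {x}" "v \<in> S - {x}"
    then obtain xs where xs: "walk E S xs" "hd xs = u" "last xs = v"
      using conn unfolding linked_set_def linked_def by blast
    \<comment> \<open>A walk can pass through the leaf \<open>x\<close> only from \<open>y\<close>
      back to \<open>y\<close>, so reaching \<open>x\<close> is recorded as reaching
      \<open>y\<close>.\<close>
    let ?Q = "{w. if w = x then linked E (S - {x}) u y else linked E (S - {x}) u w}"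
    have "set xs \<subseteq> ?Q"
    proof (rule walk_invariant[OF xs(1)])
      show "hd xs \<in> ?Q" using uv xs(2) linked_refl[of u "S - {x}"] by auto
      fix a b assume a: "a \<in> ?Q" "a \<in> S" "(a, b) \<in> E" "b \<in> S"
      have ba: "(b, a) \<in> E" using a sym unfolding sym_def by blast
      show "b \<in> ?Q"
      proof (cases "b = x")
        case True
        then have "a = y" using leaf ba a S by blast
        then show ?thesis using a True by (auto split: if_splits)
      next
        case False
        show ?thesis
        proof (cases "a = x")
          case True
          then have "b = y" using leaf a S by blast
          then show ?thesis using a True False by auto
        next
          case False
          then have "linked E (S - {x}) u a" using a by simp
          then have "linked E (S - {x}) u b" using linked_step a \<open>b \<noteq> x\<close> by fastforce
          then show ?thesis using \<open>b \<noteq> x\<close> by simp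
        qed
      qed
    qed
    moreover have "v \<in> set xs" using xs unfolding walk_def by auto
    ultimately have "v \<in> ?Q" by blast
    then show "linked E (S - {x}) u v" using uv(2) by simp
  qed
  show "y \<in> S" if xS: "x \<in> S" "S \<noteq> {x}"
  proof -
    obtain v where "v \<in> S" "v \<noteq> x" using xS by blast
    then obtain z where "z \<in> S" "(x, z) \<in> E"
      using linked_ne_neighbour[of E S x v] conn xS unfolding linked_set_def by blast
    then have "z \<in> {z\<in>V. (x, z) \<in> E}" using S by blast
    then have "z = y" unfolding leaf by simp
    then show ?thesis using \<open>z \<in> S\<close> by simp
  qed
qed

text \<open>Induction by deleting a leaf \<open>x\<close> with neighbour \<open>y\<close>. If {x} is
  a member, \<open>x\<close> is the common node. Otherwise every member that contains
  \<open>x\<close> also contains \<open>y\<close>, so pairwise intersections survive the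
  deletion.\<close>

lemma Helly_subtrees:
  assumes "finite V" "V \<noteq> {}" "sym E" "\<And>v. (v, v) \<notin> E" "acyclic_on E V" "linked_set E V"
    and "\<And>S. S \<in> \<S> \<Longrightarrow> S \<subseteq> V \<and> linked_set E S"
    and "\<And>S S'. S \<in> \<S> \<Longrightarrow> S' \<in> \<S> \<Longrightarrow> S \<inter> S' \<noteq> {}"
  shows "\<exists>x\<in>V. \<forall>S\<in>\<S>. x \<in> S"
  using assms
proof (induction "card V" arbitrary: V \<S> rule: less_induct)
  case less
  note sub = less.prems(7) and meet = less.prems(8)
  show ?case
  proof (cases "2 \<le> card V")
    case False
    then have "card V = 1" using less.prems(1,2) card_gt_0_iff[of V] by linarith
    then obtain x where x: "V = {x}" using card_1_singletonE by blast
    have "x \<in> S" if "S \<in> \<S>" for S using sub[OF that] meet[OF that that] x by blast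
    then show ?thesis using x by blast
  next
    case True
    then obtain x y where x: "x \<in> V" "{z\<in>V. (x, z) \<in> E} = {y}"
      using exists_leaf[OF less.prems(1,3,4,5,6)] by blast
    show ?thesis
    proof (cases "{x} \<in> \<S>")
      case True
      then show ?thesis using meet[OF True] x by blast
    next
      case False
      have yx: "y \<noteq> x" using x less.prems(4) by blast
      have "\<exists>z\<in>V - {x}. \<forall>S'\<in>(\<lambda>S. S - {x}) ` \<S>. z \<in> S'"
      proof (rule less.hyps)
        show "card (V - {x}) < card V" using x less.prems(1) by (meson card_Diff1_less)
        show "finite (V - {x})" using less.prems(1) by simp
        show "V - {x} \<noteq> {}" using x yx by blast
        show "sym E" "\<And>v. (v, v) \<notin> E" using less.prems by blast+
        show "acyclic_on E (V - {x})"
          using less.prems(5) unfolding acyclic_on_def walk_def by blast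
        show "linked_set E (V - {x})" using linked_set_remove_leaf(1)[OF order_refl x(2)] less.prems by blast
        show "S \<subseteq> V - {x} \<and> linked_set E S" if "S \<in> (\<lambda>S. S - {x}) ` \<S>" for S
          using that linked_set_remove_leaf(1)[OF _ x(2) less.prems(3)] sub by blast
        show "S \<inter> S' \<noteq> {}" if S: "S \<in> (\<lambda>S. S - {x}) ` \<S>" "S' \<in> (\<lambda>S. S - {x}) ` \<S>" for S S'
        proof -
          obtain A B where AB: "A \<in> \<S>" "B \<in> \<S>" "S = A - {x}" "S' = B - {x}" using S by blast
          show ?thesis
          proof (cases "x \<in> A \<and> x \<in> B")
            case True
            then have "y \<in> A" "y \<in> B"
              using linked_set_remove_leaf(2)[OF _ x(2) less.prems(3)] sub AB False by metis+
            then show ?thesis using yx AB by blast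
          next
            case False
            then show ?thesis using meet[OF AB(1,2)] AB by blast
          qed
        qed
      qed
      then obtain z where z: "z \<in> V" "\<forall>S'\<in>(\<lambda>S. S - {x}) ` \<S>. z \<in> S'" by auto
      then have "z \<in> S" if "S \<in> \<S>" for S using that by auto
      then show ?thesis using z(1) by auto
    qed
  qed
qed

lemma pcas_zip:
  assumes "walk E V (x # xs)" "(last (x # xs), z) \<in> E"
  shows "pcas x (zip (x # xs) (xs @ [z])) z" "pawalk_verts x (zip (x # xs) (xs @ [z])) = x # xs @ [z]"
    "set (zip (x # xs) (xs @ [z])) \<subseteq> E"
  using assms by (induction xs arbitrary: x) (auto simp: walk_def)

lemma acyclic_on_undirected_tree:
  assumes "undirected_tree T"
  shows "acyclic_on (parcs T) (pverts T)"
  unfolding acyclic_on_def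
proof (intro allI impI notI)
  fix xs assume xs: "walk (parcs T) (pverts T) xs" "distinct xs" "3 \<le> length xs" "(last xs, hd xs) \<in> parcs T"
  then obtain y ys where ys: "xs = y # ys" by (cases xs) auto
  let ?p = "zip (y # ys) (ys @ [y])"
  note z = pcas_zip[OF xs(1)[unfolded ys], of y] xs(4)
  have "pre_digraph.awalk (with_proj T) y ?p y"
    using z xs unfolding pre_digraph.awalk_def by (simp add: ys walk_def cas_with_proj_eq)
  moreover have "distinct (tl (pre_digraph.awalk_verts (with_proj T) y ?p))"
    using z xs(2) by (simp add: ys awalk_verts_with_proj_eq)
  moreover have "?p \<noteq> []" "3 \<le> length ?p" using xs(3) by (auto simp: ys)
  ultimately show False using assms unfolding undirected_tree_def pre_digraph.cycle_def by blast
qed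

text \<open>Two connected sets that each contain more than half of \<open>X\<close> intersect, so
  the subtrees of nodes whose bags meet them intersect as well. By the Helly property one bag meets
  all such sets, and then no component of its complement can be one of them.\<close>

lemma tree_decomposition_balanced_bag:
  assumes H: "pair_graph H" and td: "tree_decomposition H T bag" and X: "X \<subseteq> pverts H"
  shows "\<exists>x\<in>pverts T. \<forall>u\<in>pverts H - bag x.
    2 * card {v\<in>X. linked (parcs H) (pverts H - bag x) u v} \<le> card X"
proof -
  let ?E = "parcs H" and ?V = "pverts H" and ?ET = "parcs T"
  have tree: "undirected_tree T" and
    edge: "\<And>u v. (u, v) \<in> ?E \<Longrightarrow> \<exists>x\<in>pverts T. u \<in> bag x \<and> v \<in> bag x"
    using td unfolding tree_decomposition_def by auto
  have T: "pair_graph T" using tree unfolding undirected_tree_def by simp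
  have symT: "sym ?ET" using pair_graph_sym[OF T] .
  have symH: "sym ?E" using pair_graph_sym[OF H] .
  have finX: "finite X" using X pair_graph_finite[OF H] finite_subset by blast
  have sub: "{x\<in>pverts T. v \<in> bag x} \<noteq> {}" "linked_set ?ET {x\<in>pverts T. v \<in> bag x}" if "v \<in> ?V" for v
    using td that connected_induce_iff[OF symT] unfolding tree_decomposition_def by blast+
  define nodes where "nodes B = {x\<in>pverts T. bag x \<inter> B \<noteq> {}}" for B
  define \<B> where "\<B> = {B. B \<subseteq> ?V \<and> linked_set ?E B \<and> card X < 2 * card (B \<inter> X)}"
  have "\<exists>x\<in>pverts T. \<forall>S\<in>nodes ` \<B>. x \<in> S"
  proof (rule Helly_subtrees[OF pair_graph_finite[OF T] _ symT pair_graph_irrefl[OF T] acyclic_on_undirected_tree[OF tree]])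
    show "pverts T \<noteq> {}" "linked_set ?ET (pverts T)"
      using tree connected_iff[OF T] unfolding undirected_tree_def by blast+
    show "S \<subseteq> pverts T \<and> linked_set ?ET S" if S: "S \<in> nodes ` \<B>" for S
    proof
      obtain B where B: "S = nodes B" "B \<subseteq> ?V" "linked_set ?E B" using S unfolding \<B>_def by blast
      show "S \<subseteq> pverts T" unfolding B nodes_def by blast
      show "linked_set ?ET S" unfolding linked_set_def
      proof (intro ballI)
        fix x x' assume x: "x \<in> S" "x' \<in> S"
        obtain b b' where b: "b \<in> bag x \<inter> B" "b' \<in> bag x' \<inter> B" using x unfolding B nodes_def by blast
        then obtain xs where xs: "walk ?E B xs" "hd xs = b" "last xs = b'"
          using B(3) unfolding linked_set_def linked_def by blast
        have star: "linked ?ET S y y'" if "v \<in> B" "y \<in> pverts T" "v \<in> bag y" "y' \<in> pverts T" "v \<in> bag y'" for v y y'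
        proof -
          have "linked ?ET {x\<in>pverts T. v \<in> bag x} y y'"
            using sub(2)[of v] that B(2) unfolding linked_set_def by blast
          moreover have "{x\<in>pverts T. v \<in> bag x} \<subseteq> S" using that unfolding B nodes_def by blast
          ultimately show ?thesis by (rule linked_mono)
        qed
        \<comment> \<open>Along a walk in \<open>B\<close> the ends of each edge share a bag, so
          their subtrees share a node.\<close>
        let ?Q = "{v\<in>B. \<forall>y\<in>pverts T. v \<in> bag y \<longrightarrow> linked ?ET S x y}"
        have xT: "x \<in> pverts T" "x' \<in> pverts T" using x unfolding B nodes_def by blast+
        have "set xs \<subseteq> ?Q"
        proof (rule walk_invariant[OF xs(1)])
          show "hd xs \<in> ?Q" using star[of b x] b xs(2) xT by blast
          fix u v assume u: "u \<in> ?Q" "u \<in> B" "(u, v) \<in> ?E" "v \<in> B"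
          then obtain y where y: "y \<in> pverts T" "u \<in> bag y" "v \<in> bag y" using edge by blast
          then have "linked ?ET S x y" using u by blast
          then have "linked ?ET S x y'" if "y' \<in> pverts T" "v \<in> bag y'" for y'
            using linked_trans star[OF u(4) y(1,3) that] by metis
          then show "v \<in> ?Q" using u by blast
        qed
        moreover have "b' \<in> set xs" using xs unfolding walk_def by auto
        ultimately have "b' \<in> ?Q" by blast
        then show "linked ?ET S x x'" using b xT by blast
      qed
    qed
    show "S \<inter> S' \<noteq> {}" if S: "S \<in> nodes ` \<B>" "S' \<in> nodes ` \<B>" for S S'
    proof -
      obtain B B' where B: "S = nodes B" "S' = nodes B'" "B \<in> \<B>" "B' \<in> \<B>" using S by blast
      have "(B \<inter> X) \<inter> (B' \<inter> X) \<noteq> {}"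
      proof
        assume "(B \<inter> X) \<inter> (B' \<inter> X) = {}"
        then have "card (B \<inter> X) + card (B' \<inter> X) = card ((B \<inter> X) \<union> (B' \<inter> X))"
          using finX by (intro card_Un_disjoint[symmetric]) auto
        also have "\<dots> \<le> card X" using finX by (intro card_mono) auto
        finally show False using B(3,4) unfolding \<B>_def by auto
      qed
      then obtain v where v: "v \<in> B" "v \<in> B'" "v \<in> ?V" using X by blast
      then obtain x where "x \<in> pverts T" "v \<in> bag x" using sub(1)[of v] by blast
      then show ?thesis unfolding B nodes_def using v by blast
    qed
  qed
  then obtain x where x0: "x \<in> pverts T" "\<forall>S\<in>nodes ` \<B>. x \<in> S" by auto
  have x: "bag x \<inter> B \<noteq> {}" if "B \<in> \<B>" for B
    using x0(2) that unfolding nodes_def by auto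
  have "2 * card {v\<in>X. linked ?E (?V - bag x) u v} \<le> card X" for u
  proof -
    let ?B = "{v. linked ?E (?V - bag x) u v}"
    have "?B \<subseteq> ?V - bag x" using linked_in[of ?E "?V - bag x" u] by blast
    then have "?B \<notin> \<B>" using x[of ?B] by blast
    moreover have "?B \<subseteq> ?V" using \<open>?B \<subseteq> ?V - bag x\<close> by blast
    ultimately have "\<not> card X < 2 * card (?B \<inter> X)"
      using linked_set_component[OF symH] unfolding \<B>_def by blast
    moreover have "{v\<in>X. linked ?E (?V - bag x) u v} = ?B \<inter> X" by blast
    ultimately show ?thesis by simp
  qed
  then show ?thesis using x0(1) by blast
qed

section \<open>Trees given by parent functions\<close>

definition parent_tree :: "nat \<Rightarrow> (nat \<Rightarrow> nat) \<Rightarrow> nat pair_pre_digraph" where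
  "parent_tree N par = \<lparr>pverts = {..<N},
     parcs = {(i, par i) | i. 0 < i \<and> i < N} \<union> {(par i, i) | i. 0 < i \<and> i < N}\<rparr>"

lemma pcas_nth:
  "pcas u p v \<Longrightarrow> p \<noteq> [] \<Longrightarrow> fst (p ! 0) = u \<and> snd (last p) = v \<and>
    (\<forall>i. Suc i < length p \<longrightarrow> fst (p ! Suc i) = snd (p ! i)) \<and> pawalk_verts u p = u # map snd p"
proof (induction p arbitrary: u)
  case (Cons e p)
  show ?case
  proof (cases "p = []")
    case False
    have IH: "fst (p ! 0) = snd e \<and> snd (last p) = v \<and>
      (\<forall>i. Suc i < length p \<longrightarrow> fst (p ! Suc i) = snd (p ! i)) \<and> pawalk_verts (snd e) p = snd e # map snd p"
      using Cons False by auto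
    have "fst ((e # p) ! Suc i) = snd ((e # p) ! i)" if "Suc i < length (e # p)" for i
      using IH that by (cases i) auto
    then show ?thesis using IH Cons.prems False by auto
  qed (use Cons.prems in auto)
qed simp

text \<open>For acyclicity, consider the largest node of a cycle: both its neighbours on the cycle
  must be its parent, but they are distinct since the cycle has length at least 3.\<close>

lemma undirected_tree_parent_tree:
  assumes N: "0 < N" and par: "\<And>i. 0 < i \<Longrightarrow> i < N \<Longrightarrow> par i < i"
  shows "undirected_tree (parent_tree N par)"
proof -
  let ?T = "parent_tree N par"
  have mem: "(a, b) \<in> parcs ?T \<longleftrightarrow> (0 < a \<and> a < N \<and> b = par a) \<or> (0 < b \<and> b < N \<and> a = par b)" for a b
    unfolding parent_tree_def by auto
  have arc: "a = par b" if "(a, b) \<in> parcs ?T" "a \<le> b" for a b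
    using that par[of a] unfolding mem by linarith
  have sym: "sym (parcs ?T)" unfolding sym_def mem by blast
  have irr: "irrefl (parcs ?T)" unfolding irrefl_def mem by (metis par less_irrefl)
  have "parcs ?T \<subseteq> {..<N} \<times> {..<N}"
  proof
    fix e assume "e \<in> parcs ?T"
    then show "e \<in> {..<N} \<times> {..<N}"
      using mem[of "fst e" "snd e"] par[of "fst e"] par[of "snd e"] by (cases e) auto
  qed
  then have T: "pair_graph ?T"
    using pair_graphI[of "{..<N}" "parcs ?T"] sym irr by (simp add: parent_tree_def)
  have "linked (parcs ?T) {..<N} i 0" if "i < N" for i
    using that
  proof (induction i rule: less_induct)
    case (less i)
    show ?case
    proof (cases "i = 0")
      case True
      then show ?thesis using N by (auto intro: linked_refl)
    next
      case False
      then have "par i < i" using par less by simp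
      have "(i, par i) \<in> parcs ?T" using False less unfolding mem by auto
      then have "linked (parcs ?T) {..<N} i (par i)"
        using less.prems \<open>par i < i\<close> by (intro linked_edge) auto
      then show ?thesis using less.IH[OF \<open>par i < i\<close>] less.prems \<open>par i < i\<close> linked_trans
        by (metis less_trans)
    qed
  qed
  then have "linked (parcs ?T) {..<N} i j" if "i < N" "j < N" for i j
    using linked_sym[OF sym] linked_trans that by metis
  then have "linked_set (parcs ?T) (pverts ?T)"
    unfolding linked_set_def by (simp add: parent_tree_def)
  moreover have "pverts ?T \<noteq> {}" using N unfolding parent_tree_def by auto
  ultimately have conn: "Digraph_Component.connected (with_proj ?T)" using connected_iff[OF T] by blast
  have "False" if cyc: "pre_digraph.cycle (with_proj ?T) p" "3 \<le> length p" for p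
  proof -
    obtain u where u: "set p \<subseteq> parcs ?T" "pcas u p u" "distinct (tl (pawalk_verts u p))" "p \<noteq> []"
      using cyc(1) unfolding pre_digraph.cycle_def pre_digraph.awalk_def
      by (auto simp: cas_with_proj_eq awalk_verts_with_proj_eq)
    define ws where "ws = map snd p"
    let ?n = "length p"
    note pn = pcas_nth[OF u(2,4)]
    have dist: "distinct ws" using u(3) pn unfolding ws_def by simp
    have adj: "(ws ! i, ws ! (Suc i mod ?n)) \<in> parcs ?T" if i: "i < ?n" for i
    proof -
      have "fst (p ! (Suc i mod ?n)) = snd (p ! i)"
      proof (cases "Suc i < ?n")
        case True
        then show ?thesis using pn by simp
      next
        case False
        then have "Suc i = ?n" using i by simp
        then have "p ! i = last p" using u(4) by (simp add: last_conv_nth flip: \<open>Suc i = ?n\<close>)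
        then show ?thesis using pn \<open>Suc i = ?n\<close> by simp
      qed
      moreover have "Suc i mod ?n < ?n" using u(4) by simp
      ultimately have "p ! (Suc i mod ?n) = (ws ! i, ws ! (Suc i mod ?n))"
        unfolding ws_def using i by (simp add: prod_eq_iff)
      then show ?thesis using u(1) \<open>Suc i mod ?n < ?n\<close> nth_mem by (metis subsetD)
    qed
    have wsne: "ws \<noteq> []" and lw: "length ws = ?n" using u(4) unfolding ws_def by auto
    obtain i where i: "i < ?n" "ws ! i = Max (set ws)"
      using Max_in[of "set ws"] wsne lw by (metis List.finite_set in_set_conv_nth set_empty)
    \<comment> \<open>Positions are cyclic: \<open>j\<close> follows and \<open>l\<close> precedes
      the maximum. Adding the length before subtracting 1 avoids truncation at position 0.\<close>
    define j where "j = Suc i mod ?n"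
    define l where "l = (i + ?n - 1) mod ?n"
    have jl: "j < ?n" "l < ?n" using u(4) unfolding j_def l_def by auto
    have lS: "Suc l mod ?n = i"
    proof (cases i)
      case 0
      then have "l = ?n - 1" unfolding l_def using u(4) by simp
      then show ?thesis using 0 u(4) by simp
    next
      case (Suc i')
      then have "l = i'" unfolding l_def using i by simp
      then show ?thesis using Suc i by simp
    qed
    have "j \<noteq> l"
    proof
      assume "j = l"
      then have j: "Suc j mod ?n = i" using lS by simp
      show False
      proof (cases "Suc i < ?n")
        case True
        then have "j = Suc i" unfolding j_def by simp
        then show False using j True cyc(2) by (cases "Suc (Suc i) = ?n") auto
      next
        case False
        then have "Suc i = ?n" using i(1) by simp
        then have "j = 0" unfolding j_def by simp
        then show False using j \<open>Suc i = ?n\<close> cyc(2) by auto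
      qed
    qed
    then have ne: "ws ! j \<noteq> ws ! l" using dist jl lw nth_eq_iff_index_eq by metis
    have max: "ws ! m \<le> ws ! i" if "m < ?n" for m using i(2) that lw by simp
    have "(ws ! i, ws ! j) \<in> parcs ?T" using adj[OF i(1)] unfolding j_def .
    then have "(ws ! j, ws ! i) \<in> parcs ?T" using sym unfolding sym_def by blast
    then have "ws ! j = par (ws ! i)" using arc max[OF jl(1)] by blast
    moreover have "(ws ! l, ws ! i) \<in> parcs ?T" using adj[OF jl(2)] lS by simp
    then have "ws ! l = par (ws ! i)" using arc max[OF jl(2)] by blast
    ultimately show False using ne by simp
  qed
  then show ?thesis unfolding undirected_tree_def using T conn by blast
qed

lemma tree_decomposition_parent_tree:
  assumes N: "0 < N" and par: "\<And>i. 0 < i \<Longrightarrow> i < N \<Longrightarrow> par i < i"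
    and bag: "\<And>i. i < N \<Longrightarrow> bag i \<subseteq> pverts G"
    and edges: "\<And>u v. (u, v) \<in> parcs G \<Longrightarrow> \<exists>i<N. u \<in> bag i \<and> v \<in> bag i"
    and top: "\<And>v. v \<in> pverts G \<Longrightarrow> \<exists>r<N. v \<in> bag r \<and> (\<forall>i<N. v \<in> bag i \<longrightarrow> i \<noteq> r \<longrightarrow> 0 < i \<and> v \<in> bag (par i))"
  shows "tree_decomposition G (parent_tree N par) bag"
proof -
  let ?T = "parent_tree N par"
  have V: "pverts ?T = {..<N}" unfolding parent_tree_def by simp
  have sym: "sym (parcs ?T)" unfolding parent_tree_def sym_def by auto
  have "Digraph_Component.connected (induce_subgraph (with_proj ?T) {x \<in> pverts ?T. v \<in> bag x})"
    if v: "v \<in> pverts G" for v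
  proof -
    let ?S = "{x \<in> pverts ?T. v \<in> bag x}"
    obtain r where r: "r < N" "v \<in> bag r" "\<And>i. i < N \<Longrightarrow> v \<in> bag i \<Longrightarrow> i \<noteq> r \<Longrightarrow> 0 < i \<and> v \<in> bag (par i)"
      using top[OF v] by blast
    have "linked (parcs ?T) ?S i r" if "i \<in> ?S" for i
      using that
    proof (induction i rule: less_induct)
      case (less i)
      have i: "i < N" "v \<in> bag i" using less.prems unfolding V by auto
      show ?case
      proof (cases "i = r")
        case True
        then show ?thesis using less.prems linked_refl by metis
      next
        case False
        then have *: "0 < i" "v \<in> bag (par i)" using r(3) i by auto
        then have "par i < i" using par i by simp
        then have "par i \<in> ?S" using * i unfolding V by simp
        moreover have "(i, par i) \<in> parcs ?T" using * i unfolding parent_tree_def by auto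
        ultimately show ?thesis
          using linked_trans[OF linked_edge less.IH] less.prems \<open>par i < i\<close> by blast
      qed
    qed
    then have "linked_set (parcs ?T) ?S" unfolding linked_set_def
      using linked_trans[OF _ linked_sym[OF sym]] by blast
    moreover have "?S \<noteq> {}" using r(1,2) unfolding V by blast
    ultimately show ?thesis using connected_induce_iff[OF sym] by blast
  qed
  moreover have "undirected_tree ?T" using undirected_tree_parent_tree[OF N par] .
  moreover have "\<forall>x\<in>pverts ?T. bag x \<subseteq> pverts G" using bag unfolding V by blast
  moreover have "\<forall>(u, v)\<in>parcs G. \<exists>x\<in>pverts ?T. u \<in> bag x \<and> v \<in> bag x" using edges unfolding V by blast
  ultimately show ?thesis unfolding tree_decomposition_def by blast
qed

lemma treewidth_decomposition:
  fixes H :: "'a pair_pre_digraph"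
  assumes H: "pair_graph H"
  obtains T :: "nat pair_pre_digraph" and bag where "tree_decomposition H T bag"
    "\<And>x. x \<in> pverts T \<Longrightarrow> card (bag x) \<le> treewidth H + 1"
proof -
  \<comment> \<open>The decomposition with a single bag shows that the \<open>LEAST\<close> in
    \<open>treewidth\<close> is attained.\<close>
  have "tree_decomposition H (parent_tree 1 (\<lambda>_. 0)) (\<lambda>_. pverts H)"
    using pair_graph_arcs[OF H] by (intro tree_decomposition_parent_tree) auto
  then have "\<exists>w. \<exists>(T :: nat pair_pre_digraph) bag. tree_decomposition H T bag \<and> decomposition_width T bag = w"
    by blast
  from LeastI_ex[OF this] obtain T :: "nat pair_pre_digraph" and bag where
    T: "tree_decomposition H T bag" "decomposition_width T bag = treewidth H"
    unfolding treewidth_def by blast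
  have "finite (pverts T)" using T(1) pair_graph_finite unfolding tree_decomposition_def undirected_tree_def by blast
  then have "card (bag x) \<le> Max ((\<lambda>x. card (bag x)) ` pverts T)" if "x \<in> pverts T" for x
    using that by (intro Max_ge) auto
  then have "card (bag x) \<le> treewidth H + 1" if "x \<in> pverts T" for x
    using that T(2) unfolding decomposition_width_def by fastforce
  then show ?thesis using that T(1) by blast
qed

section \<open>Choice of parameters\<close>

text \<open>\<open>S\<close> is one less than the rounded 5000K because each bag receives one more
  center. The quantity ln (22S) is bounded in two ways: by 5/2 log 4f for the number of crossing
  walks, and by \<open>L\<close> for the degrees, so that \<Delta> does not refer to
  \<open>f\<close>. The second way requires 22S \<le> n.\<close>

lemma game_parameters:
  fixes n c d k :: nat and L f K :: real
  assumes pos: "0 < n" "0 < c" "0 < d" "0 < k"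
  defines "L \<equiv> log 2 (2 * real n)"
  defines "\<Delta> \<equiv> 1000000 * real d * (real k)\<^sup>2 * L ^ 3"
  defines "f \<equiv> \<Delta> ^ c"
  defines "K \<equiv> real k * L\<^sup>2 * (f * log 2 (4 * f))"
  defines "S \<equiv> nat \<lfloor>5000 * K\<rfloor> - 1"
  defines "lam \<equiv> 11 * ln (22 * real S) * (166 * L\<^sup>2)"
  shows "6 \<le> S" "real (S + 1) \<le> 5000 * K" "3 * (f + 1) \<le> real S" "(f + 1) * lam \<le> 3/2 * real S"
    "22 * S \<le> n \<Longrightarrow> real (4 * d) + 1 + 2 * real k * lam \<le> \<Delta>"
proof -
  have L1: "1 \<le> L" unfolding L_def using pos by (simp add: le_log_iff)
  have k1: "1 \<le> real k" and d1: "1 \<le> real d" using pos by auto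
  have L2: "1 \<le> L\<^sup>2" and L3: "1 \<le> L ^ 3" and L23: "L\<^sup>2 \<le> L ^ 3"
    using L1 by (auto intro: one_le_power power_increasing)
  have k2: "real k \<le> (real k)\<^sup>2" "1 \<le> (real k)\<^sup>2" using k1 by (auto simp: self_le_power)
  define a where "a = (real k)\<^sup>2 * L ^ 3"
  have a1: "1 \<le> a" unfolding a_def using mult_mono[OF k2(2) L3] by simp
  have ka: "real k * L\<^sup>2 \<le> a" "real k * L ^ 3 \<le> a"
    unfolding a_def using k2 L23 L1 k1 by (auto intro!: mult_mono)
  have \<Delta>: "\<Delta> = 1000000 * real d * a" unfolding \<Delta>_def a_def by simp
  have da: "a \<le> real d * a" "real d \<le> real d * a" using d1 a1 by (simp_all add: mult_le_cancel_right1 mult_le_cancel_left1)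
  then have D1: "1000000 * a \<le> \<Delta>" "1 \<le> \<Delta>" unfolding \<Delta> using a1 by linarith+
  have f\<Delta>: "\<Delta> \<le> f" unfolding f_def using D1 pos by (intro self_le_power) auto
  have fa: "1000000 * a \<le> f" using f\<Delta> D1 by linarith
  have f1: "1000000 \<le> f" using fa a1 by linarith
  define lg where "lg = log 2 (4 * f)"
  have lg1: "1 \<le> lg" unfolding lg_def using f1 by (simp add: le_log_iff)
  have lnlg: "ln (4 * f) = ln 2 * lg" unfolding lg_def by (simp add: log_def)
  have lg8: "lg \<le> 8 * f"
  proof -
    have "7/12 * lg \<le> ln 2 * lg" using ln_2_bounds(1) lg1 by (intro mult_right_mono) auto
    also have "\<dots> \<le> 4 * f - 1" using ln_le_minus_one[of "4 * f"] f1 lnlg by simp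
    finally show ?thesis using f1 by linarith
  qed
  define u where "u = real k * L\<^sup>2"
  have u1: "1 \<le> u" unfolding u_def using mult_mono[OF k1 L2] by simp
  have K: "K = u * (f * lg)" unfolding K_def u_def lg_def by simp
  have flg: "f \<le> f * lg" using lg1 f1 by (simp add: mult_le_cancel_left1)
  have "f * lg \<le> u * (f * lg)" using mult_right_mono[OF u1, of "f * lg"] f1 lg1 by simp
  then have Kf: "f * lg \<le> K" "f \<le> K" "1000000 \<le> K" unfolding K using flg f1 by linarith+
  have S1: "real (S + 1) = real_of_int \<lfloor>5000 * K\<rfloor>" unfolding S_def using Kf(3) by (simp add: of_nat_nat)
  show S2: "real (S + 1) \<le> 5000 * K" unfolding S1 by linarith
  have S3: "5000 * K - 2 \<le> real S" using S1 by linarith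
  show "6 \<le> S" using S3 Kf(3) by linarith
  have "3 * f + 3 \<le> 5000 * K - 2" using Kf(2) f1 by argo
  then show "3 * (f + 1) \<le> real S" using S3 by argo
  have Spos: "0 < 22 * real S" using S3 Kf(3) by linarith
  \<comment> \<open>A crude polynomial bound in \<open>f\<close> is enough, since only its logarithm
    counts: k L^2 \<le> f / 1000000 and log 4f \<le> 8f.\<close>
  have "110000 * K \<le> (4 * f) ^ 3"
  proof -
    have "110000 * K \<le> 110000 * (f / 1000000 * (f * (8 * f)))"
      unfolding K using ka(1) fa f1 lg8 lg1 u1 unfolding u_def[symmetric]
      by (intro mult_left_mono mult_mono) auto
    also have "\<dots> \<le> 64 * (f * f * f)" using f1 by simp
    also have "\<dots> = (4 * f) ^ 3" by (simp add: power3_eq_cube)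
    finally show ?thesis .
  qed
  then have "22 * real S \<le> (4 * f) ^ 3" using S2 by simp
  then have "ln (22 * real S) \<le> ln ((4 * f) ^ 3)" using Spos f1 by (subst ln_le_cancel_iff) auto
  also have "\<dots> = 3 * (ln 2 * lg)" unfolding lnlg[symmetric] using ln_realpow[of "4 * f" 3] f1 by simp
  also have "\<dots> \<le> 3 * (5/6 * lg)" using ln_2_bounds(2) lg1 by (intro mult_left_mono mult_right_mono) auto
  finally have lnS: "ln (22 * real S) \<le> 5/2 * lg" by simp
  \<comment> \<open>The factor 1001/1000 absorbs the \<open>+ 1\<close>. The resulting constant
    4569.565 stays below 3/2 * 5000.\<close>
  have "(f + 1) * lam \<le> (1001/1000 * f) * (11 * (5/2 * lg) * (166 * L\<^sup>2))"
  proof (rule mult_mono)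
    show "lam \<le> 11 * (5/2 * lg) * (166 * L\<^sup>2)"
      unfolding lam_def using lnS by (intro mult_right_mono mult_left_mono) auto
    show "0 \<le> lam" unfolding lam_def using Spos S3 Kf(3) by (intro mult_nonneg_nonneg) auto
  qed (use f1 in auto)
  also have "\<dots> = 4569565/1000 * (L\<^sup>2 * (f * lg))" by simp
  also have "\<dots> \<le> 4569565/1000 * K"
  proof -
    have "L\<^sup>2 \<le> u" unfolding u_def using k1 by (simp add: mult_le_cancel_right1)
    then show ?thesis unfolding K using f1 lg1 by (intro mult_left_mono mult_right_mono) auto
  qed
  also have "\<dots> \<le> 3/2 * real S" using S3 Kf(3) by linarith
  finally show "(f + 1) * lam \<le> 3/2 * real S" .
  show "real (4 * d) + 1 + 2 * real k * lam \<le> \<Delta>" if Sn: "22 * S \<le> n"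
  proof -
    have "22 * real S \<le> real n" using of_nat_mono[OF Sn, where 'a = real] by simp
    then have "ln (22 * real S) \<le> ln (real n)" using Spos by (subst ln_le_cancel_iff) auto
    also have "\<dots> \<le> 5/6 * L" using ln_card_le(1)[OF pos(1)] unfolding L_def .
    finally have "ln (22 * real S) \<le> L" using L1 by linarith
    then have "lam \<le> 11 * L * (166 * L\<^sup>2)"
      unfolding lam_def by (intro mult_right_mono mult_left_mono) auto
    also have "\<dots> = 1826 * L ^ 3" by (simp add: power3_eq_cube power2_eq_square)
    finally have "2 * real k * lam \<le> 2 * real k * (1826 * L ^ 3)" by (intro mult_left_mono) auto
    also have "\<dots> = 3652 * (real k * L ^ 3)" by simp
    also have "\<dots> \<le> 3652 * (real d * a)" using ka(2) da(1) by linarith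
    finally have "4 * real d + 1 + 2 * real k * lam \<le> 1000000 * (real d * a)" using da a1 by argo
    then show ?thesis unfolding \<Delta> by simp
  qed
qed

section \<open>From the given family to the abstract layered graph\<close>

lemma partition_layer:
  assumes "ordered_partition V Ls"
  obtains lay where "\<And>v. v \<in> V \<Longrightarrow> lay v < length Ls \<and> v \<in> Ls ! lay v"
    "\<And>v i. i < length Ls \<Longrightarrow> v \<in> Ls ! i \<Longrightarrow> lay v = i"
proof -
  have part: "distinct Ls" "\<Union>(set Ls) = V" "disjoint (set Ls)"
    using assms unfolding ordered_partition_def partition_on_def by auto
  have uniq: "i = j" if "i < length Ls" "j < length Ls" "v \<in> Ls ! i" "v \<in> Ls ! j" for v i j
  proof (rule ccontr)
    assume "i \<noteq> j"
    then have "Ls ! i \<noteq> Ls ! j" using part(1) that nth_eq_iff_index_eq by metis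
    then have "Ls ! i \<inter> Ls ! j = {}" using part(3) that unfolding disjoint_def by simp
    then show False using that by blast
  qed
  define lay where "lay v = (SOME i. i < length Ls \<and> v \<in> Ls ! i)" for v
  have lay: "lay v < length Ls \<and> v \<in> Ls ! lay v" if "i < length Ls" "v \<in> Ls ! i" for v i
    unfolding lay_def using that by (intro someI[of "\<lambda>i. i < length Ls \<and> v \<in> Ls ! i"]) blast
  show ?thesis
  proof (rule that)
    show "lay v < length Ls \<and> v \<in> Ls ! lay v" if "v \<in> V" for v
    proof -
      obtain A where "A \<in> set Ls" "v \<in> A" using part(2) \<open>v \<in> V\<close> by blast
      then show ?thesis using lay by (metis in_set_conv_nth)
    qed
    show "lay v = i" if "i < length Ls" "v \<in> Ls ! i" for v i
      using uniq lay[OF that] that by blast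
  qed
qed

text \<open>The number of layers is a bound for every member, so the \<open>LEAST\<close> in
  \<open>thickness\<close> is attained.\<close>

lemma thickness_bound:
  assumes "thickness Ls \<F> \<le> k" "A \<in> \<F>"
  shows "card {L \<in> set Ls. A \<inter> L \<noteq> {}} \<le> k"
proof -
  have "\<forall>A\<in>\<F>. card {L \<in> set Ls. A \<inter> L \<noteq> {}} \<le> card (set Ls)" by (auto intro: card_mono)
  then have "\<forall>A\<in>\<F>. card {L \<in> set Ls. A \<inter> L \<noteq> {}} \<le> thickness Ls \<F>"
    unfolding thickness_def by (rule LeastI)
  then show ?thesis using assms by fastforce
qed

lemma centers_eq_sources:
  "centers G Ls = sources (pverts G) (parcs (layer_digraph G Ls))"
  unfolding centers_def sources_def in_arcs_def by auto

lemma descendants_eq_Image: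
  assumes "pair_graph G" "w \<in> pverts G"
  shows "descendants G Ls w = (parcs (layer_digraph G Ls))\<^sup>* `` {w}"
proof -
  let ?D = "parcs (layer_digraph G Ls)"
  have D: "?D \<subseteq> pverts G \<times> pverts G" using pair_graph_arcs[OF assms(1)] unfolding layer_digraph_def by auto
  have V: "pverts (layer_digraph G Ls) = pverts G" unfolding layer_digraph_def by simp
  have "(w, v) \<in> rtrancl_on (pverts G) ?D \<longleftrightarrow> (w, v) \<in> ?D\<^sup>*" for v
  proof
    assume "(w, v) \<in> rtrancl_on (pverts G) ?D"
    then show "(w, v) \<in> ?D\<^sup>*"
      by (induction rule: rtrancl_on_induct) (auto intro: rtrancl.rtrancl_into_rtrancl)
  next
    assume "(w, v) \<in> ?D\<^sup>*"
    then show "(w, v) \<in> rtrancl_on (pverts G) ?D"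
      by (induction rule: rtrancl_induct) (use assms(2) D in \<open>auto intro: rtrancl_on_into_rtrancl_on\<close>)
  qed
  then show ?thesis unfolding descendants_def reachable_def by (auto simp: V)
qed

lemma layered_graph_layer_digraph:
  assumes G: "pair_graph G" and part: "ordered_partition (pverts G) Ls"
    and wit: "neighborhood_witnessing t G (layered_family G Ls)"
    and thick: "thickness Ls (layered_family G Ls) \<le> k"
  shows "layered_graph (pverts G) (parcs G) (parcs (layer_digraph G Ls)) k t"
proof -
  let ?V = "pverts G" and ?E = "parcs G" and ?D = "parcs (layer_digraph G Ls)"
  obtain lay where lay: "\<And>v. v \<in> ?V \<Longrightarrow> lay v < length Ls \<and> v \<in> Ls ! lay v"
    "\<And>v i. i < length Ls \<Longrightarrow> v \<in> Ls ! i \<Longrightarrow> lay v = i"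
    using partition_layer[OF part] by blast
  have DE: "?D \<subseteq> ?E" unfolding layer_digraph_def by auto
  have EV: "?E \<subseteq> ?V \<times> ?V" using pair_graph_arcs[OF G] .
  have finV: "finite ?V" using pair_graph_finite[OF G] .
  have down: "lay v < lay u" if uv: "(u, v) \<in> ?D" for u v
  proof -
    obtain i j where "i < length Ls" "j < i" "u \<in> Ls ! i" "v \<in> Ls ! j"
      using uv unfolding layer_digraph_def by auto
    then show ?thesis using lay(2)[of i u] lay(2)[of j v] by simp
  qed
  have src: "w \<in> ?V" if "w \<in> sources ?V ?D" for w using that unfolding sources_def by simp
  have mem: "?D\<^sup>* `` {w} \<in> layered_family G Ls" if "w \<in> sources ?V ?D" for w
    using that descendants_eq_Image[OF G src[OF that]] unfolding layered_family_def centers_eq_sources by blast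
  have reachV: "v \<in> ?V" if "(w, v) \<in> ?D\<^sup>*" "w \<in> ?V" for w v
    using that by (induction rule: rtrancl_induct) (use DE EV in auto)
  show ?thesis
  proof
    show "finite ?V" by (rule finV)
    show "?E \<subseteq> ?V \<times> ?V" by (rule EV)
    show "sym ?E" by (rule pair_graph_sym[OF G])
    show "?D \<subseteq> ?E" by (rule DE)
    show "j < k" if w: "w \<in> sources ?V ?D" and j: "(w, v) \<in> ?D ^^ j" for w v j
    proof -
      let ?F = "?D\<^sup>* `` {w}"
      obtain xs where xs: "length xs = Suc j" "successively (\<lambda>a b. (a, b) \<in> ?D) xs" "\<forall>z\<in>set xs. (w, z) \<in> ?D\<^sup>*"
        using relpow_list[OF j] by blast
      have "successively (\<lambda>a b. lay b < lay a) xs" using xs(2) by (rule successively_mono) (rule down)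
      moreover have "transp (\<lambda>a b. lay b < lay a)" by (auto intro: transpI)
      ultimately have "sorted_wrt (\<lambda>a b. lay b < lay a) xs" using successively_conv_sorted_wrt by blast
      then have dist: "distinct (map lay xs)"
        by (induction xs) auto
      have inV: "z \<in> ?V" if "z \<in> set xs" for z using reachV xs(3) src[OF w] that by blast
      have "inj_on (\<lambda>i. Ls ! i) {..<length Ls}"
        using part unfolding ordered_partition_def by (auto simp: inj_on_def nth_eq_iff_index_eq)
      moreover have "lay ` set xs \<subseteq> {..<length Ls}" using lay(1) inV by blast
      ultimately have "card ((\<lambda>i. Ls ! i) ` lay ` set xs) = card (lay ` set xs)"
        by (meson card_image inj_on_subset)
      also have "\<dots> = Suc j" using distinct_card[OF dist] xs(1) by simp
      \<comment> \<open>The j + 1 vertices of a path with j arcs lie in as many layers, all of them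
        met by the member; hence j < k.\<close>
      finally have "Suc j = card ((\<lambda>i. Ls ! i) ` lay ` set xs)" ..
      also have "\<dots> \<le> card {L \<in> set Ls. ?F \<inter> L \<noteq> {}}"
      proof (rule card_mono)
        show "(\<lambda>i. Ls ! i) ` lay ` set xs \<subseteq> {L \<in> set Ls. ?F \<inter> L \<noteq> {}}"
          using lay(1) inV xs(3) by fastforce
      qed simp
      also have "\<dots> \<le> k" using thickness_bound[OF thick mem[OF w]] .
      finally show ?thesis by simp
    qed
    show "\<exists>w\<in>sources ?V ?D. (w, v) \<in> ?D\<^sup>*" if "v \<in> ?V" for v
      using that
    \<comment> \<open>Passing to an in-neighbour raises the layer index, which is bounded by the
      number of layers.\<close>
    proof (induction "length Ls - lay v" arbitrary: v rule: less_induct)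
      case less
      show ?case
      proof (cases "v \<in> sources ?V ?D")
        case True
        then show ?thesis by blast
      next
        case False
        then obtain u where u: "(u, v) \<in> ?D" using less.prems unfolding sources_def by blast
        then have "u \<in> ?V" using DE EV by blast
        then have "length Ls - lay u < length Ls - lay v" using down[OF u] lay(1)[of u] by linarith
        then obtain w where "w \<in> sources ?V ?D" "(w, u) \<in> ?D\<^sup>*" using less.hyps \<open>u \<in> ?V\<close> by blast
        then show ?thesis using u by (meson rtrancl.rtrancl_into_rtrancl)
      qed
    qed
    show "card (?E `` {v} - ?D\<^sup>* `` {w}) \<le> t" if w: "w \<in> sources ?V ?D" "(w, v) \<in> ?D\<^sup>*" for w v
    proof -
      let ?A = "closed_nbhd G v - ?D\<^sup>* `` {w}"
      have "closed_nbhd G v \<subseteq> insert v ?V" unfolding closed_nbhd_def nbhd_def using EV by blast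
      then have "finite ?A" using finV by (meson finite_Diff finite_insert finite_subset)
      moreover have "?E `` {v} - ?D\<^sup>* `` {w} \<subseteq> ?A" unfolding closed_nbhd_def nbhd_def by auto
      ultimately have "card (?E `` {v} - ?D\<^sup>* `` {w}) \<le> card ?A" by (rule card_mono)
      also have "\<dots> \<le> t"
        using wit mem[OF w(1)] reachV[OF w(2) src[OF w(1)]] w(2) unfolding neighborhood_witnessing_def by blast
      finally show ?thesis .
    qed
  qed
qed

text \<open>The separator is a balanced bag of an optimal tree decomposition of the subgraph induced
  by \<open>U\<close>; the \<open>+ 1\<close> is the difference between bag size and width.\<close>

lemma has_balanced_separators_treewidth:
  assumes graphs: "\<forall>H\<in>\<C>. pair_graph H" and closed: "induced_subgraph_closed \<C>"
    and tw: "\<forall>H\<in>\<C>. treewidth H \<le> max_degree H ^ c" and G: "G \<in> \<C>"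
    and lay: "layered_graph (pverts G) (parcs G) D k t" and \<Delta>: "0 \<le> \<Delta>"
  shows "layered_graph.has_balanced_separators (pverts G) (parcs G) \<Delta> (\<Delta> ^ c + 1)"
proof -
  interpret layered_graph "pverts G" "parcs G" D k t by (rule lay)
  have pG: "pair_graph G" using graphs G by blast
  show ?thesis unfolding has_balanced_separators_def
  proof (intro allI impI)
    fix U X
    assume U: "U \<subseteq> pverts G" and X: "X \<subseteq> U"
      and deg: "\<forall>v\<in>U. real (card (parcs G `` {v} \<inter> U)) \<le> \<Delta>"
    define H where "H = \<lparr>pverts = U, parcs = parcs G \<inter> U \<times> U\<rparr>"
    have pH: "pair_graph H" unfolding H_def
    proof (rule pair_graphI)
      show "finite U" using U finite_V finite_subset by blast
      show "sym (parcs G \<inter> U \<times> U)" using sym_E unfolding sym_def by blast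
      show "irrefl (parcs G \<inter> U \<times> U)" using pair_graph_irrefl[OF pG] unfolding irrefl_def by blast
    qed blast
    have wf: "wf_digraph (with_proj G)" "wf_digraph (with_proj H)"
      using pair_graph_arcs[OF pG] pair_graph_arcs[OF pH] by (unfold_locales; auto)+
    have "induced_subgraph (with_proj H) (with_proj G)"
      unfolding induced_subgraph_def subgraph_def compatible_def using wf U by (auto simp: H_def)
    then have HC: "H \<in> \<C>" using closed G unfolding induced_subgraph_closed_def by blast
    have "real (max_degree H) \<le> \<Delta>"
    proof (cases "U = {}")
      case True
      then show ?thesis using \<Delta> unfolding max_degree_def H_def by simp
    next
      case False
      have fin: "finite ((\<lambda>v. card (nbhd H v)) ` U)" using pair_graph_finite[OF pH] unfolding H_def by simp
      have "max_degree H = Max ((\<lambda>v. card (nbhd H v)) ` U)"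
        unfolding max_degree_def using False cSup_eq_Max[OF fin] by (simp add: H_def)
      then obtain v where v: "v \<in> U" "max_degree H = card (nbhd H v)"
        using Max_in[OF fin] False by auto
      have "nbhd H v = parcs G `` {v} \<inter> U" using v unfolding nbhd_def H_def by auto
      then show ?thesis using v deg by simp
    qed
    then have "real (max_degree H) ^ c \<le> \<Delta> ^ c" by (rule power_mono) simp
    moreover have "real (treewidth H) \<le> real (max_degree H ^ c)" using tw HC by (intro of_nat_mono) blast
    ultimately have tH: "real (treewidth H) \<le> \<Delta> ^ c" unfolding of_nat_power by linarith
    obtain T :: "nat pair_pre_digraph" and bag where T: "tree_decomposition H T bag"
      "\<And>x. x \<in> pverts T \<Longrightarrow> card (bag x) \<le> treewidth H + 1"
      using treewidth_decomposition[OF pH] by blast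
    have "X \<subseteq> pverts H" using X unfolding H_def by simp
    from tree_decomposition_balanced_bag[OF pH T(1) this]
    obtain x where x: "x \<in> pverts T"
      "\<forall>u\<in>pverts H - bag x. 2 * card {v \<in> X. linked (parcs H) (pverts H - bag x) u v} \<le> card X" by blast
    have "bag x \<subseteq> U" using T(1) x(1) unfolding tree_decomposition_def H_def by auto
    moreover have "real (card (bag x)) \<le> \<Delta> ^ c + 1" using of_nat_mono[OF T(2)[OF x(1)], where 'a = real] tH by simp
    moreover have "\<forall>u\<in>U - bag x. 2 * card {v \<in> X. linked (parcs G) (U - bag x) u v} \<le> card X"
      using x(2) linked_restrict_arcs[of "U - bag x" U "parcs G"] unfolding H_def by simp
    ultimately show "\<exists>Z\<subseteq>U. real (card Z) \<le> \<Delta> ^ c + 1 \<and>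
      (\<forall>u\<in>U - Z. 2 * card {v \<in> X. linked (parcs G) (U - Z) u v} \<le> card X)" by blast
  qed
qed

theorem theorem8p5:
  fixes c d k :: nat
    and \<C> :: "'a pair_pre_digraph set"
    and G :: "'a pair_pre_digraph"
    and Ls :: "'a set list"
    and \<F> :: "'a set set"
    and X :: "'a set"
  assumes "c > 0" and "d > 0"
    and "\<forall>H\<in>\<C>. pair_graph H"
    and "induced_subgraph_closed \<C>"
    and "\<forall>H\<in>\<C>. treewidth H \<le> max_degree H ^ c"
    and "G \<in> \<C>"
    and "degeneracy G \<le> d"
    and "k > 0"
    and "ordered_partition (pverts G) Ls"
    and "\<F> = layered_family G Ls"
    and "neighborhood_witnessing (4 * d) G \<F>"
    and "thickness Ls \<F> \<le> k"
    and "X \<subseteq> centers G Ls"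
  shows "let n = real (card (pverts G));
             f = (1000000 * real d * (real k)^2 * (log 2 (2 * n))^3) ^ c
         in \<exists>(T :: nat pair_pre_digraph) (bag :: nat \<Rightarrow> 'a set) r.
              rooted_tree_decomposition G T bag r \<and>
              (\<Union>w\<in>X. descendants G Ls w) \<subseteq> bag r \<and>
              (\<forall>x\<in>pverts T. \<exists>X'. X' \<subseteq> centers G Ls \<and>
                 real (card X') \<le>
                   max (real (card X)) (110000 * real k * (log 2 (2 * n))^2 * (f * log 2 (4 * f)))
                   + 5000 * real k * (log 2 (2 * n))^2 * (f * log 2 (4 * f)) \<and>
                 bag x = (\<Union>w\<in>X'. descendants G Ls w))"
proof -
  define n where "n = card (pverts G)"
  define L where "L = log 2 (2 * real n)"
  define \<Delta> where "\<Delta> = 1000000 * real d * (real k)\<^sup>2 * L ^ 3"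
  define f where "f = \<Delta> ^ c"
  define K where "K = real k * L\<^sup>2 * (f * log 2 (4 * f))"
  have G: "pair_graph G" using assms(3,6) by blast
  let ?D = "parcs (layer_digraph G Ls)"
  have lg: "layered_graph (pverts G) (parcs G) ?D k (4 * d)"
    using layered_graph_layer_digraph[OF G assms(9)] assms(10,11,12) by blast
  interpret layered_graph "pverts G" "parcs G" ?D k "4 * d" by (rule lg)
  have Cn: "centers G Ls = Cn" by (rule centers_eq_sources)
  have FU: "(\<Union>w\<in>Y. descendants G Ls w) = FU Y" if "Y \<subseteq> Cn" for Y
    using that descendants_eq_Image[OF G] Cn_subset by fastforce
  have X: "X \<subseteq> Cn" using assms(13) Cn by simp
  have main: "\<exists>(T :: nat pair_pre_digraph) bag r. rooted_tree_decomposition G T bag r \<and>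
      FU X \<subseteq> bag r \<and> (\<forall>x\<in>pverts T. \<exists>X'\<subseteq>Cn. real (card X') \<le> max (real (card X)) (110000 * K) + 5000 * K \<and> bag x = FU X')"
  proof (cases "n = 0")
    case True
    \<comment> \<open>Here log 2 0 = 0 by convention, so K = 0, and one node with the empty bag
      meets the bound.\<close>
    then have V: "pverts G = {}" using finite_V unfolding n_def by simp
    then have E: "parcs G = {}" and X0: "X = {}" using E_subset X Cn_subset by auto
    have "tree_decomposition G (parent_tree 1 (\<lambda>_. 0)) (\<lambda>_. {})"
      by (rule tree_decomposition_parent_tree) (auto simp: V E)
    moreover have "K = 0" unfolding K_def f_def \<Delta>_def L_def True using assms(1) by (simp add: log_def)
    ultimately show ?thesis unfolding rooted_tree_decomposition_def X0
      by (intro exI[of _ "parent_tree 1 (\<lambda>_. 0)"] exI[of _ "\<lambda>_. {}"] exI[of _ 0])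
         (auto simp: parent_tree_def intro!: exI[of _ "{}"])
  next
    case False
    then have n: "0 < n" by simp
    define S where "S = nat \<lfloor>5000 * K\<rfloor> - 1"
    note P = game_parameters[OF n assms(1,2,8), folded L_def, folded \<Delta>_def, folded f_def, folded K_def, folded S_def]
    have "0 \<le> \<Delta>" unfolding \<Delta>_def L_def using n by simp
    then have sep: "has_balanced_separators \<Delta> (f + 1)"
      using has_balanced_separators_treewidth[OF assms(3,4,5,6) lg] unfolding f_def by blast
    have split: "splits_centers S" unfolding splits_centers_def
    proof (intro allI impI)
      fix W X assume W: "W \<subseteq> Cn" and X: "X \<subseteq> W" and c: "22 * S \<le> card X"
      \<comment> \<open>A set \<open>X\<close> with 22S centers exists only if 22S \<le> |V|, which
        is what the degree bound of \<open>game_parameters\<close> asks for.\<close>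
      have "card X \<le> n" unfolding n_def using X W Cn_subset finite_V by (intro card_mono) auto
      then have "22 * S \<le> n" using c by simp
      from P(5)[OF this] show "\<exists>Y\<subseteq>W. card Y \<le> S \<and> (\<forall>u\<in>FU W - FU Y. card {v \<in> X. linked (parcs G) (FU W - FU Y) u v} + S < card X)"
        using balanced_separator[OF W X c P(1) sep, folded n_def, folded L_def] P(3,4) by blast
    qed
    \<comment> \<open>110000 = 22 * 5000 ensures 22 (S + 1) \<le> M, and a bag then has at most M +
      S + 1 centers.\<close>
    define M where "M = max (card X) (nat \<lfloor>110000 * K\<rfloor>)"
    have K0: "0 \<le> K" using P(2) by simp
    have "real (22 * (S + 1)) \<le> 110000 * K" using P(2) by simp
    then have "22 * (S + 1) \<le> nat \<lfloor>110000 * K\<rfloor>" by (simp add: le_nat_floor)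
    then have M: "22 * (S + 1) \<le> M" "card X \<le> M" unfolding M_def by auto
    have "real M \<le> max (real (card X)) (110000 * K)" unfolding M_def using K0 by (simp add: of_nat_max) linarith
    then have MS: "real (M + (S + 1)) \<le> max (real (card X)) (110000 * K) + 5000 * K" using P(2) by simp
    obtain N :: nat and par bag where N: "0 < N" "\<forall>i. 0 < i \<longrightarrow> i < N \<longrightarrow> par i < i" "bag 0 = FU X"
      "\<forall>i<N. \<exists>X\<subseteq>Cn. card X \<le> M + (S + 1) \<and> bag i = FU X"
      "\<forall>(u, v)\<in>parcs G. \<exists>i<N. u \<in> bag i \<and> v \<in> bag i"
      "\<forall>v\<in>pverts G. \<exists>r<N. v \<in> bag r \<and> (\<forall>i<N. v \<in> bag i \<longrightarrow> i \<noteq> r \<longrightarrow> 0 < i \<and> v \<in> bag (par i))"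
      using layered_tree_decomposition[OF split M X] by (elim exE conjE) (rule that)
    have "tree_decomposition G (parent_tree N par) bag"
    proof (rule tree_decomposition_parent_tree)
      show "bag i \<subseteq> pverts G" if "i < N" for i using N(4) FU_subset that by blast
    qed (use N in auto)
    moreover have "\<exists>X'\<subseteq>Cn. real (card X') \<le> max (real (card X)) (110000 * K) + 5000 * K \<and> bag x = FU X'"
      if x: "x < N" for x
    proof -
      obtain X' where X': "X' \<subseteq> Cn" "card X' \<le> M + (S + 1)" "bag x = FU X'" using N(4) x by blast
      have "real (card X') \<le> real (M + (S + 1))" using X'(2) by (rule of_nat_mono)
      then show ?thesis using X' MS by (intro exI[of _ X']) auto
    qed
    moreover have "pverts (parent_tree N par) = {..<N}" unfolding parent_tree_def by simp
    ultimately show ?thesis unfolding rooted_tree_decomposition_def using N(1,3)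
      by (intro exI[of _ "parent_tree N par"] exI[of _ bag] exI[of _ 0]) auto
  qed
  obtain T :: "nat pair_pre_digraph" and bag r where T: "rooted_tree_decomposition G T bag r" "FU X \<subseteq> bag r"
    "\<forall>x\<in>pverts T. \<exists>X'\<subseteq>Cn. real (card X') \<le> max (real (card X)) (110000 * K) + 5000 * K \<and> bag x = FU X'"
    using main by blast
  have K: "110000 * real k * L\<^sup>2 * (f * log 2 (4 * f)) = 110000 * K" "5000 * real k * L\<^sup>2 * (f * log 2 (4 * f)) = 5000 * K"
    unfolding K_def by simp_all
  have "\<forall>x\<in>pverts T. \<exists>X'. X' \<subseteq> centers G Ls \<and>
      real (card X') \<le> max (real (card X)) (110000 * K) + 5000 * K \<and> bag x = (\<Union>w\<in>X'. descendants G Ls w)"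
    using T(3) FU unfolding Cn by metis
  moreover have "(\<Union>w\<in>X. descendants G Ls w) \<subseteq> bag r" using T(2) FU[OF X] by simp
  ultimately show ?thesis
    unfolding Let_def n_def[symmetric] L_def[symmetric] \<Delta>_def[symmetric] f_def[symmetric] K
    using T(1) by blast
qed

end
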